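(* Under the standing hypotheses (H1)–(H6) below, suppose $\tau$ is in the limit-circle case at both endpoints and $S$ is a self-adjoint restriction of $T_{\max}$. Then for each $z\in\rho(S)$ the resolvent $R_z=(S-z)^{-1}$ is an integral operator $$R_zf(x)=\int_a^b G_z(x,y)f(y)\,d\varrho(y),\qquad f\in L^2((a,b);\varrho),$$ with a kernel $G_z$ square integrable with respect to $\varrho\otimes\varrho$. Moreover, for any two linearly independent solutions $u_1,u_2$ of $(\tau-z)u=0$ there are coefficients $m^\pm_{ij}(z)\in\mathbb{C}$, $i,j\in\{1,2\}$, such that $$G_z(x,y)=\begin{cases}\sum_{i,j=1}^2 m^+_{ij}(z)u_i(x)u_j(y), & y<x,\\ \sum_{i,j=1}^2 m^-_{ij}(z)u_i(x)u_j(y), & y\ge x.\end{cases}$$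
   Context: Let $-\infty\le a<b\le\infty$ and $\varrho,\varsigma,\chi$ locally finite Borel measures on $(a,b)$ with: (H1) $\varrho$ positive; (H2) $\chi$ real-valued; (H3) $\varsigma$ real-valued with $\operatorname{supp}\varsigma=(a,b)$; (H4) $\varsigma(\{x\})\chi(\{x\})=\varsigma(\{x\})\varrho(\{x\})=0$ for all $x$; (H5) for every gap $(\alpha,\beta)$ of $\operatorname{supp}\varrho$ (open interval in the complement with $\alpha,\beta\in\operatorname{supp}\varrho$) and every $f\in\mathfrak{D}_\tau$ with $f(\alpha-)=f(\beta+)=0$ one has $f=0$ on $(\alpha,\beta)$; (H6) $\operatorname{supp}\varrho$ has more than one point. Notation: $\int_c^x h\,d\mu=\int_{[c,x)}h\,d\mu$ ($x>c$), $0$ ($x=c$), $-\int_{[x,c)}h\,d\mu$ ($x<c$); $AC_{loc}((a,b);\mu)$: functions $f(x)=f(c)+\int_c^x h\,d\mu$, $h=\frac{df}{d\mu}\in L^1_{loc}$. $\mathfrak{D}_\tau$: $f\in AC_{loc}((a,b);\varsigma)$ for which there is $F\in AC_{loc}((a,b);\varrho)$ with $F=-\frac{df}{d\varsigma}+\int_c^{\cdot}f\,d\chi$ $|\varsigma|$-a.e.; $\tau f:=\frac{dF}{d\varrho}$; solutions of $(\tau-z)u=0$ are $u\in\mathfrak{D}_\tau$ with $\tau u=zu$. In $L^2((a,b);\varrho)$: $T_{\max}=\{(f,\tau f): f\in\mathfrak{D}_\tau,\ f,\tau f\in L^2\}$ (a linear relation). $\tau$ is l.c. at an endpoint if for all $z$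 all solutions of $\tau u=zu$ are square-integrable w.r.t. $\varrho$ near it. A self-adjoint restriction of $T_{\max}$ is a linear relation $S\subseteq T_{\max}$ with $S=S^\ast$. For a linear relation $S$, $(S-z)^{-1}=\{(g-zf,f):(f,g)\in S\}$, and the resolvent set $\rho(S)$ is the set of $z\in\mathbb{C}$ for which $(S-z)^{-1}$ is an everywhere defined (single-valued) operator on $L^2((a,b);\varrho)$. *)

theory Defs
  imports "HOL-Analysis.Analysis"
begin

definition Iab :: "ereal \<Rightarrow> ereal \<Rightarrow> real set" where
  "Iab a b = {x. a < ereal x \<and> ereal x < b}"

definition lf_measure :: "ereal \<Rightarrow> ereal \<Rightarrow> real measure \<Rightarrow> bool" where
  "lf_measure a b M \<longleftrightarrow> sets M = sets borel \<and> emeasure M (- Iab a b) = 0 \<and>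
     (\<forall>K. compact K \<and> K \<subseteq> Iab a b \<longrightarrow> emeasure M K < \<infinity>)"

text \<open>A real-valued locally finite Borel measure on (a,b), given by its Jordan decomposition
  mu = mp - mn into two mutually singular positive locally finite measures;
  its variation is |mu| = mp + mn.\<close>
definition real_lf_measure :: "ereal \<Rightarrow> ereal \<Rightarrow> real measure \<Rightarrow> real measure \<Rightarrow> bool" where
  "real_lf_measure a b mp mn \<longleftrightarrow> lf_measure a b mp \<and> lf_measure a b mn \<and>
     (\<exists>A\<in>sets borel. emeasure mp (- A) = 0 \<and> emeasure mn A = 0)"

definition msupp :: "ereal \<Rightarrow> ereal \<Rightarrow> real measure \<Rightarrow> real set" where
  "msupp a b M = {x \<in> Iab a b. \<forall>e>0. emeasure M (ball x e) > 0}"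

definition rsupp :: "ereal \<Rightarrow> ereal \<Rightarrow> real measure \<Rightarrow> real measure \<Rightarrow> real set" where
  "rsupp a b mp mn = {x \<in> Iab a b. \<forall>e>0. emeasure mp (ball x e) > 0 \<or> emeasure mn (ball x e) > 0}"

definition rpoint :: "real measure \<Rightarrow> real measure \<Rightarrow> real \<Rightarrow> real" where
  "rpoint mp mn x = measure mp {x} - measure mn {x}"

definition pint :: "real measure \<Rightarrow> real \<Rightarrow> real \<Rightarrow> (real \<Rightarrow> complex) \<Rightarrow> complex" where
  "pint M c x h = (if c < x then set_lebesgue_integral M {c..<x} h
                   else if x = c then 0 else - set_lebesgue_integral M {x..<c} h)"

definition sint :: "real measure \<Rightarrow> real measure \<Rightarrow> real \<Rightarrow> real \<Rightarrow> (real \<Rightarrow> complex) \<Rightarrow> complex" where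
  "sint mp mn c x h = pint mp c x h - pint mn c x h"

definition loc_int :: "ereal \<Rightarrow> ereal \<Rightarrow> real measure \<Rightarrow> (real \<Rightarrow> complex) \<Rightarrow> bool" where
  "loc_int a b M h \<longleftrightarrow> (\<forall>\<alpha> \<beta>. \<alpha> \<in> Iab a b \<and> \<beta> \<in> Iab a b \<longrightarrow> set_integrable M {\<alpha>..\<beta>} h)"

definition AC_dens :: "ereal \<Rightarrow> ereal \<Rightarrow> real measure \<Rightarrow> (real \<Rightarrow> complex) \<Rightarrow> (real \<Rightarrow> complex) \<Rightarrow> bool" where
  "AC_dens a b M f h \<longleftrightarrow> loc_int a b M h \<and>
     (\<exists>c\<in>Iab a b. \<forall>x\<in>Iab a b. f x = f c + pint M c x h)"

definition rAC_dens :: "ereal \<Rightarrow> ereal \<Rightarrow> real measure \<Rightarrow> real measure \<Rightarrow> (real \<Rightarrow> complex) \<Rightarrow> (real \<Rightarrow> complex) \<Rightarrow> bool" where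
  "rAC_dens a b mp mn f h \<longleftrightarrow> loc_int a b mp h \<and> loc_int a b mn h \<and>
     (\<exists>c\<in>Iab a b. \<forall>x\<in>Iab a b. f x = f c + sint mp mn c x h)"

text \<open>tau_rel ... f g: f belongs to D_tau and g is (a version of) tau f = dF/drho, where
  F = - df/dsigma + int_c^. f dchi holds |sigma|-a.e.
  Measures: rho (positive), sigma = sp - sn, chi = cp - cn.\<close>
definition tau_rel :: "ereal \<Rightarrow> ereal \<Rightarrow> real measure \<Rightarrow> real measure \<Rightarrow> real measure \<Rightarrow>
    real measure \<Rightarrow> real measure \<Rightarrow> (real \<Rightarrow> complex) \<Rightarrow> (real \<Rightarrow> complex) \<Rightarrow> bool" where
  "tau_rel a b rho sp sn cp cn f g \<longleftrightarrow>
     (\<exists>h F c. c \<in> Iab a b \<and> rAC_dens a b sp sn f h \<and> AC_dens a b rho F g \<and>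
        (AE x in sp. x \<in> Iab a b \<longrightarrow> F x = - h x + sint cp cn c x f) \<and>
        (AE x in sn. x \<in> Iab a b \<longrightarrow> F x = - h x + sint cp cn c x f))"

definition Dtau :: "ereal \<Rightarrow> ereal \<Rightarrow> real measure \<Rightarrow> real measure \<Rightarrow> real measure \<Rightarrow>
    real measure \<Rightarrow> real measure \<Rightarrow> (real \<Rightarrow> complex) \<Rightarrow> bool" where
  "Dtau a b rho sp sn cp cn f \<longleftrightarrow> (\<exists>g. tau_rel a b rho sp sn cp cn f g)"

definition is_sol :: "ereal \<Rightarrow> ereal \<Rightarrow> real measure \<Rightarrow> real measure \<Rightarrow> real measure \<Rightarrow>
    real measure \<Rightarrow> real measure \<Rightarrow> complex \<Rightarrow> (real \<Rightarrow> complex) \<Rightarrow> bool" where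
  "is_sol a b rho sp sn cp cn z u \<longleftrightarrow> tau_rel a b rho sp sn cp cn u (\<lambda>x. z * u x)"

text \<open>Elements of L^2((a,b);rho) are represented by square-integrable functions;
  equality in L^2 is rho-a.e. equality.\<close>
definition L2 :: "real measure \<Rightarrow> (real \<Rightarrow> complex) \<Rightarrow> bool" where
  "L2 M f \<longleftrightarrow> f \<in> borel_measurable M \<and> integrable M (\<lambda>x. (cmod (f x))\<^sup>2)"

definition Tmax :: "ereal \<Rightarrow> ereal \<Rightarrow> real measure \<Rightarrow> real measure \<Rightarrow> real measure \<Rightarrow>
    real measure \<Rightarrow> real measure \<Rightarrow> ((real \<Rightarrow> complex) \<times> (real \<Rightarrow> complex)) set" where
  "Tmax a b rho sp sn cp cn = {(f, g). L2 rho f \<and> L2 rho g \<and>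
      (\<exists>f'. tau_rel a b rho sp sn cp cn f' g \<and> (AE x in rho. f x = f' x))}"

definition adj :: "real measure \<Rightarrow> ((real \<Rightarrow> complex) \<times> (real \<Rightarrow> complex)) set \<Rightarrow>
    ((real \<Rightarrow> complex) \<times> (real \<Rightarrow> complex)) set" where
  "adj M S = {(f, g). L2 M f \<and> L2 M g \<and>
      (\<forall>(u, v) \<in> S. (\<integral>x. g x * cnj (u x) \<partial>M) = (\<integral>x. f x * cnj (v x) \<partial>M))}"

text \<open>z is in the resolvent set: (S - z)^{-1} = {(g - z f, f) | (f,g) \<in> S} is an everywhere
  defined single-valued operator on L^2 (modulo rho-a.e. equality).\<close>
definition resolvent_set :: "real measure \<Rightarrow> ((real \<Rightarrow> complex) \<times> (real \<Rightarrow> complex)) set \<Rightarrow> complex set" where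
  "resolvent_set M S = {z.
     (\<forall>g. L2 M g \<longrightarrow> (\<exists>(f, h) \<in> S. AE x in M. h x - z * f x = g x)) \<and>
     (\<forall>(f1, h1) \<in> S. \<forall>(f2, h2) \<in> S.
        (AE x in M. h1 x - z * f1 x = h2 x - z * f2 x) \<longrightarrow> (AE x in M. f1 x = f2 x))}"

definition lc_left :: "ereal \<Rightarrow> ereal \<Rightarrow> real measure \<Rightarrow> real measure \<Rightarrow> real measure \<Rightarrow>
    real measure \<Rightarrow> real measure \<Rightarrow> bool" where
  "lc_left a b rho sp sn cp cn \<longleftrightarrow> (\<forall>z u. is_sol a b rho sp sn cp cn z u \<longrightarrow>
     (\<exists>c\<in>Iab a b. integrable rho (\<lambda>x. indicator {x. a < ereal x \<and> x < c} x * (cmod (u x))\<^sup>2)))"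

definition lc_right :: "ereal \<Rightarrow> ereal \<Rightarrow> real measure \<Rightarrow> real measure \<Rightarrow> real measure \<Rightarrow>
    real measure \<Rightarrow> real measure \<Rightarrow> bool" where
  "lc_right a b rho sp sn cp cn \<longleftrightarrow> (\<forall>z u. is_sol a b rho sp sn cp cn z u \<longrightarrow>
     (\<exists>c\<in>Iab a b. integrable rho (\<lambda>x. indicator {x. c < x \<and> ereal x < b} x * (cmod (u x))\<^sup>2)))"

definition standing_hyps :: "ereal \<Rightarrow> ereal \<Rightarrow> real measure \<Rightarrow> real measure \<Rightarrow> real measure \<Rightarrow>
    real measure \<Rightarrow> real measure \<Rightarrow> bool" where
  "standing_hyps a b rho sp sn cp cn \<longleftrightarrow>
     a < b \<and>
     lf_measure a b rho \<and>
     real_lf_measure a b cp cn \<and>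
     real_lf_measure a b sp sn \<and> rsupp a b sp sn = Iab a b \<and>
     (\<forall>x\<in>Iab a b. rpoint sp sn x * rpoint cp cn x = 0 \<and> rpoint sp sn x * measure rho {x} = 0) \<and>
     (\<forall>\<alpha> \<beta> f. \<alpha> < \<beta> \<and> {\<alpha><..<\<beta>} \<inter> msupp a b rho = {} \<and>
        \<alpha> \<in> msupp a b rho \<and> \<beta> \<in> msupp a b rho \<and>
        Dtau a b rho sp sn cp cn f \<and> (f \<longlongrightarrow> 0) (at_left \<alpha>) \<and> (f \<longlongrightarrow> 0) (at_right \<beta>)
        \<longrightarrow> (\<forall>x\<in>{\<alpha><..<\<beta>}. f x = 0)) \<and>
     (\<exists>x\<in>msupp a b rho. \<exists>y\<in>msupp a b rho. x \<noteq> y)"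

end

theory Submission
  imports Defs
begin

text \<open>
  All measures have bounded densities with respect to their sum \<open>nu\<close>, so \<open>\<tau> f = g\<close> is a first-order
  system for \<open>f\<close> and its quasi-derivative, driven by \<open>nu\<close>; by (H4) the coefficient matrix is
  nilpotent at every atom, which makes the system solvable in both directions and the Wronskian of
  two solutions constant. Let \<open>u1, u2\<close> be solutions for \<open>z\<close> with Wronskian 1. They are square
  integrable, and variation of constants from the left endpoint gives for each \<open>g\<close> a solution
  \<open>psol g\<close> of \<open>(\<tau> - z) f = g\<close>, with a kernel supported in \<open>y < x\<close>. If \<open>\<integral> u1 g = \<integral> u2 g = 0\<close>, then \<open>psol g\<close>
  vanishes at both endpoints in the sense of boundary forms, so \<open>(psol g, z psol g + g)\<close> lies in
  \<open>S\<^sup>* = S\<close> and \<open>psol g\<close> is the resolvent applied to \<open>g\<close>. Hence in general \<open>R\<^sub>z g - psol g\<close>, an element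
  of the span of \<open>u1, u2\<close>, is a linear function of the two numbers \<open>\<integral> u1 g, \<integral> u2 g\<close>.
\<close>

section \<open>Primitives with respect to a locally finite measure\<close>

text \<open>The obstacle is that all measures may have atoms. Primitives are then only
  left-continuous, and the Leibniz rule acquires the extra density \<open>p t * q t * nu{t}\<close>.
  (H4) removes this term whenever one factor comes from sigma and the other from chi or rho, which
  is what the Lagrange identity needs in order that the boundary form has a density with respect to
  rho alone. Atoms also spoil the usual estimate of iterated integrals by repeated integration by
  parts; the factorial is recovered by a combinatorial inequality for chains. A second difficulty is
  that elements of L2 are determined only rho-a.e., while solutions are functions on the whole
  interval. Changes on rho-null sets are therefore moved into the forcing term, which enters the
  system only with the factor \<open>r\<close>. The boundary conditions that single out S enter only
  through \<open>a1, b1, a2, b2\<close>, the coordinates relative to \<open>u1, u2\<close> of the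
  deviation from \<open>psol\<close> of the resolvent at two fixed functions
  \<open>e1, e2\<close>.\<close>

lemma Iab_interval: "\<lbrakk>x \<in> Iab a b; y \<in> Iab a b; x \<le> t; t \<le> y\<rbrakk> \<Longrightarrow> t \<in> Iab a b"
  unfolding Iab_def using less_le_trans[of a "ereal x" "ereal t"] le_less_trans[of "ereal t" "ereal y" b]
  by simp

lemma atLeastAtMost_subset_Iab: "\<lbrakk>x \<in> Iab a b; y \<in> Iab a b\<rbrakk> \<Longrightarrow> {x..y} \<subseteq> Iab a b"
  by (rule subsetI, rule Iab_interval[of x _ _ y]) simp_all

lemma open_Iab: "open (Iab a b)"
proof -
  have "Iab a b = ereal -` {a<..<b}" by (auto simp: Iab_def)
  moreover have "open (ereal -` {a<..<b})"
    by (intro open_ereal_vimage open_greaterThanLessThan)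
  ultimately show ?thesis by simp
qed

lemma Iab_borel [measurable]: "Iab a b \<in> sets borel"
  using open_Iab by (rule borel_open)

lemma Iab_rat_bounds:
  assumes "x \<in> Iab a b"
  shows "\<exists>\<alpha>\<in>\<rat>. \<exists>\<beta>\<in>\<rat>. \<alpha> \<in> Iab a b \<and> \<beta> \<in> Iab a b \<and> \<alpha> < x \<and> x < \<beta>"
proof -
  obtain e where e: "e > 0" "ball x e \<subseteq> Iab a b"
    using assms open_Iab open_contains_ball by blast
  obtain \<alpha> where \<alpha>: "\<alpha> \<in> \<rat>" "x - e < \<alpha>" "\<alpha> < x" using Rats_dense_in_real[of "x - e" x] e(1) by auto
  obtain \<beta> where \<beta>: "\<beta> \<in> \<rat>" "x < \<beta>" "\<beta> < x + e" using Rats_dense_in_real[of x "x + e"] e(1) by auto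
  have "\<alpha> \<in> ball x e" "\<beta> \<in> ball x e" using \<alpha> \<beta> by (auto simp: dist_real_def)
  then show ?thesis using \<alpha> \<beta> e(2) by blast
qed

text \<open>The countable cover consists of compact intervals with rational endpoints in (a, b),
  together with the complement of (a, b), which is a null set.\<close>

lemma lf_measure_sigma_finite:
  assumes "lf_measure a b M"
  shows "sigma_finite_measure M"
proof
  have sets: "sets M = sets borel" and null: "emeasure M (- Iab a b) = 0"
    and fin: "\<And>K. compact K \<Longrightarrow> K \<subseteq> Iab a b \<Longrightarrow> emeasure M K < \<infinity>"
    using assms unfolding lf_measure_def by auto
  define C where "C = (\<lambda>(\<alpha>, \<beta>). {\<alpha>..\<beta>}) ` ((\<rat> \<inter> Iab a b) \<times> (\<rat> \<inter> Iab a b))"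
  have "countable (\<rat> \<inter> Iab a b)"
    by (rule countable_subset[OF Int_lower1 countable_rat])
  then have "countable C" unfolding C_def by blast
  moreover have "x \<in> \<Union>C" if x: "x \<in> Iab a b" for x
  proof -
    obtain \<alpha> \<beta> where "\<alpha> \<in> \<rat>" "\<beta> \<in> \<rat>" "\<alpha> \<in> Iab a b" "\<beta> \<in> Iab a b" "\<alpha> < x" "x < \<beta>"
      using Iab_rat_bounds[OF x] by blast
    then have "x \<in> {\<alpha>..\<beta>}" "{\<alpha>..\<beta>} \<in> C" unfolding C_def by auto
    then show ?thesis by blast
  qed
  moreover have "emeasure M K < \<infinity>" if "K \<in> C" for K
    using that fin atLeastAtMost_subset_Iab unfolding C_def by fastforce
  moreover have "C \<subseteq> sets M" unfolding C_def sets by auto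
  ultimately show "\<exists>A. countable A \<and> A \<subseteq> sets M \<and> \<Union> A = space M \<and> (\<forall>a\<in>A. emeasure M a \<noteq> \<infinity>)"
    using null sets sets_eq_imp_space_eq[OF sets] Iab_borel[of a b]
    by (intro exI[of _ "insert (- Iab a b) C"]) (auto simp: less_top)
qed

text \<open>The oriented interval \<open>[c, x)\<close>, so that \<^const>\<open>pint\<close> becomes one integral with signed weight.\<close>
definition J :: "real \<Rightarrow> real \<Rightarrow> real \<Rightarrow> real" where
  "J c x t = indicator {c..<x} t - indicator {x..<c} t"

lemma J_measurable [measurable]: "(\<lambda>(c, x, t). J c x t) \<in> borel_measurable (borel \<Otimes>\<^sub>M borel \<Otimes>\<^sub>M borel)"
proof -
  have "(\<lambda>(c, x, t). J c x t) =
      (\<lambda>p. (if fst p \<le> snd (snd p) \<and> snd (snd p) < fst (snd p) then 1 else 0) -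
           (if fst (snd p) \<le> snd (snd p) \<and> snd (snd p) < fst p then 1 else (0::real)))"
    by (auto simp: J_def fun_eq_iff)
  then show ?thesis by simp
qed

lemma J_measurable3 [measurable (raw)]:
  assumes "f \<in> borel_measurable M" "g \<in> borel_measurable M" "h \<in> borel_measurable M"
  shows "(\<lambda>w. J (f w) (g w) (h w)) \<in> borel_measurable M"
  using measurable_compose[OF measurable_Pair[OF assms(1) measurable_Pair[OF assms(2,3)]] J_measurable]
  by simp

lemma J_add: "J x y t + J y w t = J x w t"
  by (auto simp: J_def indicator_def)

lemma J_flip: "J y x t = - J x y t" by (simp add: J_def)

lemma J_eq_indicator: "x \<le> y \<Longrightarrow> J x y t = indicator {x..<y} t" by (auto simp: J_def)

lemma abs_J_le: "\<bar>J x y t\<bar> \<le> 1" by (auto simp: J_def indicator_def)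

lemma J_zero: "t \<notin> {min x y..max x y} \<Longrightarrow> J x y t = 0" by (auto simp: J_def indicator_def)

lemma pint_eq_J: "pint M c x h = (\<integral>t. J c x t *\<^sub>R h t \<partial>M)"
  by (cases c x rule: linorder_cases) (auto simp: pint_def J_def set_lebesgue_integral_def)

section \<open>Local integrability and primitives for a fixed base measure\<close>

locale lf_space =
  fixes a b :: ereal and nu :: "real measure"
  assumes lf: "lf_measure a b nu"

sublocale lf_space \<subseteq> sigma_finite_measure nu
  using lf by (rule lf_measure_sigma_finite)

sublocale lf_space \<subseteq> pair: pair_sigma_finite nu nu ..

context lf_space
begin

abbreviation I :: "real set" where "I \<equiv> Iab a b"

abbreviation Lloc :: "(real \<Rightarrow> complex) \<Rightarrow> bool" where "Lloc \<equiv> loc_int a b nu"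

lemma sets_nu [simp, measurable_cong]: "sets nu = sets borel"
  using lf by (simp add: lf_measure_def)

lemma space_nu [simp]: "space nu = UNIV"
  using sets_eq_imp_space_eq[OF sets_nu] by simp

lemma AE_I: "AE t in nu. t \<in> I"
  using lf Iab_borel[of a b] by (intro AE_I'[of "- I"]) (auto simp: lf_measure_def null_sets_def)

lemma finite_compact: "\<lbrakk>\<alpha> \<in> I; \<beta> \<in> I\<rbrakk> \<Longrightarrow> emeasure nu {\<alpha>..\<beta>} < \<infinity>"
  using lf atLeastAtMost_subset_Iab[of \<alpha> a b \<beta>] by (simp add: lf_measure_def)

lemma min_max_I: "\<lbrakk>x \<in> I; y \<in> I\<rbrakk> \<Longrightarrow> min x y \<in> I \<and> max x y \<in> I"
  by (auto simp: min_def max_def)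

lemma Lloc_D: "\<lbrakk>Lloc h; \<alpha> \<in> I; \<beta> \<in> I\<rbrakk> \<Longrightarrow> integrable nu (\<lambda>t. indicator {\<alpha>..\<beta>} t *\<^sub>R h t)"
  unfolding loc_int_def set_integrable_def by blast

lemma integrable_weight:
  assumes h: "Lloc h" and ab: "\<alpha> \<in> I" "\<beta> \<in> I"
    and w: "w \<in> borel_measurable borel" "\<And>t. \<bar>w t\<bar> \<le> 1" "\<And>t. t \<notin> {\<alpha>..\<beta>} \<Longrightarrow> w t = 0"
  shows "integrable nu (\<lambda>t. w t *\<^sub>R h t)"
proof (rule Bochner_Integration.integrable_bound[OF Lloc_D[OF h ab]])
  \<comment> \<open>Measurability of \<open>h\<close> is known only after cutting it to a compact
    interval, so the cut is inserted before multiplying by the weight.\<close>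
  have "(\<lambda>t. w t *\<^sub>R h t) = (\<lambda>t. w t *\<^sub>R (indicator {\<alpha>..\<beta>} t *\<^sub>R h t))"
    using w(3) by (auto simp: fun_eq_iff indicator_def)
  moreover have "(\<lambda>t. w t *\<^sub>R (indicator {\<alpha>..\<beta>} t *\<^sub>R h t)) \<in> borel_measurable nu"
    using w(1) by (intro borel_measurable_scaleR[OF _ borel_measurable_integrable[OF Lloc_D[OF h ab]]]) simp
  ultimately show "(\<lambda>t. w t *\<^sub>R h t) \<in> borel_measurable nu" by simp
  show "AE t in nu. norm (w t *\<^sub>R h t) \<le> norm (indicator {\<alpha>..\<beta>} t *\<^sub>R h t)"
    using w(2,3) by (auto simp: indicator_def mult_left_le_one_le)
qed

lemma integrable_J:
  assumes "Lloc h" "x \<in> I" "y \<in> I"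
  shows "integrable nu (\<lambda>t. J x y t *\<^sub>R h t)"
  by (rule integrable_weight[OF assms(1), of "min x y" "max x y"])
     (use assms min_max_I abs_J_le J_zero in auto)

lemma Lloc_add: "\<lbrakk>Lloc f; Lloc g\<rbrakk> \<Longrightarrow> Lloc (\<lambda>t. f t + g t)"
  unfolding loc_int_def by (auto intro: set_integral_add)

lemma Lloc_diff: "\<lbrakk>Lloc f; Lloc g\<rbrakk> \<Longrightarrow> Lloc (\<lambda>t. f t - g t)"
  unfolding loc_int_def by (auto intro: set_integral_diff)

lemma Lloc_cmult: "Lloc f \<Longrightarrow> Lloc (\<lambda>t. c * f t)"
  unfolding loc_int_def by (auto intro: set_integrable_mult_right)

text \<open>The increment form has no distinguished base point, unlike \<open>AC_dens\<close>. With
  the half-open intervals [x, y) a primitive is left-continuous: an atom at t changes the values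
  only to the right of t.\<close>

definition prim :: "(real \<Rightarrow> complex) \<Rightarrow> (real \<Rightarrow> complex) \<Rightarrow> bool" where
  "prim f p \<longleftrightarrow> Lloc p \<and> (\<forall>x\<in>I. \<forall>y\<in>I. f y - f x = (\<integral>t. J x y t *\<^sub>R p t \<partial>nu))"

lemma primD: "\<lbrakk>prim f p; x \<in> I; y \<in> I\<rbrakk> \<Longrightarrow> f y = f x + (\<integral>t. J x y t *\<^sub>R p t \<partial>nu)"
  unfolding prim_def diff_eq_eq by (subst add.commute) blast

lemma prim_Lloc: "prim f p \<Longrightarrow> Lloc p" by (simp add: prim_def)

lemma integral_J_add:
  assumes "Lloc p" "x \<in> I" "y \<in> I" "w \<in> I"
  shows "(\<integral>t. J x w t *\<^sub>R p t \<partial>nu) = (\<integral>t. J x y t *\<^sub>R p t \<partial>nu) + (\<integral>t. J y w t *\<^sub>R p t \<partial>nu)"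
  unfolding J_add[of x y _ w, symmetric] scaleR_add_left
  by (intro Bochner_Integration.integral_add integrable_J assms)

lemma primI:
  assumes "Lloc p" "c \<in> I" "\<And>x. x \<in> I \<Longrightarrow> f x = d + (\<integral>t. J c x t *\<^sub>R p t \<partial>nu)"
  shows "prim f p"
proof -
  have "f y - f x = (\<integral>t. J x y t *\<^sub>R p t \<partial>nu)" if "x \<in> I" "y \<in> I" for x y
    using integral_J_add[OF assms(1,2) that] by (simp add: assms(3)[OF that(1)] assms(3)[OF that(2)])
  then show ?thesis using assms(1) by (simp add: prim_def)
qed

lemma prim_cong:
  assumes "prim f p" "\<And>x. x \<in> I \<Longrightarrow> f x = g x" "\<And>t. t \<in> I \<Longrightarrow> p t = q t"
  shows "prim g q"
proof -
  have *: "J x y t *\<^sub>R p t = J x y t *\<^sub>R q t" if "x \<in> I" "y \<in> I" for x y t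
  proof (cases "t \<in> {min x y..max x y}")
    case True
    then have "t \<in> I" using Iab_interval[of "min x y" a b "max x y" t] min_max_I[OF that] by simp
    then show ?thesis by (simp add: assms(3))
  qed (simp add: J_zero)
  have "Lloc q" unfolding loc_int_def set_integrable_def
  proof (intro allI impI)
    fix \<alpha> \<beta> assume ab: "\<alpha> \<in> I \<and> \<beta> \<in> I"
    have "(\<lambda>x. indicat_real {\<alpha>..\<beta>} x *\<^sub>R q x) = (\<lambda>x. indicat_real {\<alpha>..\<beta>} x *\<^sub>R p x)"
      using assms(3) atLeastAtMost_subset_Iab[of \<alpha> a b \<beta>] ab by (auto simp: indicator_def fun_eq_iff)
    then show "integrable nu (\<lambda>x. indicat_real {\<alpha>..\<beta>} x *\<^sub>R q x)"
      using Lloc_D[OF prim_Lloc[OF assms(1)]] ab by simp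
  qed
  moreover have "g y - g x = (\<integral>t. J x y t *\<^sub>R q t \<partial>nu)" if "x \<in> I" "y \<in> I" for x y
    unfolding assms(2)[OF that(1), symmetric] assms(2)[OF that(2), symmetric] *[OF that, symmetric]
    using assms(1) that by (simp add: prim_def)
  ultimately show ?thesis by (simp add: prim_def)
qed

lemma prim_add:
  assumes f: "prim f p" and g: "prim g q"
  shows "prim (\<lambda>x. f x + g x) (\<lambda>x. p x + q x)"
proof -
  have "(\<integral>t. J x y t *\<^sub>R (p t + q t) \<partial>nu) = (f y + g y) - (f x + g x)" if "x \<in> I" "y \<in> I" for x y
  proof -
    have "(\<integral>t. J x y t *\<^sub>R (p t + q t) \<partial>nu) = (\<integral>t. J x y t *\<^sub>R p t \<partial>nu) + (\<integral>t. J x y t *\<^sub>R q t \<partial>nu)"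
      unfolding scaleR_add_right
      by (intro Bochner_Integration.integral_add integrable_J[OF prim_Lloc[OF f] that] integrable_J[OF prim_Lloc[OF g] that])
    then show ?thesis by (simp add: primD[OF f that] primD[OF g that])
  qed
  then show ?thesis unfolding prim_def using Lloc_add[OF prim_Lloc[OF f] prim_Lloc[OF g]] by simp
qed

lemma prim_diff:
  assumes f: "prim f p" and g: "prim g q"
  shows "prim (\<lambda>x. f x - g x) (\<lambda>x. p x - q x)"
proof -
  have "(\<integral>t. J x y t *\<^sub>R (p t - q t) \<partial>nu) = (f y - g y) - (f x - g x)" if "x \<in> I" "y \<in> I" for x y
  proof -
    have "(\<integral>t. J x y t *\<^sub>R (p t - q t) \<partial>nu) = (\<integral>t. J x y t *\<^sub>R p t \<partial>nu) - (\<integral>t. J x y t *\<^sub>R q t \<partial>nu)"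
      unfolding scaleR_diff_right
      by (intro Bochner_Integration.integral_diff integrable_J[OF prim_Lloc[OF f] that] integrable_J[OF prim_Lloc[OF g] that])
    then show ?thesis by (simp add: primD[OF f that] primD[OF g that])
  qed
  then show ?thesis unfolding prim_def using Lloc_diff[OF prim_Lloc[OF f] prim_Lloc[OF g]] by simp
qed

lemma prim_cnj:
  assumes "prim f p" shows "prim (\<lambda>x. cnj (f x)) (\<lambda>x. cnj (p x))"
proof -
  have eq: "(\<lambda>t. w t *\<^sub>R cnj (p t)) = (\<lambda>t. cnj (w t *\<^sub>R p t))" for w :: "real \<Rightarrow> real"
    by simp
  have "Lloc (\<lambda>x. cnj (p x))"
  proof (unfold loc_int_def set_integrable_def eq, intro allI impI)
    fix \<alpha> \<beta> assume "\<alpha> \<in> I \<and> \<beta> \<in> I"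
    then show "integrable nu (\<lambda>t. cnj (indicator {\<alpha>..\<beta>} t *\<^sub>R p t))"
      using Lloc_D[OF prim_Lloc[OF assms], of \<alpha> \<beta>] by (intro integrable_cnj) blast
  qed
  moreover have "cnj (f y) - cnj (f x) = (\<integral>t. J x y t *\<^sub>R cnj (p t) \<partial>nu)" if "x \<in> I" "y \<in> I" for x y
  proof -
    have "(\<integral>t. J x y t *\<^sub>R cnj (p t) \<partial>nu) = cnj (\<integral>t. J x y t *\<^sub>R p t \<partial>nu)"
      unfolding eq by (rule Bochner_Integration.integral_cnj)
    then show ?thesis by (simp add: primD[OF assms that])
  qed
  ultimately show ?thesis by (simp add: prim_def)
qed

text \<open>Atoms make \<open>f\<close> discontinuous, so compactness alone does not help; the bound
  is the value at the left end plus the total mass of the density on the interval.\<close>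

lemma prim_bounded:
  assumes f: "prim f p" and ab: "\<alpha> \<in> I" "\<beta> \<in> I"
  shows "\<exists>B\<ge>0. \<forall>x\<in>{\<alpha>..\<beta>}. norm (f x) \<le> B"
proof (cases "\<alpha> \<le> \<beta>")
  case True
  define B where "B = norm (f \<alpha>) + (\<integral>t. norm (indicator {\<alpha>..\<beta>} t *\<^sub>R p t) \<partial>nu)"
  have "norm (f x) \<le> B" if x: "x \<in> {\<alpha>..\<beta>}" for x
  proof -
    have xI: "x \<in> I" using x Iab_interval[OF ab, of x] by simp
    have "norm (\<integral>t. J \<alpha> x t *\<^sub>R p t \<partial>nu) \<le> (\<integral>t. norm (J \<alpha> x t *\<^sub>R p t) \<partial>nu)"
      by (rule integral_norm_bound)
    also have "\<dots> \<le> (\<integral>t. norm (indicator {\<alpha>..\<beta>} t *\<^sub>R p t) \<partial>nu)"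
    proof (rule integral_mono)
      show "integrable nu (\<lambda>t. norm (J \<alpha> x t *\<^sub>R p t))"
        using integrable_J[OF prim_Lloc[OF f] ab(1) xI] by (rule integrable_norm)
      show "integrable nu (\<lambda>t. norm (indicator {\<alpha>..\<beta>} t *\<^sub>R p t))"
        using Lloc_D[OF prim_Lloc[OF f] ab] by (rule integrable_norm)
      show "norm (J \<alpha> x t *\<^sub>R p t) \<le> norm (indicator {\<alpha>..\<beta>} t *\<^sub>R p t)" for t
        using x by (auto simp: J_def indicator_def)
    qed
    finally show ?thesis unfolding B_def primD[OF f ab(1) xI] by (intro norm_triangle_le add_left_mono)
  qed
  moreover have "B \<ge> 0" unfolding B_def by simp
  ultimately show ?thesis by blast
qed (auto intro: exI[of _ 0])

text \<open>On the interval, \<open>f\<close> is a constant plus an integral depending on the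
  parameter x, with an integrand that is jointly measurable because \<open>J\<close> is and because
  the truncated density \<open>q\<close> is measurable on the whole line.\<close>

lemma prim_measurable:
  assumes f: "prim f p" and ab: "\<alpha> \<in> I" "\<beta> \<in> I"
  shows "(\<lambda>x. indicator {\<alpha>..\<beta>} x *\<^sub>R f x) \<in> borel_measurable borel"
proof -
  define q where "q = (\<lambda>t. indicator {\<alpha>..\<beta>} t *\<^sub>R p t)"
  have [measurable]: "q \<in> borel_measurable borel"
    using Lloc_D[OF prim_Lloc[OF f] ab] unfolding q_def by (auto dest: borel_measurable_integrable)
  have "(\<lambda>(x, t). J \<alpha> x t *\<^sub>R q t) \<in> borel_measurable (borel \<Otimes>\<^sub>M nu)" by measurable
  from borel_measurable_lebesgue_integral[OF this]
  have m: "(\<lambda>x. \<integral>t. J \<alpha> x t *\<^sub>R q t \<partial>nu) \<in> borel_measurable borel" by simp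
  have "indicator {\<alpha>..\<beta>} x *\<^sub>R f x = indicator {\<alpha>..\<beta>} x *\<^sub>R (f \<alpha> + (\<integral>t. J \<alpha> x t *\<^sub>R q t \<partial>nu))" for x
  proof (cases "x \<in> {\<alpha>..\<beta>}")
    case True
    then have "(\<lambda>t. J \<alpha> x t *\<^sub>R q t) = (\<lambda>t. J \<alpha> x t *\<^sub>R p t)"
      by (auto simp: q_def J_def indicator_def)
    then show ?thesis using True primD[OF f ab(1), of x] Iab_interval[OF ab, of x] by simp
  qed simp
  note eq = this
  have "(\<lambda>x. indicator {\<alpha>..\<beta>} x *\<^sub>R (f \<alpha> + (\<integral>t. J \<alpha> x t *\<^sub>R q t \<partial>nu))) \<in> borel_measurable borel"
    using m by simp
  then show ?thesis by (rule measurable_cong[THEN iffD2, rotated]) (rule eq)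
qed

lemma Lloc_mult_prim:
  assumes f: "prim f p" and h: "Lloc h"
  shows "Lloc (\<lambda>t. h t * f t)"
  unfolding loc_int_def set_integrable_def
proof (intro allI impI)
  fix \<alpha> \<beta> assume ab: "\<alpha> \<in> I \<and> \<beta> \<in> I"
  obtain B where B: "B \<ge> 0" "\<And>x. x \<in> {\<alpha>..\<beta>} \<Longrightarrow> norm (f x) \<le> B" using prim_bounded[OF f] ab by blast
  have eq: "(\<lambda>t. indicator {\<alpha>..\<beta>} t *\<^sub>R (h t * f t)) =
    (\<lambda>t. (indicator {\<alpha>..\<beta>} t *\<^sub>R h t) * (indicator {\<alpha>..\<beta>} t *\<^sub>R f t))"
    by (auto simp: indicator_def)
  show "integrable nu (\<lambda>t. indicator {\<alpha>..\<beta>} t *\<^sub>R (h t * f t))"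
  proof (rule Bochner_Integration.integrable_bound[of _ "\<lambda>t. B *\<^sub>R (indicator {\<alpha>..\<beta>} t *\<^sub>R h t)"])
    show "integrable nu (\<lambda>t. B *\<^sub>R (indicator {\<alpha>..\<beta>} t *\<^sub>R h t))"
      using ab by (intro integrable_scaleR_right Lloc_D[OF h]) simp_all
    show "(\<lambda>t. indicator {\<alpha>..\<beta>} t *\<^sub>R (h t * f t)) \<in> borel_measurable nu"
      unfolding eq using ab prim_measurable[OF f, of \<alpha> \<beta>]
      by (intro borel_measurable_times[OF borel_measurable_integrable[OF Lloc_D[OF h]]])
         (simp_all add: measurable_cong_sets[OF sets_nu refl])
    show "AE t in nu. norm (indicator {\<alpha>..\<beta>} t *\<^sub>R (h t * f t)) \<le> norm (B *\<^sub>R (indicator {\<alpha>..\<beta>} t *\<^sub>R h t))"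
    proof (intro AE_I2)
      fix t
      show "norm (indicator {\<alpha>..\<beta>} t *\<^sub>R (h t * f t)) \<le> norm (B *\<^sub>R (indicator {\<alpha>..\<beta>} t *\<^sub>R h t))"
      proof (cases "t \<in> {\<alpha>..\<beta>}")
        case True
        have "norm (h t) * norm (f t) \<le> norm (h t) * B"
          by (rule mult_left_mono[OF B(2)[OF True] norm_ge_zero])
        then show ?thesis using True B(1) by (simp add: norm_mult mult.commute[of B])
      qed simp
    qed
  qed
qed

lemma Lloc_mult_bounded:
  fixes s :: "real \<Rightarrow> real"
  assumes h: "Lloc h" and s: "s \<in> borel_measurable borel" "\<And>t. \<bar>s t\<bar> \<le> B"
  shows "Lloc (\<lambda>t. of_real (s t) * h t)"
  unfolding loc_int_def set_integrable_def
proof (intro allI impI)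
  fix \<alpha> \<beta> assume ab: "\<alpha> \<in> I \<and> \<beta> \<in> I"
  have eq: "(\<lambda>t. indicator {\<alpha>..\<beta>} t *\<^sub>R (of_real (s t) * h t)) = (\<lambda>t. s t *\<^sub>R (indicator {\<alpha>..\<beta>} t *\<^sub>R h t))"
    by (simp add: scaleR_conv_of_real mult_ac)
  show "integrable nu (\<lambda>t. indicator {\<alpha>..\<beta>} t *\<^sub>R (of_real (s t) * h t))"
    unfolding eq
  proof (rule Bochner_Integration.integrable_bound[of _ "\<lambda>t. B *\<^sub>R (indicator {\<alpha>..\<beta>} t *\<^sub>R h t)"])
    show "integrable nu (\<lambda>t. B *\<^sub>R (indicator {\<alpha>..\<beta>} t *\<^sub>R h t))"
      using ab by (intro integrable_scaleR_right Lloc_D[OF h]) simp_all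
    show "(\<lambda>t. s t *\<^sub>R (indicator {\<alpha>..\<beta>} t *\<^sub>R h t)) \<in> borel_measurable nu"
      using ab s(1) by (intro borel_measurable_scaleR[OF _ borel_measurable_integrable[OF Lloc_D[OF h]]]) simp_all
    show "AE t in nu. norm (s t *\<^sub>R (indicator {\<alpha>..\<beta>} t *\<^sub>R h t)) \<le> norm (B *\<^sub>R (indicator {\<alpha>..\<beta>} t *\<^sub>R h t))"
      unfolding norm_scaleR[of "s _"] norm_scaleR[of B]
      by (intro AE_I2 mult_right_mono order_trans[OF s(2) abs_ge_self] norm_ge_zero)
  qed
qed

lemma Lloc_const: "Lloc (\<lambda>_. c)"
  unfolding loc_int_def set_integrable_def using finite_compact
  by (intro allI impI integrable_scaleR_left integrable_real_indicator) simp_all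

section \<open>Double integrals and the Leibniz rule in the presence of atoms\<close>

lemma integrable_product:
  fixes f g :: "real \<Rightarrow> 'b::{real_normed_field, banach, second_countable_topology}"
  assumes f: "integrable nu f" and g: "integrable nu g"
  shows "integrable (nu \<Otimes>\<^sub>M nu) (\<lambda>(t, u). f t * g u)"
proof (rule pair.Fubini_integrable)
  note [measurable] = borel_measurable_integrable[OF f] borel_measurable_integrable[OF g]
  show "(\<lambda>(t, u). f t * g u) \<in> borel_measurable (nu \<Otimes>\<^sub>M nu)" by measurable
  show "AE t in nu. integrable nu (\<lambda>u. case (t, u) of (t, u) \<Rightarrow> f t * g u)" using g by simp
  show "integrable nu (\<lambda>t. \<integral>u. norm (case (t, u) of (t, u) \<Rightarrow> f t * g u) \<partial>nu)"
    using f g by (simp add: norm_mult)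
qed

text \<open>The atom term is what remains of an integrable function on the product space when it is
  restricted to the diagonal and one variable is integrated out: the section over t is the single
  point t. Fubini then gives integrability without enumerating the atoms.\<close>

lemma integrable_atoms:
  fixes f g :: "real \<Rightarrow> complex"
  assumes f: "integrable nu f" and g: "integrable nu g"
  shows "integrable nu (\<lambda>t. f t * g t * of_real (measure nu {t}))"
proof -
  let ?D = "\<lambda>t u. indicator {p. fst p = snd p} (t, u) *\<^sub>R (f t * g u)"
  have "{p. fst p = snd p} \<in> sets (borel \<Otimes>\<^sub>M (borel :: real measure))"
    unfolding borel_prod by (intro borel_closed closed_Collect_eq continuous_intros)
  then have "integrable (nu \<Otimes>\<^sub>M nu) (\<lambda>p. indicator {p. fst p = snd p} p *\<^sub>R (case p of (t, u) \<Rightarrow> f t * g u))"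
    by (intro integrable_mult_indicator integrable_product f g) auto
  then have "integrable (nu \<Otimes>\<^sub>M nu) (case_prod ?D)" by (simp add: case_prod_beta')
  then have "integrable nu (\<lambda>t. \<integral>u. ?D t u \<partial>nu)" by (rule pair.integrable_fst)
  moreover have "(\<integral>u. ?D t u \<partial>nu) = f t * g t * of_real (measure nu {t})" for t
  proof -
    have "?D t = (\<lambda>u. indicator {t} u *\<^sub>R (f t * g t))"
      by (auto simp: fun_eq_iff indicator_def)
    then show ?thesis by (simp add: scaleR_conv_of_real mult.commute)
  qed
  ultimately show ?thesis by simp
qed

lemma Lloc_atoms:
  assumes "Lloc p" "Lloc q"
  shows "Lloc (\<lambda>t. p t * q t * of_real (measure nu {t}))"
  unfolding loc_int_def set_integrable_def
proof (intro allI impI)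
  fix \<alpha> \<beta> assume ab: "\<alpha> \<in> I \<and> \<beta> \<in> I"
  have "(\<lambda>t. indicator {\<alpha>..\<beta>} t *\<^sub>R (p t * q t * of_real (measure nu {t}))) =
    (\<lambda>t. (indicator {\<alpha>..\<beta>} t *\<^sub>R p t) * (indicator {\<alpha>..\<beta>} t *\<^sub>R q t) * of_real (measure nu {t}))"
    by (auto simp: indicator_def)
  then show "integrable nu (\<lambda>t. indicator {\<alpha>..\<beta>} t *\<^sub>R (p t * q t * of_real (measure nu {t})))"
    using integrable_atoms[OF Lloc_D[OF assms(1)] Lloc_D[OF assms(2)]] ab by simp
qed

text \<open>The double integral is split along the diagonal, on which the atoms contribute.\<close>
lemma integral_mult_split:
  fixes f g :: "real \<Rightarrow> complex"
  assumes f: "integrable nu f" and g: "integrable nu g"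
  shows "(\<integral>t. f t \<partial>nu) * (\<integral>u. g u \<partial>nu) =
    (\<integral>t. f t * (\<integral>u. indicator {..<t} u *\<^sub>R g u \<partial>nu) + (\<integral>u. indicator {..<t} u *\<^sub>R f u \<partial>nu) * g t
        + f t * g t * of_real (measure nu {t}) \<partial>nu)"
proof -
  note [measurable] = borel_measurable_integrable[OF f] borel_measurable_integrable[OF g]
  let ?F = "\<lambda>t u. f t * g u"
  have F: "integrable (nu \<Otimes>\<^sub>M nu) (case_prod ?F)" by (rule integrable_product[OF f g])
  have ind: "integrable (nu \<Otimes>\<^sub>M nu) (\<lambda>(t, u). indicator A (t, u) *\<^sub>R ?F t u)"
    if A: "A \<in> sets (borel \<Otimes>\<^sub>M borel)" for A
  proof -
    have "integrable (nu \<Otimes>\<^sub>M nu) (\<lambda>p. indicator A p *\<^sub>R case_prod ?F p)"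
      using A F by (intro integrable_mult_indicator) auto
    then show ?thesis by (simp add: case_prod_beta')
  qed
  have A1: "{p. snd p < fst p} \<in> sets (borel \<Otimes>\<^sub>M (borel :: real measure))"
    and A2: "{p. fst p < snd p} \<in> sets (borel \<Otimes>\<^sub>M (borel :: real measure))"
    and A3: "{p. fst p = snd p} \<in> sets (borel \<Otimes>\<^sub>M (borel :: real measure))"
    unfolding borel_prod
    by (intro borel_open borel_closed open_Collect_less closed_Collect_eq continuous_intros)+
  define D1 where "D1 = (\<lambda>t u. indicator {p. snd p < fst p} (t, u) *\<^sub>R ?F t u)"
  define D2 where "D2 = (\<lambda>t u. indicator {p. fst p < snd p} (t, u) *\<^sub>R ?F t u)"
  define D3 where "D3 = (\<lambda>t u. indicator {p. fst p = snd p} (t, u) *\<^sub>R ?F t u)"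
  have D: "integrable (nu \<Otimes>\<^sub>M nu) (case_prod D1)" "integrable (nu \<Otimes>\<^sub>M nu) (case_prod D2)"
     "integrable (nu \<Otimes>\<^sub>M nu) (case_prod D3)"
    unfolding D1_def D2_def D3_def using ind[OF A1] ind[OF A2] ind[OF A3] by auto
  have F_D: "case_prod ?F = (\<lambda>p. case_prod D1 p + case_prod D2 p + case_prod D3 p)"
    by (auto simp: D1_def D2_def D3_def fun_eq_iff indicator_def)
  have i1: "(\<integral>u. D1 t u \<partial>nu) = f t * (\<integral>u. indicator {..<t} u *\<^sub>R g u \<partial>nu)" for t
  proof -
    have "D1 t = (\<lambda>u. f t * (indicator {..<t} u *\<^sub>R g u))"
      by (auto simp: D1_def fun_eq_iff indicator_def)
    then show ?thesis by (simp only: integral_mult_right_zero)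
  qed
  have i2: "(\<integral>t. D2 t u \<partial>nu) = (\<integral>t. indicator {..<u} t *\<^sub>R f t \<partial>nu) * g u" for u
  proof -
    have "(\<lambda>t. D2 t u) = (\<lambda>t. (indicator {..<u} t *\<^sub>R f t) * g u)"
      by (auto simp: D2_def fun_eq_iff indicator_def)
    then show ?thesis by (simp only: integral_mult_left_zero)
  qed
  have i3: "(\<integral>u. D3 t u \<partial>nu) = f t * g t * of_real (measure nu {t})" for t
  proof -
    have "D3 t = (\<lambda>u. indicator {t} u *\<^sub>R (f t * g t))"
      by (auto simp: D3_def fun_eq_iff indicator_def)
    then show ?thesis by (simp add: scaleR_conv_of_real mult.commute)
  qed
  have "(\<integral>t. f t \<partial>nu) * (\<integral>u. g u \<partial>nu) = (\<integral>t. (\<integral>u. ?F t u \<partial>nu) \<partial>nu)"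
    by simp
  also have "\<dots> = (\<integral>p. case_prod ?F p \<partial>(nu \<Otimes>\<^sub>M nu))"
    by (rule pair.integral_fst[OF F])
  also have "\<dots> = (\<integral>p. case_prod D1 p \<partial>(nu \<Otimes>\<^sub>M nu)) + (\<integral>p. case_prod D2 p \<partial>(nu \<Otimes>\<^sub>M nu))
     + (\<integral>p. case_prod D3 p \<partial>(nu \<Otimes>\<^sub>M nu))"
    unfolding F_D using D by simp
  \<comment> \<open>The triangle \<open>D2\<close> is integrated in the opposite order, so that in
    both triangles the inner variable runs below the outer one.\<close>
  also have "\<dots> = (\<integral>t. (\<integral>u. D1 t u \<partial>nu) \<partial>nu) + (\<integral>u. (\<integral>t. D2 t u \<partial>nu) \<partial>nu)
     + (\<integral>t. (\<integral>u. D3 t u \<partial>nu) \<partial>nu)"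
    by (simp only: pair.integral_fst[OF D(1)] pair.integral_snd[OF D(2)] pair.integral_fst[OF D(3)])
  also have "\<dots> = (\<integral>t. (\<integral>u. D1 t u \<partial>nu) + (\<integral>u. D2 u t \<partial>nu) + (\<integral>u. D3 t u \<partial>nu) \<partial>nu)"
    using pair.integrable_fst[OF D(1)] pair.integrable_snd[OF D(2)] pair.integrable_fst[OF D(3)] by simp
  finally show ?thesis unfolding i1 i2 i3 .
qed

text \<open>With P and Q the increments of \<open>f\<close> and \<open>g\<close> from x to y, the
  left side is \<open>f x * Q + P * g x + P * Q\<close>. Splitting P * Q along the diagonal supplies
  the increments from x to t, which turn the constants \<open>f x\<close> and \<open>g x\<close>
  into \<open>f t\<close> and \<open>g t\<close>; the diagonal gives the atom term.\<close>

lemma prim_mult_aux: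
  assumes f: "prim f p" and g: "prim g q" and xy: "x \<in> I" "y \<in> I" "x \<le> y"
    and L: "Lloc (\<lambda>t. p t * g t + f t * q t + p t * q t * of_real (measure nu {t}))" (is "Lloc ?h")
  shows "f y * g y - f x * g x = (\<integral>t. J x y t *\<^sub>R ?h t \<partial>nu)"
proof -
  let ?p = "\<lambda>t. J x y t *\<^sub>R p t" and ?q = "\<lambda>t. J x y t *\<^sub>R q t"
  have ip: "integrable nu ?p" and iq: "integrable nu ?q"
    using integrable_J prim_Lloc f g xy by auto
  have cut: "indicator {..<t} u *\<^sub>R J x y u *\<^sub>R w u = J x t u *\<^sub>R w u"
    if "t \<in> {x..<y}" for t u and w :: "real \<Rightarrow> complex"
    using that xy(3) by (auto simp: J_eq_indicator indicator_def)
  have "J x y t *\<^sub>R ?h t = f x * ?q t + ?p t * g x +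
     (?p t * (\<integral>u. indicator {..<t} u *\<^sub>R ?q u \<partial>nu) + (\<integral>u. indicator {..<t} u *\<^sub>R ?p u \<partial>nu) * ?q t
        + ?p t * ?q t * of_real (measure nu {t}))" for t
  proof (cases "t \<in> {x..<y}")
    case True
    then have t: "t \<in> I" using Iab_interval[OF xy(1,2), of t] by simp
    show ?thesis
      unfolding cut[OF True] primD[OF f xy(1) t] primD[OF g xy(1) t]
      using True xy(3) by (simp add: J_eq_indicator algebra_simps)
  qed (use xy(3) in \<open>auto simp: J_eq_indicator\<close>)
  note eq = this
  have i1: "integrable nu (\<lambda>t. f x * ?q t + ?p t * g x)"
    using ip iq by (intro Bochner_Integration.integrable_add integrable_mult_right integrable_mult_left)
  \<comment> \<open>Integrability of the split product is obtained by subtraction from the full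
    density \<open>?h\<close>, whose integrability is an assumption.\<close>
  have i2: "integrable nu (\<lambda>t. ?p t * (\<integral>u. indicator {..<t} u *\<^sub>R ?q u \<partial>nu) + (\<integral>u. indicator {..<t} u *\<^sub>R ?p u \<partial>nu) * ?q t
        + ?p t * ?q t * of_real (measure nu {t}))" (is "integrable nu ?r")
  proof -
    have "?r = (\<lambda>t. J x y t *\<^sub>R ?h t - (f x * ?q t + ?p t * g x))" by (simp add: eq)
    then show ?thesis using integrable_J[OF L xy(1,2)] i1 by (simp only: Bochner_Integration.integrable_diff)
  qed
  have "(\<integral>t. J x y t *\<^sub>R ?h t \<partial>nu) = f x * (\<integral>t. ?q t \<partial>nu) + (\<integral>t. ?p t \<partial>nu) * g x + (\<integral>t. ?p t \<partial>nu) * (\<integral>t. ?q t \<partial>nu)"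
    unfolding eq Bochner_Integration.integral_add[OF i1 i2] integral_mult_split[OF ip iq, symmetric]
      Bochner_Integration.integral_add[OF integrable_mult_right[OF iq] integrable_mult_left[OF ip]]
      integral_mult_right_zero integral_mult_left_zero ..
  also have "\<dots> = f y * g y - f x * g x"
    unfolding primD[OF f xy(1,2)] primD[OF g xy(1,2)] by (simp add: algebra_simps)
  finally show ?thesis by simp
qed

text \<open>The Leibniz rule for left-continuous functions: both factors are evaluated before the
  jump, so an atom contributes the product of the two jumps in addition to the two classical
  terms.\<close>

lemma prim_mult:
  assumes f: "prim f p" and g: "prim g q"
  shows "prim (\<lambda>x. f x * g x) (\<lambda>t. p t * g t + f t * q t + p t * q t * of_real (measure nu {t}))"
    (is "prim _ ?h")
proof -
  have h: "Lloc ?h"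
    using Lloc_add[OF Lloc_add[OF Lloc_mult_prim[OF g prim_Lloc[OF f]] Lloc_mult_prim[OF f prim_Lloc[OF g]]]
      Lloc_atoms[OF prim_Lloc[OF f] prim_Lloc[OF g]]]
    by (simp add: mult.commute)
  have "f y * g y - f x * g x = (\<integral>t. J x y t *\<^sub>R ?h t \<partial>nu)" if "x \<in> I" "y \<in> I" for x y
  proof (cases "x \<le> y")
    case True
    then show ?thesis using prim_mult_aux[OF f g that(1,2) _ h] by simp
  next
    case False
    then have "f x * g x - f y * g y = (\<integral>t. J y x t *\<^sub>R ?h t \<partial>nu)"
      using prim_mult_aux[OF f g that(2,1) _ h] by simp
    then show ?thesis unfolding J_flip[of x y] scaleR_minus_left integral_minus by (simp add: algebra_simps)
  qed
  then show ?thesis using h by (simp add: prim_def)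
qed

end

section \<open>The first-order system\<close>

text \<open>\<open>s\<close>, \<open>k\<close>, \<open>r\<close> are to be the densities of sigma,
  chi and rho with respect to \<open>nu\<close>. Since a point mass is the density times the mass of
  \<open>nu\<close> at the point, \<open>atoms\<close> is (H4) in this language.\<close>

locale sl_system = lf_space +
  fixes s k r :: "real \<Rightarrow> real"
  assumes meas [measurable]: "s \<in> borel_measurable borel" "k \<in> borel_measurable borel" "r \<in> borel_measurable borel"
    and bound: "\<bar>s t\<bar> \<le> 1" "\<bar>k t\<bar> \<le> 1" "0 \<le> r t" "r t \<le> 1"
    and atoms: "t \<in> I \<Longrightarrow> s t * k t * measure nu {t} = 0" "t \<in> I \<Longrightarrow> s t * r t * measure nu {t} = 0"
    and nonempty: "I \<noteq> {}"
begin

lemma abs_r: "\<bar>r t\<bar> \<le> 1" using bound(3,4)[of t] by simp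

abbreviation cs :: "real \<Rightarrow> complex" where "cs t \<equiv> complex_of_real (s t)"
abbreviation ck :: "real \<Rightarrow> complex" where "ck t \<equiv> complex_of_real (k t)"
abbreviation cr :: "real \<Rightarrow> complex" where "cr t \<equiv> complex_of_real (r t)"
abbreviation cm :: "real \<Rightarrow> complex" where "cm t \<equiv> complex_of_real (measure nu {t})"

lemma atoms_complex: "t \<in> I \<Longrightarrow> cs t * ck t * cm t = 0" "t \<in> I \<Longrightarrow> cs t * cr t * cm t = 0"
  using atoms[of t] by (simp_all flip: of_real_mult)

text \<open>The first-order system for \<open>f\<close> and its quasi-derivative \<open>f1\<close>, equivalent to \<open>\<tau> f = g\<close>.\<close>
definition Sys :: "(real \<Rightarrow> complex) \<Rightarrow> (real \<Rightarrow> complex) \<Rightarrow> (real \<Rightarrow> complex) \<Rightarrow> bool" where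
  "Sys f f1 g \<longleftrightarrow> prim f (\<lambda>t. cs t * f1 t) \<and> prim f1 (\<lambda>t. ck t * f t - cr t * g t)"

lemma Sys_diff:
  assumes "Sys f f1 g" "Sys v v1 h"
  shows "Sys (\<lambda>x. f x - v x) (\<lambda>x. f1 x - v1 x) (\<lambda>x. g x - h x)"
proof -
  have p: "prim f (\<lambda>t. cs t * f1 t)" "prim v (\<lambda>t. cs t * v1 t)"
    "prim f1 (\<lambda>t. ck t * f t - cr t * g t)" "prim v1 (\<lambda>t. ck t * v t - cr t * h t)"
    using assms by (simp_all add: Sys_def)
  have "prim (\<lambda>x. f x - v x) (\<lambda>t. cs t * (f1 t - v1 t))"
    by (rule prim_cong[OF prim_diff[OF p(1,2)]]) (simp_all add: algebra_simps)
  moreover have "prim (\<lambda>x. f1 x - v1 x) (\<lambda>t. ck t * (f t - v t) - cr t * (g t - h t))"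
    by (rule prim_cong[OF prim_diff[OF p(3,4)]]) (simp_all add: algebra_simps)
  ultimately show ?thesis by (simp add: Sys_def)
qed

lemma Sys_cnj:
  assumes "Sys f f1 g" shows "Sys (\<lambda>x. cnj (f x)) (\<lambda>x. cnj (f1 x)) (\<lambda>x. cnj (g x))"
  using prim_cnj[of f "\<lambda>t. cs t * f1 t"] prim_cnj[of f1 "\<lambda>t. ck t * f t - cr t * g t"] assms
  unfolding Sys_def by simp

lemma Sys_cong:
  assumes "Sys f f1 g" "\<And>x. x \<in> I \<Longrightarrow> g x = h x" shows "Sys f f1 h"
  using assms(1) prim_cong[of f1 "\<lambda>t. ck t * f t - cr t * g t" f1 "\<lambda>t. ck t * f t - cr t * h t"] assms(2)
  unfolding Sys_def by simp

text \<open>In each atom term of the Leibniz rule one jump has the factor \<open>cs\<close> and the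
  other is a combination of \<open>ck\<close> and \<open>cr\<close>, so the term vanishes by
  \<open>atoms_complex\<close>. Of the classical terms, those with \<open>cs\<close> and those with
  \<open>ck\<close> cancel by symmetry, and only the forcing is left.\<close>

lemma Lagrange_identity:
  assumes f: "Sys f f1 g" and v: "Sys v v1 h"
  shows "prim (\<lambda>x. f x * v1 x - f1 x * v x) (\<lambda>t. cr t * (g t * v t - f t * h t))"
proof -
  have p: "prim f (\<lambda>t. cs t * f1 t)" "prim f1 (\<lambda>t. ck t * f t - cr t * g t)"
      "prim v (\<lambda>t. cs t * v1 t)" "prim v1 (\<lambda>t. ck t * v t - cr t * h t)"
    using f v by (simp_all add: Sys_def)
  show ?thesis
  proof (rule prim_cong[OF prim_diff[OF prim_mult[OF p(1,4)] prim_mult[OF p(2,3)]]])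
    fix t assume "t \<in> I"
    note z = atoms_complex[OF this]
    have "cs t * f1 t * (ck t * v t - cr t * h t) * cm t =
       f1 t * v t * (cs t * ck t * cm t) - f1 t * h t * (cs t * cr t * cm t)"
      by (simp add: algebra_simps)
    also have "\<dots> = 0" by (simp add: z)
    finally have 1: "cs t * f1 t * (ck t * v t - cr t * h t) * cm t = 0" .
    have "(ck t * f t - cr t * g t) * (cs t * v1 t) * cm t =
       f t * v1 t * (cs t * ck t * cm t) - g t * v1 t * (cs t * cr t * cm t)"
      by (simp add: algebra_simps)
    also have "\<dots> = 0" by (simp add: z)
    finally have 2: "(ck t * f t - cr t * g t) * (cs t * v1 t) * cm t = 0" .
    show "cs t * f1 t * v1 t + f t * (ck t * v t - cr t * h t) + cs t * f1 t * (ck t * v t - cr t * h t) * cm t -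
       ((ck t * f t - cr t * g t) * v t + f1 t * (cs t * v1 t) + (ck t * f t - cr t * g t) * (cs t * v1 t) * cm t)
      = cr t * (g t * v t - f t * h t)"
      unfolding 1 2 by (simp add: algebra_simps)
  qed simp
qed

lemma prim_zero_const:
  assumes "prim f p" "\<And>t. p t = 0" "x \<in> I" "y \<in> I" shows "f x = f y"
  using primD[OF assms(1,3,4)] assms(2) by simp

lemma Wronskian_const:
  assumes "Sys f f1 (\<lambda>x. z * f x)" "Sys v v1 (\<lambda>x. z * v x)" "x \<in> I" "y \<in> I"
  shows "f x * v1 x - f1 x * v x = f y * v1 y - f1 y * v y"
  by (rule prim_zero_const[OF Lagrange_identity[OF assms(1,2)]]) (use assms in auto)

definition fundamental :: "complex \<Rightarrow> (real \<Rightarrow> complex) \<Rightarrow> (real \<Rightarrow> complex) \<Rightarrow> (real \<Rightarrow> complex) \<Rightarrow> (real \<Rightarrow> complex) \<Rightarrow> bool" where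
  "fundamental z u1 u1' u2 u2' \<longleftrightarrow> Sys u1 u1' (\<lambda>x. z * u1 x) \<and> Sys u2 u2' (\<lambda>x. z * u2 x) \<and>
     (\<forall>x\<in>I. u1 x * u2' x - u1' x * u2 x = 1)"

text \<open>Multiplying \<open>u\<close> by the Wronskian 1 of \<open>u1, u2\<close> and regrouping
  expresses \<open>u x\<close> through the Wronskians of \<open>u\<close> with \<open>u2\<close> and
  with \<open>u1\<close>, as in Cramer's rule. Both are constant, which yields the
  coefficients.\<close>

lemma solution_in_span:
  assumes F: "fundamental z u1 u1' u2 u2'" and u: "Sys u u' (\<lambda>x. z * u x)"
  shows "\<exists>c d. \<forall>x\<in>I. u x = c * u1 x + d * u2 x"
proof -
  obtain y where y: "y \<in> I" using nonempty by blast
  have u1: "Sys u1 u1' (\<lambda>x. z * u1 x)" and u2: "Sys u2 u2' (\<lambda>x. z * u2 x)"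
    and W: "\<And>x. x \<in> I \<Longrightarrow> u1 x * u2' x - u1' x * u2 x = 1" using F by (auto simp: fundamental_def)
  have "u x = (u y * u2' y - u' y * u2 y) * u1 x + (- (u y * u1' y - u' y * u1 y)) * u2 x" if x: "x \<in> I" for x
  proof -
    have "u x = u x * (u1 x * u2' x - u1' x * u2 x)" using W[OF x] by simp
    also have "\<dots> = (u x * u2' x - u' x * u2 x) * u1 x + (- (u x * u1' x - u' x * u1 x)) * u2 x"
      by (simp add: algebra_simps)
    also have "\<dots> = (u y * u2' y - u' y * u2 y) * u1 x + (- (u y * u1' y - u' y * u1 y)) * u2 x"
      unfolding Wronskian_const[OF u u2 x y] Wronskian_const[OF u u1 x y] ..
    finally show ?thesis .
  qed
  then show ?thesis by blast
qed

text \<open>The densities of \<open>A\<close> and \<open>B\<close> are chosen so that the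
  contributions to \<open>u1, u2\<close> cancel and those to \<open>u1', u2'\<close> add up to
  \<open>- cr * g\<close> by the Wronskian. In the first equation the atom terms vanish by (H4). In
  the second they have factors of chi and rho, about which (H4) is silent, but they are equal with
  opposite signs and cancel.\<close>

lemma variation_of_constants:
  assumes F: "fundamental z u1 u1' u2 u2'"
    and A: "prim A (\<lambda>t. cr t * (u2 t * g t))" and B: "prim B (\<lambda>t. - (cr t * (u1 t * g t)))"
  shows "Sys (\<lambda>x. A x * u1 x + B x * u2 x) (\<lambda>x. A x * u1' x + B x * u2' x)
     (\<lambda>x. z * (A x * u1 x + B x * u2 x) + g x)"
proof -
  have u: "prim u1 (\<lambda>t. cs t * u1' t)" "prim u1' (\<lambda>t. ck t * u1 t - cr t * (z * u1 t))"
      "prim u2 (\<lambda>t. cs t * u2' t)" "prim u2' (\<lambda>t. ck t * u2 t - cr t * (z * u2 t))"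
    and W: "\<And>x. x \<in> I \<Longrightarrow> u1 x * u2' x - u1' x * u2 x = 1" using F by (auto simp: fundamental_def Sys_def)
  have 1: "prim (\<lambda>x. A x * u1 x + B x * u2 x) (\<lambda>t. cs t * (A t * u1' t + B t * u2' t))"
  proof (rule prim_cong[OF prim_add[OF prim_mult[OF A u(1)] prim_mult[OF B u(3)]]])
    fix t assume "t \<in> I"
    note z = atoms_complex(2)[OF this]
    have 1: "cr t * (u2 t * g t) * (cs t * u1' t) * cm t = (cs t * cr t * cm t) * (u2 t * g t * u1' t)"
      and 2: "- (cr t * (u1 t * g t)) * (cs t * u2' t) * cm t = - (cs t * cr t * cm t) * (u1 t * g t * u2' t)"
      by (simp_all add: algebra_simps)
    show "cr t * (u2 t * g t) * u1 t + A t * (cs t * u1' t) + cr t * (u2 t * g t) * (cs t * u1' t) * cm t +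
       (- (cr t * (u1 t * g t)) * u2 t + B t * (cs t * u2' t) + - (cr t * (u1 t * g t)) * (cs t * u2' t) * cm t)
      = cs t * (A t * u1' t + B t * u2' t)"
      unfolding 1 2 z by (simp add: algebra_simps)
  qed simp
  have 2: "prim (\<lambda>x. A x * u1' x + B x * u2' x)
     (\<lambda>t. ck t * (A t * u1 t + B t * u2 t) - cr t * (z * (A t * u1 t + B t * u2 t) + g t))"
  proof (rule prim_cong[OF prim_add[OF prim_mult[OF A u(2)] prim_mult[OF B u(4)]]])
    fix t assume "t \<in> I"
    \<comment> \<open>The forcing is multiplied by the Wronskian 1 to bring it into the form
      produced by the densities of \<open>A\<close> and \<open>B\<close>.\<close>
    from W[OF this] have "cr t * g t = cr t * g t * (u1 t * u2' t - u1' t * u2 t)" by simp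
    then have g: "cr t * g t = cr t * g t * (u1 t * u2' t) - cr t * g t * (u1' t * u2 t)"
      by (simp only: right_diff_distrib)
    have "cr t * (u2 t * g t) * u1' t + A t * (ck t * u1 t - cr t * (z * u1 t)) +
         cr t * (u2 t * g t) * (ck t * u1 t - cr t * (z * u1 t)) * cm t +
       (- (cr t * (u1 t * g t)) * u2' t + B t * (ck t * u2 t - cr t * (z * u2 t)) +
         - (cr t * (u1 t * g t)) * (ck t * u2 t - cr t * (z * u2 t)) * cm t)
      = ck t * (A t * u1 t + B t * u2 t) - cr t * (z * (A t * u1 t + B t * u2 t))
        - (cr t * g t * (u1 t * u2' t) - cr t * g t * (u1' t * u2 t))"
      by (simp add: algebra_simps)
    then show "cr t * (u2 t * g t) * u1' t + A t * (ck t * u1 t - cr t * (z * u1 t)) +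
         cr t * (u2 t * g t) * (ck t * u1 t - cr t * (z * u1 t)) * cm t +
       (- (cr t * (u1 t * g t)) * u2' t + B t * (ck t * u2 t - cr t * (z * u2 t)) +
         - (cr t * (u1 t * g t)) * (ck t * u2 t - cr t * (z * u2 t)) * cm t)
      = ck t * (A t * u1 t + B t * u2 t) - cr t * (z * (A t * u1 t + B t * u2 t) + g t)"
      unfolding g[symmetric] by (simp add: algebra_simps)
  qed simp
  show ?thesis using 1 2 by (simp add: Sys_def)
qed

end

section \<open>Volterra equations\<close>

text \<open>Picard iteration for \<open>y x = y0 + \<integral>\<^bsub>{t. D x t}\<^esub> A t (y t)\<close> where \<open>D\<close> is a strict partial order:
  the iterated integrals over chains in \<open>{t. D x t}\<close> are bounded by \<open>N x ^ n / n!\<close> for the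
  mass \<open>N x\<close> of that set, even if the measure has atoms.\<close>
locale volterra = sigma_finite_measure M for M :: "'a measure" +
  fixes D :: "'a \<Rightarrow> 'a \<Rightarrow> bool"
  assumes D_meas [measurable]: "Measurable.pred (M \<Otimes>\<^sub>M M) (\<lambda>(x, t). D x t)"
    and D_trans: "D x t \<Longrightarrow> D t u \<Longrightarrow> D x u"
    and D_asym: "D x t \<Longrightarrow> \<not> D t x"
    and D_finite: "x \<in> space M \<Longrightarrow> emeasure M {t \<in> space M. D x t} < \<infinity>"
begin

definition dind :: "'a \<Rightarrow> 'a \<Rightarrow> real" where "dind x t = (if D x t then 1 else 0)"

lemma dind_measurable [measurable]: "(\<lambda>(x, t). dind x t) \<in> borel_measurable (M \<Otimes>\<^sub>M M)"
  unfolding dind_def by measurable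

lemma dind_measurable1 [measurable (raw)]:
  assumes "f \<in> measurable L M" "g \<in> measurable L M"
  shows "(\<lambda>w. dind (f w) (g w)) \<in> borel_measurable L"
  using measurable_compose[OF measurable_Pair[OF assms] dind_measurable] by simp

primrec chain :: "nat \<Rightarrow> 'a \<Rightarrow> ennreal" where
  "chain 0 x = 1"
| "chain (Suc n) x = (\<integral>\<^sup>+t. dind x t * chain n t \<partial>M)"

lemma chain_measurable [measurable]: "chain n \<in> borel_measurable M"
proof (induction n)
  case (Suc n)
  note [measurable] = Suc
  have "(\<lambda>x. \<integral>\<^sup>+t. dind x t * chain n t \<partial>M) \<in> borel_measurable M" by measurable
  then show ?case by simp
qed simp

definition N :: "'a \<Rightarrow> real" where "N x = measure M {t \<in> space M. D x t}"

lemma N_nonneg: "N x \<ge> 0" by (simp add: N_def)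

lemma chain_1:
  assumes x: "x \<in> space M" shows "(\<integral>\<^sup>+t. dind x t \<partial>M) = ennreal (N x)"
proof -
  have "(\<integral>\<^sup>+t. dind x t \<partial>M) = (\<integral>\<^sup>+t. indicator {t \<in> space M. D x t} t \<partial>M)"
    by (intro nn_integral_cong) (auto simp: dind_def)
  also have "\<dots> = emeasure M {t \<in> space M. D x t}" using x by (intro nn_integral_indicator) measurable
  finally show ?thesis using D_finite[OF x] by (simp add: N_def emeasure_eq_ennreal_measure)
qed

text \<open>Add one more free point u below x to a chain with first point t. The induction
  hypothesis bounds \<open>n + 1\<close> copies of the longer chain by the case where u lies below
  t, and Fubini identifies one further copy with the case where u lies between x and t. For fixed t
  these cases are disjoint and both are contained in the set of u below x, whose mass is
  \<open>N x\<close>. The diagonal u = t is only discarded, so atoms do no harm.\<close>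

lemma chain_step:
  assumes "x \<in> space M"
  shows "of_nat (Suc n) * chain (Suc n) x \<le> ennreal (N x) * chain n x"
  using assms
proof (induction n arbitrary: x)
  case 0
  then show ?case using chain_1 by simp
next
  case (Suc n)
  interpret P: pair_sigma_finite M M ..
  have [measurable]: "(\<lambda>t. dind x t) \<in> borel_measurable M" using Suc.prems by measurable
  have mt: "(\<lambda>u. dind t u) \<in> borel_measurable M" "(\<lambda>u. dind u t) \<in> borel_measurable M" if "t \<in> space M" for t
    using that by measurable
  have m2 [measurable]: "(\<lambda>(t, u). dind x t * chain n t * dind t u) \<in> borel_measurable (M \<Otimes>\<^sub>M M)"
      "(\<lambda>(t, u). dind x u * (dind u t * chain n t)) \<in> borel_measurable (M \<Otimes>\<^sub>M M)"
      "(\<lambda>(u, t). dind x u * (dind u t * chain n t)) \<in> borel_measurable (M \<Otimes>\<^sub>M M)"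
    using Suc.prems by measurable
  have "of_nat (Suc n) * chain (Suc (Suc n)) x = (\<integral>\<^sup>+t. dind x t * (of_nat (Suc n) * chain (Suc n) t) \<partial>M)"
    unfolding chain.simps(2)[of "Suc n"]
    by (subst nn_integral_cmult[symmetric]) (auto intro!: nn_integral_cong simp: mult_ac simp del: chain.simps of_nat_Suc)
  also have "\<dots> \<le> (\<integral>\<^sup>+t. dind x t * (ennreal (N t) * chain n t) \<partial>M)"
    by (intro nn_integral_mono mult_left_mono Suc.IH) auto
  also have "\<dots> = (\<integral>\<^sup>+t. \<integral>\<^sup>+u. dind x t * chain n t * dind t u \<partial>M \<partial>M)"
    using mt by (intro nn_integral_cong) (simp add: nn_integral_cmult chain_1, simp add: mult_ac)
  finally have 1: "of_nat (Suc n) * chain (Suc (Suc n)) x \<le> \<dots>" .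
  have "chain (Suc (Suc n)) x = (\<integral>\<^sup>+u. \<integral>\<^sup>+t. dind x u * (dind u t * chain n t) \<partial>M \<partial>M)"
    using mt by (subst chain.simps(2)) (auto intro!: nn_integral_cong simp: nn_integral_cmult)
  also have "\<dots> = (\<integral>\<^sup>+t. \<integral>\<^sup>+u. dind x u * (dind u t * chain n t) \<partial>M \<partial>M)"
    by (rule P.Fubini') (rule m2)
  finally have 2: "chain (Suc (Suc n)) x = \<dots>" .
  have "of_nat (Suc (Suc n)) * chain (Suc (Suc n)) x = of_nat (Suc n) * chain (Suc (Suc n)) x + chain (Suc (Suc n)) x"
    by (simp only: of_nat_Suc[of "Suc n"] distrib_right mult_1_left add.commute)
  also have "\<dots> \<le> (\<integral>\<^sup>+t. \<integral>\<^sup>+u. dind x t * chain n t * dind t u \<partial>M \<partial>M) +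
      (\<integral>\<^sup>+t. \<integral>\<^sup>+u. dind x u * (dind u t * chain n t) \<partial>M \<partial>M)"
    using 1 2 by (intro add_mono) simp_all
  also have "\<dots> = (\<integral>\<^sup>+t. (\<integral>\<^sup>+u. dind x t * chain n t * dind t u \<partial>M) +
      (\<integral>\<^sup>+u. dind x u * (dind u t * chain n t) \<partial>M) \<partial>M)"
    by (rule nn_integral_add[symmetric]; measurable)
  also have "\<dots> = (\<integral>\<^sup>+t. \<integral>\<^sup>+u. dind x t * chain n t * dind t u + dind x u * (dind u t * chain n t) \<partial>M \<partial>M)"
    using mt by (intro nn_integral_cong nn_integral_add[symmetric]) auto
  \<comment> \<open>Pointwise in t and u: asymmetry lets at most one summand be nonzero, and
    transitivity shows that each implies both \<open>D x t\<close> and \<open>D x u\<close>.\<close>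
  also have "\<dots> \<le> (\<integral>\<^sup>+t. \<integral>\<^sup>+u. dind x t * chain n t * dind x u \<partial>M \<partial>M)"
    by (intro nn_integral_mono) (auto simp: dind_def dest: D_trans D_asym)
  also have "\<dots> = (\<integral>\<^sup>+t. ennreal (N x) * (dind x t * chain n t) \<partial>M)"
    by (intro nn_integral_cong) (simp add: nn_integral_cmult chain_1[OF Suc.prems], simp add: mult_ac)
  also have "\<dots> = ennreal (N x) * chain (Suc n) x"
    by (simp add: nn_integral_cmult)
  finally show ?case .
qed

lemma chain_le:
  assumes x: "x \<in> space M"
  shows "chain n x \<le> ennreal (N x ^ n / fact n)"
proof (induction n)
  case (Suc n)
  have "of_nat (Suc n) * chain (Suc n) x \<le> ennreal (N x) * ennreal (N x ^ n / fact n)"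
    using chain_step[OF x, of n] mult_left_mono[OF Suc, of "ennreal (N x)"] by (auto intro: order_trans)
  then have "ennreal (1 / real (Suc n)) * (ennreal (real (Suc n)) * chain (Suc n) x)
     \<le> ennreal (1 / real (Suc n)) * (ennreal (N x) * ennreal (N x ^ n / fact n))"
    by (intro mult_left_mono) (auto simp: ennreal_of_nat_eq_real_of_nat)
  moreover have "ennreal (1 / real (Suc n)) * (ennreal (real (Suc n)) * chain (Suc n) x) = chain (Suc n) x"
    by (simp add: mult.assoc[symmetric] ennreal_mult'[symmetric] del: chain.simps of_nat_Suc)
  moreover have "ennreal (1 / real (Suc n)) * (ennreal (N x) * ennreal (N x ^ n / fact n)) = ennreal (N x ^ Suc n / fact (Suc n))"
    using N_nonneg[of x] by (simp add: ennreal_mult'[symmetric] mult_ac)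
  ultimately show ?case by metis
qed (simp add: x)

end

locale linear_volterra = volterra M D for M :: "'a measure" and D +
  fixes A :: "'a \<Rightarrow> 'b \<Rightarrow> 'b::{banach, second_countable_topology}" and C :: real and y0 :: 'b
  assumes A_linear: "bounded_linear (A t)"
    and A_bound: "norm (A t y) \<le> C * norm y"
    and A_meas: "f \<in> borel_measurable M \<Longrightarrow> (\<lambda>t. A t (f t)) \<in> borel_measurable M"
    and C_nonneg: "C \<ge> 0"
begin

text \<open>These are the terms of the Neumann series, not its partial sums; the solution is the sum
  over n.\<close>

primrec Y :: "nat \<Rightarrow> 'a \<Rightarrow> 'b" where
  "Y 0 x = y0"
| "Y (Suc n) x = (\<integral>t. dind x t *\<^sub>R A t (Y n t) \<partial>M)"

lemma Y_measurable [measurable]: "Y n \<in> borel_measurable M"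
proof (induction n)
  case (Suc n)
  note [measurable] = A_meas[OF Suc]
  have "(\<lambda>x. \<integral>t. dind x t *\<^sub>R A t (Y n t) \<partial>M) \<in> borel_measurable M" by measurable
  then show ?case by simp
qed simp

abbreviation K :: real where "K \<equiv> norm y0"

lemma Y_chain_step:
  assumes x: "x \<in> space M"
    and Y: "\<And>t. t \<in> space M \<Longrightarrow> ennreal (norm (Y n t)) \<le> ennreal (K * C ^ n) * chain n t"
  shows "(\<integral>\<^sup>+t. norm (dind x t *\<^sub>R A t (Y n t)) \<partial>M) \<le> ennreal (K * C ^ Suc n) * chain (Suc n) x"
proof -
  have [measurable]: "(\<lambda>t. dind x t) \<in> borel_measurable M" using x by measurable
  have "(\<integral>\<^sup>+t. norm (dind x t *\<^sub>R A t (Y n t)) \<partial>M) \<le> (\<integral>\<^sup>+t. ennreal (K * C ^ Suc n) * (dind x t * chain n t) \<partial>M)"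
  proof (rule nn_integral_mono)
    fix t assume t: "t \<in> space M"
    have "ennreal (norm (dind x t *\<^sub>R A t (Y n t))) \<le> ennreal (dind x t * (C * norm (Y n t)))"
      by (intro ennreal_leI) (auto simp: dind_def A_bound)
    also have "\<dots> = dind x t * (C * ennreal (norm (Y n t)))"
      using C_nonneg by (simp add: dind_def ennreal_mult)
    also have "\<dots> \<le> dind x t * (C * (ennreal (K * C ^ n) * chain n t))"
      by (intro mult_left_mono Y t) auto
    also have "\<dots> = ennreal (K * C ^ Suc n) * (dind x t * chain n t)"
      using C_nonneg by (simp add: ennreal_mult mult_ac)
    finally show "ennreal (norm (dind x t *\<^sub>R A t (Y n t))) \<le> ennreal (K * C ^ Suc n) * (dind x t * chain n t)" .
  qed
  also have "\<dots> = ennreal (K * C ^ Suc n) * chain (Suc n) x" by (simp add: nn_integral_cmult)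
  finally show ?thesis .
qed

lemma Y_chain: "x \<in> space M \<Longrightarrow> ennreal (norm (Y n x)) \<le> ennreal (K * C ^ n) * chain n x"
proof (induction n arbitrary: x)
  case (Suc n)
  \<comment> \<open>If the integrand is not integrable, its Bochner integral is 0 by convention and
    the estimate is trivial. Integrability itself is deduced from this estimate afterwards, in
    \<open>term_integrable\<close>.\<close>
  show ?case
  proof (cases "integrable M (\<lambda>u. dind x u *\<^sub>R A u (Y n u))")
    case True
    then have "ennreal (norm (Y (Suc n) x)) \<le> (\<integral>\<^sup>+u. norm (dind x u *\<^sub>R A u (Y n u)) \<partial>M)"
      by (simp only: Y.simps) (rule integral_norm_bound_ennreal)
    also have "\<dots> \<le> ennreal (K * C ^ Suc n) * chain (Suc n) x"
      by (rule Y_chain_step[OF Suc.prems Suc.IH])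
    finally show ?thesis .
  qed (simp add: not_integrable_integral_eq)
qed simp

lemma majorant:
  assumes "x \<in> space M"
  shows "ennreal (K * C ^ n) * chain n x \<le> ennreal (K * ((C * N x) ^ n / fact n))"
proof -
  have "ennreal (K * C ^ n) * chain n x \<le> ennreal (K * C ^ n) * ennreal (N x ^ n / fact n)"
    by (intro mult_left_mono chain_le assms) simp
  also have "\<dots> = ennreal (K * ((C * N x) ^ n / fact n))"
    using C_nonneg by (simp add: ennreal_mult'[symmetric] power_mult_distrib mult.assoc)
  finally show ?thesis .
qed

lemma majorant_nonneg: "0 \<le> K * ((C * N x) ^ n / fact n)"
  using C_nonneg N_nonneg by simp

lemma majorant_summable: "summable (\<lambda>n. K * ((C * N x) ^ n / fact n))"
  using summable_exp[of "C * N x"] by (intro summable_mult) (simp add: divide_inverse mult.commute)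

lemma Y_bound: "x \<in> space M \<Longrightarrow> norm (Y n x) \<le> K * ((C * N x) ^ n / fact n)"
  using order_trans[OF Y_chain majorant, of x n] majorant_nonneg by (simp add: ennreal_le_iff)

lemma term_integrable:
  assumes x: "x \<in> space M"
  shows "integrable M (\<lambda>t. dind x t *\<^sub>R A t (Y n t))"
    and "(\<integral>t. norm (dind x t *\<^sub>R A t (Y n t)) \<partial>M) \<le> K * ((C * N x) ^ Suc n / fact (Suc n))"
proof -
  have [measurable]: "(\<lambda>t. dind x t) \<in> borel_measurable M" using x by measurable
  note [measurable] = A_meas[OF Y_measurable]
  have le: "(\<integral>\<^sup>+t. norm (dind x t *\<^sub>R A t (Y n t)) \<partial>M) \<le> ennreal (K * ((C * N x) ^ Suc n / fact (Suc n)))"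
    using Y_chain_step[OF x Y_chain] majorant[OF x] by (rule order_trans)
  show int: "integrable M (\<lambda>t. dind x t *\<^sub>R A t (Y n t))"
    unfolding integrable_iff_bounded using le by (auto intro: le_less_trans)
  have "ennreal (\<integral>t. norm (dind x t *\<^sub>R A t (Y n t)) \<partial>M) = (\<integral>\<^sup>+t. norm (dind x t *\<^sub>R A t (Y n t)) \<partial>M)"
    using int by (intro nn_integral_eq_integral[symmetric] integrable_norm) auto
  then show "(\<integral>t. norm (dind x t *\<^sub>R A t (Y n t)) \<partial>M) \<le> K * ((C * N x) ^ Suc n / fact (Suc n))"
    using le majorant_nonneg by (metis ennreal_le_iff)
qed

lemma Y_summable: "x \<in> space M \<Longrightarrow> summable (\<lambda>n. norm (Y n x))"
  using Y_bound by (intro summable_comparison_test'[OF majorant_summable]) auto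

text \<open>The exponential series majorises \<open>Y n x\<close> and, shifted by one index, the
  integrals of the norms of the terms. The first gives pointwise convergence, the second permits
  termwise integration, which reproduces the series without its initial term.\<close>

theorem volterra_solution:
  "\<exists>y \<in> borel_measurable M. \<forall>x\<in>space M. integrable M (\<lambda>t. dind x t *\<^sub>R A t (y t)) \<and>
      y x = y0 + (\<integral>t. dind x t *\<^sub>R A t (y t) \<partial>M)"
proof (intro bexI ballI)
  define y where "y x = (\<Sum>n. Y n x)" for x
  show "y \<in> borel_measurable M" unfolding y_def by measurable
  fix x assume x: "x \<in> space M"
  let ?f = "\<lambda>n t. dind x t *\<^sub>R A t (Y n t)"
  have A: "(\<lambda>n. A t (Y n t)) sums A t (y t)" if "t \<in> space M" for t
    unfolding y_def
    by (rule bounded_linear.sums[OF A_linear[of t] summable_sums[OF summable_norm_cancel[OF Y_summable[OF that]]]])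
  have f: "(\<Sum>n. ?f n t) = dind x t *\<^sub>R A t (y t)" if "t \<in> space M" for t
    using sums_scaleR_right[OF A[OF that], of "dind x t"] by (simp add: sums_iff)
  have 1: "AE t in M. summable (\<lambda>n. norm (?f n t))"
  proof (rule AE_I2)
    fix t assume t: "t \<in> space M"
    have "norm (?f n t) \<le> C * norm (Y n t)" for n
      using A_bound[of t "Y n t"] C_nonneg by (simp add: dind_def)
    then show "summable (\<lambda>n. norm (?f n t))"
      by (intro summable_comparison_test'[OF summable_mult[OF Y_summable[OF t]]]) simp
  qed
  have 2: "summable (\<lambda>n. \<integral>t. norm (?f n t) \<partial>M)"
  proof (rule summable_comparison_test')
    show "summable (\<lambda>n. K * ((C * N x) ^ Suc n / fact (Suc n)))"
      using majorant_summable[of x] by (subst summable_Suc_iff)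
    show "norm (\<integral>t. norm (?f n t) \<partial>M) \<le> K * ((C * N x) ^ Suc n / fact (Suc n))" if "n \<ge> 0" for n
      using term_integrable(2)[OF x, of n] by (simp only: real_norm_def abs_of_nonneg Bochner_Integration.integral_nonneg norm_ge_zero)
  qed
  have "integrable M (\<lambda>t. \<Sum>n. ?f n t)"
    by (rule integrable_suminf[OF term_integrable(1)[OF x] 1 2])
  then have int: "integrable M (\<lambda>t. dind x t *\<^sub>R A t (y t))"
    by (rule Bochner_Integration.integrable_cong[THEN iffD1, rotated 2]) (simp_all only: f)
  have "y x = y0 + (\<Sum>n. Y (Suc n) x)"
    unfolding y_def using suminf_split_head[OF summable_norm_cancel[OF Y_summable[OF x]]] by simp
  also have "(\<Sum>n. Y (Suc n) x) = (\<integral>t. (\<Sum>n. ?f n t) \<partial>M)"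
    using integral_suminf[OF term_integrable(1)[OF x] 1 2] by simp
  also have "\<dots> = (\<integral>t. dind x t *\<^sub>R A t (y t) \<partial>M)"
    by (rule Bochner_Integration.integral_cong[OF refl f])
  finally show "integrable M (\<lambda>t. dind x t *\<^sub>R A t (y t)) \<and> y x = y0 + (\<integral>t. dind x t *\<^sub>R A t (y t) \<partial>M)"
    using int by blast
qed

end

section \<open>Initial value problems\<close>

context lf_space
begin

lemma measure_point_eq_integral: "(\<integral>t. indicator {x} t *\<^sub>R f t \<partial>nu) = of_real (measure nu {x}) * (f x :: complex)"
proof -
  have "(\<lambda>t. indicator {x} t *\<^sub>R f t) = (\<lambda>t. indicator {x} t *\<^sub>R f x)" by (auto simp: indicator_def)
  then show ?thesis by (simp add: scaleR_conv_of_real)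
qed

text \<open>The pair solves one equation in the product of two complex planes, with the off-diagonal
  operator that swaps the components and multiplies them by \<open>p\<close> and \<open>q\<close>;
  its norm is at most \<open>C\<close>. The family \<open>S\<close> is kept general to cover [c, x)
  and (x, c) alike. The order is made empty outside \<open>X\<close>, where the mass of
  \<open>S x\<close> need not be finite.\<close>

lemma coupled_volterra:
  fixes p q :: "real \<Rightarrow> complex" and S :: "real \<Rightarrow> real set"
  assumes p: "p \<in> borel_measurable borel" "\<And>t. norm (p t) \<le> C"
    and q: "q \<in> borel_measurable borel" "\<And>t. norm (q t) \<le> C"
    and S: "Measurable.pred (borel \<Otimes>\<^sub>M borel) (\<lambda>(x, t). x \<in> X \<and> t \<in> S x)"
      "\<And>x t w. t \<in> S x \<Longrightarrow> w \<in> S t \<Longrightarrow> w \<in> S x" "\<And>x t. t \<in> S x \<Longrightarrow> x \<notin> S t"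
      "\<And>x. x \<in> X \<Longrightarrow> emeasure nu (S x) < \<infinity>"
  obtains u v where "\<And>x. x \<in> X \<Longrightarrow> integrable nu (\<lambda>t. indicator (S x) t *\<^sub>R (p t * v t))"
    "\<And>x. x \<in> X \<Longrightarrow> integrable nu (\<lambda>t. indicator (S x) t *\<^sub>R (q t * u t))"
    "\<And>x. x \<in> X \<Longrightarrow> u x = u0 + (\<integral>t. indicator (S x) t *\<^sub>R (p t * v t) \<partial>nu)"
    "\<And>x. x \<in> X \<Longrightarrow> v x = v0 + (\<integral>t. indicator (S x) t *\<^sub>R (q t * u t) \<partial>nu)"
proof -
  define D where "D x t \<longleftrightarrow> x \<in> X \<and> t \<in> S x" for x t
  have D: "Measurable.pred (borel \<Otimes>\<^sub>M borel) (\<lambda>(x, t). D x t)"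
    "\<And>x t w. D x t \<Longrightarrow> D t w \<Longrightarrow> D x w" "\<And>x t. D x t \<Longrightarrow> \<not> D t x"
    using S(1,2,3) unfolding D_def by blast+
  have Dx: "{t. D x t} = (if x \<in> X then S x else {})" for x by (simp add: D_def)
  have D4: "emeasure nu {t. D x t} < \<infinity>" for x using S(4)[of x] by (simp add: Dx)
  have C: "C \<ge> 0" using p(2)[of 0] norm_ge_zero order_trans by blast
  let ?A = "\<lambda>t y. (p t * snd y, q t * fst y)"
  have sets2: "sets (nu \<Otimes>\<^sub>M nu) = sets (borel \<Otimes>\<^sub>M borel)"
    by (intro sets_pair_measure_cong sets_nu)
  have bnd: "norm (?A t y) \<le> C * norm y" for t y
  proof -
    have 1: "(norm (p t * snd y))\<^sup>2 \<le> (C * norm (snd y))\<^sup>2" and 2: "(norm (q t * fst y))\<^sup>2 \<le> (C * norm (fst y))\<^sup>2"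
      unfolding norm_mult by (intro power_mono mult_right_mono p q mult_nonneg_nonneg norm_ge_zero)+
    have "norm (?A t y) = sqrt ((norm (p t * snd y))\<^sup>2 + (norm (q t * fst y))\<^sup>2)"
      by (simp add: norm_Pair)
    also have "\<dots> \<le> sqrt ((C * norm (snd y))\<^sup>2 + (C * norm (fst y))\<^sup>2)"
      using 1 2 by (intro real_sqrt_le_mono add_mono)
    also have "\<dots> = sqrt (C\<^sup>2 * ((norm (fst y))\<^sup>2 + (norm (snd y))\<^sup>2))"
      by (simp add: algebra_simps power_mult_distrib)
    also have "\<dots> = C * norm y" using C by (simp add: real_sqrt_mult norm_prod_def)
    finally show ?thesis .
  qed
  interpret V: linear_volterra nu D ?A C "(u0, v0)"
  proof (intro linear_volterra.intro volterra.intro volterra_axioms.intro linear_volterra_axioms.intro)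
    show "Measurable.pred (nu \<Otimes>\<^sub>M nu) (\<lambda>(x, t). D x t)"
      using D(1) by (simp add: measurable_cong_sets[OF sets2 refl])
    show "bounded_linear (?A t)" for t
      by (intro bounded_linear_Pair bounded_linear_mult_right[THEN bounded_linear_compose]
          bounded_linear_fst bounded_linear_snd)
    show "(\<lambda>t. ?A t (f t)) \<in> borel_measurable nu" if "f \<in> borel_measurable nu" for f :: "real \<Rightarrow> complex \<times> complex"
    proof -
      note [measurable] = p(1) q(1)
      have c: "(\<lambda>y. fst y) \<in> borel_measurable (borel :: (complex \<times> complex) measure)"
          "(\<lambda>y. snd y) \<in> borel_measurable (borel :: (complex \<times> complex) measure)"
        by (intro borel_measurable_continuous_onI continuous_on_fst continuous_on_snd continuous_on_id)+
      note [measurable] = measurable_compose[OF that c(1)] measurable_compose[OF that c(2)]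
      show ?thesis by (intro borel_measurable_Pair) measurable
    qed
    show "sigma_finite_measure nu" by (rule sigma_finite_measure_axioms)
    show "D x w" if "D x t" "D t w" for x t w using D(2)[OF that] .
    show "\<not> D t x" if "D x t" for x t using D(3)[OF that] .
    show "emeasure nu {t \<in> space nu. D x t} < \<infinity>" for x using D4[of x] by simp
    show "norm (?A t y) \<le> C * norm y" for t y by (rule bnd)
    show "C \<ge> 0" by (rule C)
  qed
  obtain y where "\<forall>x\<in>space nu. integrable nu (\<lambda>t. V.dind x t *\<^sub>R ?A t (y t)) \<and>
    y x = (u0, v0) + (\<integral>t. V.dind x t *\<^sub>R ?A t (y t) \<partial>nu)"
    using V.volterra_solution by blast
  then have y: "integrable nu (\<lambda>t. V.dind x t *\<^sub>R ?A t (y t))"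
    "y x = (u0, v0) + (\<integral>t. V.dind x t *\<^sub>R ?A t (y t) \<partial>nu)" for x
    unfolding space_nu by blast+
  define u where "u = (\<lambda>x. fst (y x))"
  define v where "v = (\<lambda>x. snd (y x))"
  have d: "V.dind x t = indicator (S x) t" if "x \<in> X" for x t using that by (simp add: V.dind_def D_def)
  have 1: "(\<lambda>t. fst (V.dind x t *\<^sub>R ?A t (y t))) = (\<lambda>t. indicator (S x) t *\<^sub>R (p t * v t))"
    and 2: "(\<lambda>t. snd (V.dind x t *\<^sub>R ?A t (y t))) = (\<lambda>t. indicator (S x) t *\<^sub>R (q t * u t))" if "x \<in> X" for x
    by (simp_all add: d[OF that] u_def v_def)
  show ?thesis
  proof (rule that[of v u])
    fix x assume x: "x \<in> X"
    show "integrable nu (\<lambda>t. indicator (S x) t *\<^sub>R (p t * v t))"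
      using integrable_fst[OF y(1)[of x]] unfolding 1[OF x] .
    show "integrable nu (\<lambda>t. indicator (S x) t *\<^sub>R (q t * u t))"
      using integrable_snd[OF y(1)[of x]] unfolding 2[OF x] .
    show "u x = u0 + (\<integral>t. indicator (S x) t *\<^sub>R (p t * v t) \<partial>nu)"
      using arg_cong[OF y(2)[of x], of fst] integral_fst[OF y(1)[of x]] unfolding 1[OF x] u_def by simp
    show "v x = v0 + (\<integral>t. indicator (S x) t *\<^sub>R (q t * u t) \<partial>nu)"
      using arg_cong[OF y(2)[of x], of snd] integral_snd[OF y(1)[of x]] unfolding 2[OF x] v_def by simp
  qed
qed

lemma Lloc_glue:
  assumes c: "c \<in> I"
    and R: "\<And>x. x \<in> I \<Longrightarrow> integrable nu (\<lambda>t. indicator {c..<x} t *\<^sub>R w t)"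
    and L: "\<And>x. x \<in> I \<Longrightarrow> integrable nu (\<lambda>t. indicator {x<..<c} t *\<^sub>R w t)"
  shows "Lloc w"
  unfolding loc_int_def set_integrable_def
proof (intro allI impI)
  fix \<alpha> \<beta> assume ab: "\<alpha> \<in> I \<and> \<beta> \<in> I"
  \<comment> \<open>The endpoints are moved outward because both families of intervals omit the
    point x.\<close>
  obtain \<alpha>' \<beta>' where *: "\<alpha>' \<in> I" "\<beta>' \<in> I" "\<alpha>' < \<alpha>" "\<beta> < \<beta>'"
    using Iab_rat_bounds[of \<alpha> a b] Iab_rat_bounds[of \<beta> a b] ab by blast
  have "integrable nu (\<lambda>t. indicator {\<alpha>..\<beta>} t *\<^sub>R (indicator {c..<\<beta>'} t *\<^sub>R w t + indicator {\<alpha>'<..<c} t *\<^sub>R w t))"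
    by (intro integrable_mult_indicator Bochner_Integration.integrable_add R L *) simp
  moreover have "(\<lambda>t. indicator {\<alpha>..\<beta>} t *\<^sub>R (indicator {c..<\<beta>'} t *\<^sub>R w t + indicator {\<alpha>'<..<c} t *\<^sub>R w t))
     = (\<lambda>t. indicator {\<alpha>..\<beta>} t *\<^sub>R w t)"
    using * by (auto simp: fun_eq_iff indicator_def)
  ultimately show "integrable nu (\<lambda>t. indicator {\<alpha>..\<beta>} t *\<^sub>R w t)" by simp
qed

end

context sl_system
begin

lemma finite_right: "\<lbrakk>c \<in> I; x \<in> I\<rbrakk> \<Longrightarrow> emeasure nu {c..<x} < \<infinity>"
  by (rule le_less_trans[OF emeasure_mono finite_compact[of c x]]) auto

lemma finite_left: "\<lbrakk>c \<in> I; x \<in> I\<rbrakk> \<Longrightarrow> emeasure nu {x<..<c} < \<infinity>"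
  by (rule le_less_trans[OF emeasure_mono finite_compact[of x c]]) auto

text \<open>To the left of \<open>c\<close> the equation is implicit at atoms. Since the coefficient matrix squares to
  zero there, the right limits \<open>ul, vl\<close> solve an explicit equation over \<open>(x, c)\<close>, from which the
  left-continuous solution is recovered by one jump.\<close>
lemma initial_value_problem:
  assumes c: "c \<in> I"
  shows "\<exists>u u1. Sys u u1 (\<lambda>x. z * u x) \<and> u c = u0 \<and> u1 c = v0"
proof -
  define q where "q = (\<lambda>t. ck t - cr t * z)"
  define C where "C = 1 + norm z"
  have C: "C \<ge> 1" by (simp add: C_def)
  have qm: "q \<in> borel_measurable borel" unfolding q_def by measurable
  have qb: "norm (q t) \<le> C" for t
  proof -
    have "norm (q t) \<le> norm (ck t) + norm (cr t * z)" unfolding q_def by (rule norm_triangle_ineq4)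
    also have "\<dots> \<le> 1 + 1 * norm z"
      unfolding norm_mult norm_of_real by (intro add_mono mult_right_mono bound abs_r norm_ge_zero)
    finally show ?thesis by (simp add: C_def)
  qed
  have sb: "norm (cs t) \<le> C" for t
    unfolding norm_of_real using bound(1) C by (rule order_trans)
  have sm: "(\<lambda>t. cs t) \<in> borel_measurable borel" by measurable
  have sm': "(\<lambda>t. - cs t) \<in> borel_measurable borel" and qm': "(\<lambda>t. - q t) \<in> borel_measurable borel"
    using sm qm by measurable
  have sb': "norm (- cs t) \<le> C" and qb': "norm (- q t) \<le> C" for t
    unfolding norm_minus_cancel by (rule sb, rule qb)
  \<comment> \<open>The coefficient matrix has only the entries \<open>cs\<close> and
    \<open>q\<close> off the diagonal, so this is the vanishing of its square at an atom.\<close>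
  have sq: "cs t * q t * cm t = 0" if "t \<in> I" for t
    using atoms_complex[OF that] by (auto simp: q_def)
  have I': "Measurable.pred borel (\<lambda>x. x \<in> I)" using Iab_borel[of a b] by simp
  note [measurable] = I'
  have mR: "Measurable.pred (borel \<Otimes>\<^sub>M borel) (\<lambda>(x, t). x \<in> I \<and> t \<in> {c..<x})"
    and mL: "Measurable.pred (borel \<Otimes>\<^sub>M borel) (\<lambda>(x, t). x \<in> I \<and> t \<in> {x<..<c})"
    unfolding atLeastLessThan_iff greaterThanLessThan_iff by measurable
  obtain ur vr where R: "\<And>x. x \<in> I \<Longrightarrow> integrable nu (\<lambda>t. indicator {c..<x} t *\<^sub>R (cs t * vr t))"
      "\<And>x. x \<in> I \<Longrightarrow> integrable nu (\<lambda>t. indicator {c..<x} t *\<^sub>R (q t * ur t))"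
      "\<And>x. x \<in> I \<Longrightarrow> ur x = u0 + (\<integral>t. indicator {c..<x} t *\<^sub>R (cs t * vr t) \<partial>nu)"
      "\<And>x. x \<in> I \<Longrightarrow> vr x = v0 + (\<integral>t. indicator {c..<x} t *\<^sub>R (q t * ur t) \<partial>nu)"
    by (rule coupled_volterra[OF sm sb qm qb mR, of u0 v0]) (auto simp: finite_right[OF c] simp del: infinity_ennreal_def)
  obtain ul vl where L: "\<And>x. x \<in> I \<Longrightarrow> integrable nu (\<lambda>t. indicator {x<..<c} t *\<^sub>R (- cs t * vl t))"
      "\<And>x. x \<in> I \<Longrightarrow> integrable nu (\<lambda>t. indicator {x<..<c} t *\<^sub>R (- q t * ul t))"
      "\<And>x. x \<in> I \<Longrightarrow> ul x = u0 + (\<integral>t. indicator {x<..<c} t *\<^sub>R (- cs t * vl t) \<partial>nu)"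
      "\<And>x. x \<in> I \<Longrightarrow> vl x = v0 + (\<integral>t. indicator {x<..<c} t *\<^sub>R (- q t * ul t) \<partial>nu)"
    by (rule coupled_volterra[OF sm' sb' qm' qb' mL, of u0 v0]) (auto simp: finite_left[OF c] simp del: infinity_ennreal_def)
  define p where "p = (\<lambda>t. if c \<le> t then cs t * vr t else cs t * vl t)"
  define p1 where "p1 = (\<lambda>t. if c \<le> t then q t * ur t else q t * ul t)"
  \<comment> \<open>Left of \<open>c\<close> the functions \<open>ul, vl\<close> already contain the
    effect of an atom at t itself; passing to the values before the jump subtracts the density times
    the mass at t.\<close>
  define u where "u = (\<lambda>t. if c \<le> t then ur t else ul t - cm t * (cs t * vl t))"
  define u1 where "u1 = (\<lambda>t. if c \<le> t then vr t else vl t - cm t * (q t * ul t))"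
  have glue: "prim f d"
    if r: "\<And>x. x \<in> I \<Longrightarrow> integrable nu (\<lambda>t. indicator {c..<x} t *\<^sub>R dr t)"
      "\<And>x. x \<in> I \<Longrightarrow> fr x = f0 + (\<integral>t. indicator {c..<x} t *\<^sub>R dr t \<partial>nu)"
    and l: "\<And>x. x \<in> I \<Longrightarrow> integrable nu (\<lambda>t. indicator {x<..<c} t *\<^sub>R - dl t)"
      "\<And>x. x \<in> I \<Longrightarrow> fl x = f0 + (\<integral>t. indicator {x<..<c} t *\<^sub>R - dl t \<partial>nu)"
    and d: "d = (\<lambda>t. if c \<le> t then dr t else dl t)"
    and f: "f = (\<lambda>t. if c \<le> t then fr t else fl t - cm t * dl t)"
    for f d fr fl dr dl f0
  proof (rule primI[OF _ c])
    have l': "integrable nu (\<lambda>t. indicator {x<..<c} t *\<^sub>R dl t)" if "x \<in> I" for x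
      using integrable_minus[OF l(1)[OF that]] by simp
    have dr: "indicator {c..<x} t *\<^sub>R d t = indicator {c..<x} t *\<^sub>R dr t" for x t
      by (simp add: d indicator_def)
    have dl: "indicator {x<..<c} t *\<^sub>R d t = indicator {x<..<c} t *\<^sub>R dl t" for x t
      by (simp add: d indicator_def)
    show "Lloc d" using r(1) l' by (intro Lloc_glue[OF c]) (simp_all add: dr dl)
    fix x assume x: "x \<in> I"
    show "f x = f0 + (\<integral>t. J c x t *\<^sub>R d t \<partial>nu)"
    proof (cases "c \<le> x")
      case True
      then show ?thesis using r(2)[OF x] by (simp add: f J_eq_indicator dr)
    next
      case False
      \<comment> \<open>The oriented interval is minus [x, c), that is (x, c) together with the
        point x. The point produces the jump term in \<open>f\<close>.\<close>
      have e: "J c x t *\<^sub>R d t = indicator {x<..<c} t *\<^sub>R - dl t - indicator {x} t *\<^sub>R dl t" for t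
        using False by (auto simp: J_def d indicator_def)
      have i: "integrable nu (\<lambda>t. indicator {x} t *\<^sub>R dl t)"
      proof -
        have "(\<lambda>t. indicator {x} t *\<^sub>R dl t) = (\<lambda>t. indicator {x} t *\<^sub>R dl x)" by (auto simp: indicator_def)
        moreover have "emeasure nu {x} < \<infinity>" using finite_compact[OF x x] by simp
        ultimately show ?thesis by (auto intro!: integrable_scaleR_left)
      qed
      have "(\<integral>t. J c x t *\<^sub>R d t \<partial>nu) = (\<integral>t. indicator {x<..<c} t *\<^sub>R - dl t \<partial>nu) - cm x * dl x"
        unfolding e Bochner_Integration.integral_diff[OF l(1)[OF x] i] measure_point_eq_integral ..
      then show ?thesis using l(2)[OF x] False by (simp add: f)
    qed
  qed
  have 1: "prim u p"
    by (rule glue[OF R(1,3) _ _ p_def u_def]) (use L(1,3) in simp_all)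
  have 2: "prim u1 p1"
    by (rule glue[OF R(2,4) _ _ p1_def u1_def]) (use L(2,4) in simp_all)
  have "prim u (\<lambda>t. cs t * u1 t)"
  proof (rule prim_cong[OF 1])
    fix t assume "t \<in> I"
    \<comment> \<open>The jump by which \<open>u1\<close> differs from \<open>vl\<close> has the
      factor \<open>q\<close>, and \<open>cs\<close> annihilates it at every atom. So the density is
      the same before and after the jump; the other equation uses the same argument with
      \<open>cs\<close> and \<open>q\<close> exchanged.\<close>
    have "cs t * (cm t * (q t * ul t)) = (cs t * q t * cm t) * ul t" by (simp add: mult_ac)
    then show "p t = cs t * u1 t" using sq[OF \<open>t \<in> I\<close>] by (simp add: p_def u1_def right_diff_distrib)
  qed simp
  moreover have "prim u1 (\<lambda>t. ck t * u t - cr t * (z * u t))"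
  proof (rule prim_cong[OF 2])
    fix t assume "t \<in> I"
    have "q t * (cm t * (cs t * vl t)) = (cs t * q t * cm t) * vl t" by (simp add: mult_ac)
    then have "q t * u t = p1 t" using sq[OF \<open>t \<in> I\<close>] by (simp add: p1_def u_def right_diff_distrib)
    then show "p1 t = ck t * u t - cr t * (z * u t)" by (simp add: q_def algebra_simps)
  qed simp
  moreover have "u c = u0" "u1 c = v0" using R(3,4)[OF c] by (simp_all add: u_def u1_def)
  ultimately show ?thesis unfolding Sys_def by blast
qed

lemma fundamental_exists: "\<exists>u1 u1' u2 u2'. fundamental z u1 u1' u2 u2'"
proof -
  obtain c where c: "c \<in> I" using nonempty by blast
  obtain u1 u1' where 1: "Sys u1 u1' (\<lambda>x. z * u1 x)" "u1 c = 1" "u1' c = 0"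
    using initial_value_problem[OF c] by blast
  obtain u2 u2' where 2: "Sys u2 u2' (\<lambda>x. z * u2 x)" "u2 c = 0" "u2' c = 1"
    using initial_value_problem[OF c] by blast
  have "u1 x * u2' x - u1' x * u2 x = 1" if "x \<in> I" for x
    using Wronskian_const[OF 1(1) 2(1) that c] 1 2 by simp
  then show ?thesis unfolding fundamental_def using 1(1) 2(1) by blast
qed

end

section \<open>Reduction to one dominating measure\<close>

text \<open>On the set \<open>C\<close> where f > 1 inside a piece of finite measure, the integral
  of f - 1 is at most 0, so f - 1 vanishes a.e. there. Finiteness of the pieces makes the
  subtraction of extended integrals legitimate.\<close>

lemma density_le_1:
  assumes "sigma_finite_measure M" and f [measurable]: "f \<in> borel_measurable M"
    and le: "\<And>A. A \<in> sets M \<Longrightarrow> emeasure (density M f) A \<le> emeasure M A"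
  shows "AE x in M. f x \<le> 1"
proof -
  interpret sigma_finite_measure M by fact
  obtain A :: "nat \<Rightarrow> 'a set" where A: "range A \<subseteq> sets M" "(\<Union>i. A i) = space M" "\<And>i. emeasure M (A i) \<noteq> \<infinity>"
    using sigma_finite by metis
  have "AE x in M. x \<in> A i \<longrightarrow> f x \<le> 1" for i
  proof -
    have [measurable]: "A i \<in> sets M" using A(1) by auto
    define C where "C = {x \<in> space M. x \<in> A i \<and> 1 < f x}"
    have [measurable]: "C \<in> sets M" unfolding C_def by measurable
    have "emeasure M C \<le> emeasure M (A i)" by (intro emeasure_mono) (auto simp: C_def)
    then have fin: "emeasure M C \<noteq> \<infinity>" using A(3)[of i] by (metis neq_top_trans infinity_ennreal_def)
    have "(\<integral>\<^sup>+x. f x * indicator C x - indicator C x \<partial>M) = (\<integral>\<^sup>+x. f x * indicator C x \<partial>M) - (\<integral>\<^sup>+x. indicator C x \<partial>M)"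
    proof (rule nn_integral_diff)
      show "(\<integral>\<^sup>+x. indicator C x \<partial>M) \<noteq> \<infinity>" using fin by simp
      show "AE x in M. indicator C x \<le> f x * indicator C x"
        by (intro AE_I2) (auto simp: C_def indicator_def less_imp_le)
    qed measurable
    also have "\<dots> = emeasure (density M f) C - emeasure M C"
      by (simp add: emeasure_density)
    also have "\<dots> = 0" using le[of C] fin by (simp add: diff_eq_0_iff_ennreal less_top)
    finally have "AE x in M. f x * indicator C x - indicator C x = 0"
      by (subst (asm) nn_integral_0_iff_AE) measurable
    then show ?thesis
    proof eventually_elim
      case (elim x)
      show ?case
      proof (rule impI, rule ccontr)
        assume x: "x \<in> A i" "\<not> f x \<le> 1"
        then have "x \<in> C" using A(2) by (auto simp: C_def)
        then have "f x - 1 = 0" using elim by simp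
        then show False using x(2) by (auto simp: diff_eq_0_iff_ennreal)
      qed
    qed
  qed
  then have "AE x in M. \<forall>i. x \<in> A i \<longrightarrow> f x \<le> 1" by (subst AE_all_countable) blast
  then show ?thesis using AE_space by eventually_elim (use A(2) in auto)
qed

text \<open>The a.e. bound is turned into an everywhere bound by truncating the density at 1, which
  does not change the measure. Estimates with \<open>s\<close>, \<open>k\<close>, \<open>r\<close>
  can then be made pointwise.\<close>

lemma bounded_Radon_Nikodym:
  assumes "sigma_finite_measure M" and sets: "sets N = sets M"
    and le: "\<And>A. A \<in> sets M \<Longrightarrow> emeasure N A \<le> emeasure M A"
  shows "\<exists>d :: 'a \<Rightarrow> real. d \<in> borel_measurable M \<and> (\<forall>x. 0 \<le> d x \<and> d x \<le> 1) \<and> N = density M (\<lambda>x. ennreal (d x))"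
proof -
  interpret sigma_finite_measure M by fact
  have "absolutely_continuous M N"
    unfolding absolutely_continuous_def null_sets_def using le sets by fastforce
  then obtain f where f [measurable]: "f \<in> borel_measurable M" and N: "density M f = N"
    using Radon_Nikodym sets by blast
  have "AE x in M. f x \<le> 1" by (rule density_le_1[OF assms(1) f]) (simp add: N le)
  then have "AE x in M. f x = ennreal (enn2real (min (f x) 1))"
  proof eventually_elim
    case (elim x)
    then have "f x < top" using ennreal_one_less_top by (rule le_less_trans)
    then show ?case using elim by (simp add: min_def)
  qed
  then have "density M f = density M (\<lambda>x. ennreal (enn2real (min (f x) 1)))"
    by (intro density_cong) auto
  moreover have "enn2real (min (f x) 1) \<le> 1" for x
    using enn2real_mono[of "min (f x) 1" 1] by simp
  ultimately show ?thesis using N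
    by (intro exI[of _ "\<lambda>x. enn2real (min (f x) 1)"]) auto
qed

lemma lf_measure_sum:
  assumes "finite F" and M: "\<And>i. i \<in> F \<Longrightarrow> lf_measure a b (M i)"
  shows "\<exists>nu. lf_measure a b nu \<and> (\<forall>i\<in>F. \<forall>A\<in>sets borel. emeasure (M i) A \<le> emeasure nu A)"
proof -
  define nu where "nu = measure_of UNIV (sets borel) (\<lambda>A. \<Sum>i\<in>F. emeasure (M i) A)"
  have sM: "sets (M i) = sets borel" if "i \<in> F" for i using M[OF that] by (simp add: lf_measure_def)
  have sets: "sets nu = sets borel"
    unfolding nu_def using sets.sigma_sets_eq[of "borel :: real measure"] by (simp add: sets_measure_of_conv)
  have em: "emeasure nu A = (\<Sum>i\<in>F. emeasure (M i) A)" if "A \<in> sets borel" for A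
    unfolding nu_def
  proof (rule emeasure_measure_of_sigma)
    show "sigma_algebra UNIV (sets (borel :: real measure))"
      using sets.sigma_algebra_axioms[of "borel :: real measure"] by simp
    show "positive (sets borel) (\<lambda>A. \<Sum>i\<in>F. emeasure (M i) A)" by (simp add: positive_def)
    show "countably_additive (sets borel) (\<lambda>A. \<Sum>i\<in>F. emeasure (M i) A)"
    proof (rule countably_additiveI)
      fix A :: "nat \<Rightarrow> real set" assume A: "range A \<subseteq> sets borel" "disjoint_family A"
      have "(\<Sum>n. \<Sum>i\<in>F. emeasure (M i) (A n)) = (\<Sum>i\<in>F. \<Sum>n. emeasure (M i) (A n))"
        by (rule suminf_sum) simp
      also have "\<dots> = (\<Sum>i\<in>F. emeasure (M i) (\<Union>(range A)))"
        using A sM by (intro sum.cong refl suminf_emeasure) auto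
      finally show "(\<Sum>n. \<Sum>i\<in>F. emeasure (M i) (A n)) = (\<Sum>i\<in>F. emeasure (M i) (\<Union>(range A)))" .
    qed
  qed (rule that)
  have "emeasure nu (- Iab a b) = 0"
    using M by (subst em) (auto simp: lf_measure_def)
  moreover have "emeasure nu K < \<infinity>" if "compact K" "K \<subseteq> Iab a b" for K
    using M that \<open>finite F\<close> by (subst em) (auto simp: lf_measure_def borel_compact)
  moreover have "emeasure (M i) A \<le> emeasure nu A" if "i \<in> F" "A \<in> sets borel" for i A
    unfolding em[OF that(2)] using that(1) \<open>finite F\<close> by (intro member_le_sum) auto
  ultimately show ?thesis using sets unfolding lf_measure_def by blast
qed

context lf_space
begin

lemma Lloc_prim: "prim f p \<Longrightarrow> Lloc f"
  using Lloc_mult_prim[OF _ Lloc_const[of 1]] by simp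

lemma prim_cong_AE:
  assumes "prim f p" "Lloc q" "AE t in nu. t \<in> I \<longrightarrow> p t = q t"
  shows "prim f q"
proof -
  have "(\<integral>t. J x y t *\<^sub>R p t \<partial>nu) = (\<integral>t. J x y t *\<^sub>R q t \<partial>nu)" if "x \<in> I" "y \<in> I" for x y
  proof (rule integral_cong_AE)
    show "AE t in nu. J x y t *\<^sub>R p t = J x y t *\<^sub>R q t"
      using assms(3) AE_I by eventually_elim simp
  qed (rule borel_measurable_integrable[OF integrable_J[OF prim_Lloc[OF assms(1)] that]]
      borel_measurable_integrable[OF integrable_J[OF assms(2) that]])+
  then show ?thesis using assms(1,2) by (simp add: prim_def)
qed

context
  fixes d :: "real \<Rightarrow> real" and N :: "real measure"
  assumes d: "d \<in> borel_measurable borel" "\<And>t. 0 \<le> d t" "\<And>t. d t \<le> 1" and N: "N = density nu d"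
begin

lemma loc_int_densityD:
  assumes "loc_int a b N h" shows "Lloc (\<lambda>t. of_real (d t) * h t)"
  unfolding loc_int_def set_integrable_def
proof (intro allI impI)
  fix \<alpha> \<beta> assume "\<alpha> \<in> I \<and> \<beta> \<in> I"
  then have i: "integrable N (\<lambda>t. indicator {\<alpha>..\<beta>} t *\<^sub>R h t)"
    using assms by (simp add: loc_int_def set_integrable_def)
  then have "(\<lambda>t. indicator {\<alpha>..\<beta>} t *\<^sub>R h t) \<in> borel_measurable nu"
    using borel_measurable_integrable[OF i] by (simp add: N)
  then have "integrable nu (\<lambda>t. d t *\<^sub>R (indicator {\<alpha>..\<beta>} t *\<^sub>R h t))"
    using i d unfolding N by (subst (asm) integrable_density) auto
  then show "integrable nu (\<lambda>t. indicator {\<alpha>..\<beta>} t *\<^sub>R (of_real (d t) * h t))"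
    by (simp add: scaleR_conv_of_real mult_ac)
qed

lemma loc_int_densityI:
  assumes h: "Lloc h" shows "loc_int a b N h"
  unfolding loc_int_def set_integrable_def
proof (intro allI impI)
  fix \<alpha> \<beta> assume ab: "\<alpha> \<in> I \<and> \<beta> \<in> I"
  have "integrable nu (\<lambda>t. indicator {\<alpha>..\<beta>} t *\<^sub>R (of_real (d t) * h t))"
    using d ab by (intro Lloc_D Lloc_mult_bounded[OF h, of d 1]) auto
  then have "integrable nu (\<lambda>t. d t *\<^sub>R (indicator {\<alpha>..\<beta>} t *\<^sub>R h t))"
    by (simp add: scaleR_conv_of_real mult_ac)
  then show "integrable N (\<lambda>t. indicator {\<alpha>..\<beta>} t *\<^sub>R h t)"
    unfolding N using d ab borel_measurable_integrable[OF Lloc_D[OF h, of \<alpha> \<beta>]]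
    by (subst integrable_density) auto
qed

lemma pint_density:
  assumes h: "loc_int a b N h" and "c \<in> I" "x \<in> I"
  shows "pint N c x h = (\<integral>t. J c x t *\<^sub>R (of_real (d t) * h t) \<partial>nu)"
proof -
  have "integrable N (\<lambda>t. indicator {min c x..max c x} t *\<^sub>R h t)"
    using h min_max_I[OF assms(2,3)] by (simp add: loc_int_def set_integrable_def)
  then have [measurable]: "(\<lambda>t. indicator {min c x..max c x} t *\<^sub>R h t) \<in> borel_measurable borel"
    using borel_measurable_integrable[of N] by (fastforce simp: N)
  have "(\<lambda>t. J c x t *\<^sub>R h t) = (\<lambda>t. J c x t *\<^sub>R (indicator {min c x..max c x} t *\<^sub>R h t))"
    by (auto simp: J_def indicator_def)
  also have "\<dots> \<in> borel_measurable nu" by measurable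
  finally have "pint N c x h = (\<integral>t. d t *\<^sub>R (J c x t *\<^sub>R h t) \<partial>nu)"
    unfolding pint_eq_J N using d by (intro integral_density) auto
  then show ?thesis by (simp add: scaleR_conv_of_real mult_ac)
qed

end

end

section \<open>Equivalence of the differential expression with the system\<close>

locale sl_densities = sl_system +
  fixes sp sn cp cn rho :: "real measure" and dsp dsn dcp dcn :: "real \<Rightarrow> real"
  assumes dsp: "dsp \<in> borel_measurable borel" "\<And>t. 0 \<le> dsp t" "\<And>t. dsp t \<le> 1" "sp = density nu dsp"
    and dsn: "dsn \<in> borel_measurable borel" "\<And>t. 0 \<le> dsn t" "\<And>t. dsn t \<le> 1" "sn = density nu dsn"
    and dcp: "dcp \<in> borel_measurable borel" "\<And>t. 0 \<le> dcp t" "\<And>t. dcp t \<le> 1" "cp = density nu dcp"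
    and dcn: "dcn \<in> borel_measurable borel" "\<And>t. 0 \<le> dcn t" "\<And>t. dcn t \<le> 1" "cn = density nu dcn"
    and rho: "rho = density nu r" and lf_rho: "lf_measure a b rho"
    and s_eq: "s t = dsp t - dsn t" and k_eq: "k t = dcp t - dcn t"
begin

lemmas dr = meas(3) bound(3,4) rho

lemma sint_chi:
  assumes f: "Lloc f" and cx: "c \<in> I" "x \<in> I"
  shows "sint cp cn c x f = (\<integral>t. J c x t *\<^sub>R (ck t * f t) \<partial>nu)"
proof -
  have p: "loc_int a b cp f" and n: "loc_int a b cn f"
    using loc_int_densityI[OF dcp f] loc_int_densityI[OF dcn f] .
  have "sint cp cn c x f = (\<integral>t. J c x t *\<^sub>R (of_real (dcp t) * f t) - J c x t *\<^sub>R (of_real (dcn t) * f t) \<partial>nu)"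
    unfolding sint_def pint_density[OF dcp p cx] pint_density[OF dcn n cx]
    by (intro Bochner_Integration.integral_diff[symmetric] integrable_J loc_int_densityD[OF dcp p]
        loc_int_densityD[OF dcn n] cx)
  also have "(\<lambda>t. J c x t *\<^sub>R (of_real (dcp t) * f t) - J c x t *\<^sub>R (of_real (dcn t) * f t)) =
      (\<lambda>t. J c x t *\<^sub>R (ck t * f t))"
    by (simp add: k_eq algebra_simps)
  finally show ?thesis .
qed

lemma prim_chi:
  assumes f: "Lloc f" and c: "c \<in> I" shows "prim (\<lambda>x. sint cp cn c x f) (\<lambda>t. ck t * f t)"
  by (rule primI[OF Lloc_mult_bounded[OF f, of k 1] c, of _ 0])
     (use meas bound sint_chi[OF f c] in auto)

lemma rAC_dens_prim:
  assumes "rAC_dens a b sp sn f h" shows "prim f (\<lambda>t. cs t * h t)"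
proof -
  obtain c where p: "loc_int a b sp h" and n: "loc_int a b sn h" and c: "c \<in> I"
    and f: "\<And>x. x \<in> I \<Longrightarrow> f x = f c + sint sp sn c x h"
    using assms unfolding rAC_dens_def by blast
  have e: "cs t * h t = of_real (dsp t) * h t - of_real (dsn t) * h t" for t
    by (simp add: s_eq algebra_simps)
  show ?thesis unfolding e
  proof (rule primI[OF Lloc_diff[OF loc_int_densityD[OF dsp p] loc_int_densityD[OF dsn n]] c])
    fix x assume x: "x \<in> I"
    show "f x = f c + (\<integral>t. J c x t *\<^sub>R (of_real (dsp t) * h t - of_real (dsn t) * h t) \<partial>nu)"
      unfolding f[OF x] sint_def pint_density[OF dsp p c x] pint_density[OF dsn n c x] scaleR_diff_right
      by (subst Bochner_Integration.integral_diff)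
         (intro integrable_J loc_int_densityD[OF dsp p] loc_int_densityD[OF dsn n] c x refl)+
  qed
qed

lemma prim_rAC_dens:
  assumes f: "prim f (\<lambda>t. cs t * h t)" and h: "Lloc h" shows "rAC_dens a b sp sn f h"
proof -
  obtain c where c: "c \<in> I" using nonempty by blast
  have p: "loc_int a b sp h" and n: "loc_int a b sn h"
    using loc_int_densityI[OF dsp h] loc_int_densityI[OF dsn h] .
  have e: "cs t * h t = of_real (dsp t) * h t - of_real (dsn t) * h t" for t
    by (simp add: s_eq algebra_simps)
  have "f x = f c + sint sp sn c x h" if x: "x \<in> I" for x
    unfolding primD[OF f c x] sint_def pint_density[OF dsp p c x] pint_density[OF dsn n c x] e scaleR_diff_right
    by (subst Bochner_Integration.integral_diff)
       (intro integrable_J loc_int_densityD[OF dsp p] loc_int_densityD[OF dsn n] c x refl)+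
  then show ?thesis unfolding rAC_dens_def using p n c by blast
qed

text \<open>The quasi-derivative is the chi-integral of \<open>f\<close> minus \<open>F\<close>, a
  function defined everywhere and a primitive. It agrees with the sigma-density \<open>h\<close>
  wherever \<open>dsp\<close> or \<open>dsn\<close> is positive, up to a null set, and elsewhere
  \<open>s\<close> is 0; hence \<open>cs * h\<close> may be replaced by
  \<open>cs * f1\<close>.\<close>

lemma tau_rel_Sys:
  assumes "tau_rel a b rho sp sn cp cn f g"
  shows "\<exists>f1. Sys f f1 g"
proof -
  obtain h F c where c: "c \<in> I" and f: "rAC_dens a b sp sn f h" and F: "AC_dens a b rho F g"
    and AEp: "AE x in sp. x \<in> I \<longrightarrow> F x = - h x + sint cp cn c x f"
    and AEn: "AE x in sn. x \<in> I \<longrightarrow> F x = - h x + sint cp cn c x f"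
    using assms by (auto simp: tau_rel_def)
  have pf: "prim f (\<lambda>t. cs t * h t)" by (rule rAC_dens_prim[OF f])
  have pF: "prim F (\<lambda>t. cr t * g t)"
  proof -
    obtain c where g: "loc_int a b rho g" and c: "c \<in> I" and Fx: "\<And>x. x \<in> I \<Longrightarrow> F x = F c + pint rho c x g"
      using F unfolding AC_dens_def by blast
    show ?thesis
    proof (rule primI[OF loc_int_densityD[OF dr g] c])
      fix x assume "x \<in> I"
      then show "F x = F c + (\<integral>t. J c x t *\<^sub>R (cr t * g t) \<partial>nu)"
        using Fx pint_density[OF dr g c] by metis
    qed
  qed
  define f1 where "f1 = (\<lambda>x. sint cp cn c x f - F x)"
  have f1: "prim f1 (\<lambda>t. ck t * f t - cr t * g t)"
    unfolding f1_def by (rule prim_diff[OF prim_chi[OF Lloc_prim[OF pf] c] pF])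
  have "AE t in nu. 0 < dsp t \<longrightarrow> t \<in> I \<longrightarrow> F t = - h t + sint cp cn c t f"
    using AEp dsp(1) unfolding dsp(4) by (subst (asm) AE_density) auto
  moreover have "AE t in nu. 0 < dsn t \<longrightarrow> t \<in> I \<longrightarrow> F t = - h t + sint cp cn c t f"
    using AEn dsn(1) unfolding dsn(4) by (subst (asm) AE_density) auto
  ultimately have "AE t in nu. t \<in> I \<longrightarrow> cs t * h t = cs t * f1 t"
  proof eventually_elim
    case (elim t)
    show ?case
    proof
      assume t: "t \<in> I"
      show "cs t * h t = cs t * f1 t"
      proof (cases "0 < dsp t \<or> 0 < dsn t")
        case True
        then have "F t = - h t + sint cp cn c t f" using elim t by blast
        then show ?thesis by (simp add: f1_def)
      next
        case False
        then have "s t = 0" using dsp(2)[of t] dsn(2)[of t] s_eq[of t] by simp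
        then show ?thesis by simp
      qed
    qed
  qed
  moreover have "Lloc (\<lambda>t. cs t * f1 t)"
    using meas bound by (intro Lloc_mult_bounded[OF Lloc_prim[OF f1], of s 1]) auto
  ultimately have "prim f (\<lambda>t. cs t * f1 t)" using prim_cong_AE[OF pf] by blast
  then show ?thesis using f1 by (auto simp: Sys_def)
qed

text \<open>Taking \<open>f1\<close> as the sigma-density of \<open>f\<close> and the chi-integral
  minus \<open>f1\<close> as \<open>F\<close> makes the required identity hold at every point. Local
  integrability of \<open>g\<close> for rho has to be assumed separately, because \<open>Sys\<close>
  sees \<open>g\<close> only through \<open>cr * g\<close>.\<close>

lemma Sys_tau_rel:
  assumes f: "Sys f f1 g" and g: "Lloc g"
  shows "tau_rel a b rho sp sn cp cn f g"
proof -
  obtain c where c: "c \<in> I" using nonempty by blast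
  have p: "prim f (\<lambda>t. cs t * f1 t)" "prim f1 (\<lambda>t. ck t * f t - cr t * g t)"
    using f by (auto simp: Sys_def)
  define F where "F = (\<lambda>x. sint cp cn c x f - f1 x)"
  have F: "prim F (\<lambda>t. cr t * g t)" unfolding F_def
    by (rule prim_cong[OF prim_diff[OF prim_chi[OF Lloc_prim[OF p(1)] c] p(2)]]) simp_all
  have g': "loc_int a b rho g" using loc_int_densityI[OF dr g] .
  have "AC_dens a b rho F g"
    unfolding AC_dens_def using g' c primD[OF F c] pint_density[OF dr g' c] by metis
  moreover have "rAC_dens a b sp sn f f1" by (rule prim_rAC_dens[OF p(1) Lloc_prim[OF p(2)]])
  ultimately show ?thesis
    unfolding tau_rel_def using c by (intro exI[of _ f1] exI[of _ F] exI[of _ c]) (simp add: F_def)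
qed

lemma is_sol_iff: "is_sol a b rho sp sn cp cn z u \<longleftrightarrow> (\<exists>u1. Sys u u1 (\<lambda>x. z * u x))"
proof
  assume "\<exists>u1. Sys u u1 (\<lambda>x. z * u x)"
  then obtain u1 where u: "Sys u u1 (\<lambda>x. z * u x)" by blast
  then have "Lloc (\<lambda>x. z * u x)" by (intro Lloc_cmult) (auto simp: Sys_def intro: Lloc_prim)
  then show "is_sol a b rho sp sn cp cn z u" using Sys_tau_rel[OF u] by (simp add: is_sol_def)
qed (auto simp: is_sol_def dest: tau_rel_Sys)

end

section \<open>Square-integrable functions\<close>

lemma L2_measurable: "L2 M f \<Longrightarrow> f \<in> borel_measurable M" by (simp add: L2_def)

lemma L2_bound:
  assumes f: "f \<in> borel_measurable M" and F: "integrable M F" and le: "\<And>x. (cmod (f x))\<^sup>2 \<le> F x"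
  shows "L2 M f"
  unfolding L2_def
proof (intro conjI f Bochner_Integration.integrable_bound[OF F])
  show "(\<lambda>x. (cmod (f x))\<^sup>2) \<in> borel_measurable M" using f by measurable
  show "AE x in M. norm ((cmod (f x))\<^sup>2) \<le> norm (F x)"
    using le by (intro AE_I2) (smt (verit) real_norm_def zero_le_power2)
qed

lemma L2_zero: "L2 M (\<lambda>_. 0)" by (simp add: L2_def)

lemma L2_cmult: "L2 M f \<Longrightarrow> L2 M (\<lambda>x. c * f x)"
  by (auto simp: L2_def norm_mult power_mult_distrib)

lemma L2_cnj: "L2 M f \<Longrightarrow> L2 M (\<lambda>x. cnj (f x))"
  unfolding L2_def by (auto intro: borel_measurable_continuous_on[OF continuous_on_cnj[OF continuous_on_id]])

lemma L2_add:
  assumes f: "L2 M f" and g: "L2 M g" shows "L2 M (\<lambda>x. f x + g x)"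
proof (rule L2_bound)
  show "(\<lambda>x. f x + g x) \<in> borel_measurable M" using f g by (auto simp: L2_def)
  show "integrable M (\<lambda>x. 2 * (cmod (f x))\<^sup>2 + 2 * (cmod (g x))\<^sup>2)" using f g by (auto simp: L2_def)
  fix x
  have "(cmod (f x + g x))\<^sup>2 \<le> (cmod (f x) + cmod (g x))\<^sup>2" by (intro power_mono norm_triangle_ineq) simp
  also have "\<dots> \<le> 2 * (cmod (f x))\<^sup>2 + 2 * (cmod (g x))\<^sup>2"
    using sum_squares_bound[of "cmod (f x)" "cmod (g x)"] by (simp add: power2_sum)
  finally show "(cmod (f x + g x))\<^sup>2 \<le> 2 * (cmod (f x))\<^sup>2 + 2 * (cmod (g x))\<^sup>2" .
qed

lemma L2_diff_cmult: "\<lbrakk>L2 M f; L2 M g\<rbrakk> \<Longrightarrow> L2 M (\<lambda>x. f x - c * g x)"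
  using L2_add[of M f "\<lambda>x. (- c) * g x"] L2_cmult[of M g "- c"] by simp

lemma L2_mult_bounded:
  assumes w: "w \<in> borel_measurable M" "\<And>x. cmod (w x) \<le> B" and f: "L2 M f"
  shows "L2 M (\<lambda>x. w x * f x)"
proof (rule L2_bound)
  show "(\<lambda>x. w x * f x) \<in> borel_measurable M" using w(1) L2_measurable[OF f] by measurable
  show "integrable M (\<lambda>x. B\<^sup>2 * (cmod (f x))\<^sup>2)" using f by (simp add: L2_def)
  show "(cmod (w x * f x))\<^sup>2 \<le> B\<^sup>2 * (cmod (f x))\<^sup>2" for x
    unfolding norm_mult power_mult_distrib by (intro mult_right_mono power_mono w(2)) auto
qed

lemma L2_mult_integrable:
  assumes f: "L2 M f" and g: "L2 M g" shows "integrable M (\<lambda>x. f x * g x)"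
proof (rule Bochner_Integration.integrable_bound)
  show "integrable M (\<lambda>x. (cmod (f x))\<^sup>2 + (cmod (g x))\<^sup>2)" using f g by (auto simp: L2_def)
  show "(\<lambda>x. f x * g x) \<in> borel_measurable M" using f g by (auto simp: L2_def)
  show "AE x in M. norm (f x * g x) \<le> norm ((cmod (f x))\<^sup>2 + (cmod (g x))\<^sup>2)"
  proof (rule AE_I2)
    fix x
    have "cmod (f x) * cmod (g x) \<le> (cmod (f x))\<^sup>2 + (cmod (g x))\<^sup>2"
      using sum_squares_bound[of "cmod (f x)" "cmod (g x)"] mult_nonneg_nonneg[of "cmod (f x)" "cmod (g x)"]
      unfolding mult.assoc using norm_ge_zero[of "f x"] norm_ge_zero[of "g x"] by linarith
    then show "norm (f x * g x) \<le> norm ((cmod (f x))\<^sup>2 + (cmod (g x))\<^sup>2)" by (simp add: norm_mult)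
  qed
qed

text \<open>An adjoint is always a linear relation, also at the level of representing functions. For
  a relation equal to its adjoint this is the source of linearity.\<close>

lemma adj_diff_cmult:
  assumes S: "S \<subseteq> {(f, g). L2 M f \<and> L2 M g}" and 1: "(f, g) \<in> adj M S" and 2: "(f', g') \<in> adj M S"
  shows "(\<lambda>x. f x - c * f' x, \<lambda>x. g x - c * g' x) \<in> adj M S"
  unfolding adj_def
proof (clarsimp, intro conjI ballI)
  have L: "L2 M f" "L2 M g" "L2 M f'" "L2 M g'" using 1 2 by (auto simp: adj_def)
  show "L2 M (\<lambda>x. f x - c * f' x)" "L2 M (\<lambda>x. g x - c * g' x)" by (intro L2_diff_cmult L)+
  fix p assume p: "p \<in> S"
  obtain u v where uv: "p = (u, v)" by fastforce
  have "L2 M u" "L2 M v" using S p uv by auto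
  note Luv = L2_cnj[OF this(1)] L2_cnj[OF this(2)]
  have e: "(\<integral>x. g x * cnj (u x) \<partial>M) = (\<integral>x. f x * cnj (v x) \<partial>M)"
     "(\<integral>x. g' x * cnj (u x) \<partial>M) = (\<integral>x. f' x * cnj (v x) \<partial>M)"
    using 1 2 p uv by (auto simp: adj_def)
  have split: "(\<integral>x. (k x - c * k' x) * w x \<partial>M) = (\<integral>x. k x * w x \<partial>M) - c * (\<integral>x. k' x * w x \<partial>M)"
    if "L2 M k" "L2 M k'" "L2 M w" for k k' w
  proof -
    have "(\<lambda>x. (k x - c * k' x) * w x) = (\<lambda>x. k x * w x - c * (k' x * w x))" by (simp add: algebra_simps)
    then show ?thesis
      using L2_mult_integrable[OF that(1,3)] L2_mult_integrable[OF that(2,3)] by simp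
  qed
  show "case p of (u, v) \<Rightarrow> (\<integral>x. (g x - c * g' x) * cnj (u x) \<partial>M) = (\<integral>x. (f x - c * f' x) * cnj (v x) \<partial>M)"
    unfolding uv prod.case split[OF L(2,4) Luv(1)] split[OF L(1,3) Luv(2)] e ..
qed

text \<open>If \<open>l\<close> is nonzero at some \<open>e\<close> in the class, \<open>m\<close>
  is the reciprocal of \<open>l e\<close>, and a multiple of \<open>e\<close> corrects any
  \<open>g\<close> into the kernel. If \<open>l\<close> vanishes on the class, \<open>e = 0\<close>
  and \<open>m = 0\<close> serve, so both cases have the same form.\<close>

lemma functional_complement:
  fixes l :: "('a \<Rightarrow> complex) \<Rightarrow> complex"
  assumes zero: "X (\<lambda>_. 0)"
    and lin: "\<And>g e c. X g \<Longrightarrow> X e \<Longrightarrow> l (\<lambda>x. g x - c * e x) = l g - c * l e"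
  shows "\<exists>e m. X e \<and> (\<forall>g. X g \<longrightarrow> l (\<lambda>x. g x - m * l g * e x) = 0)"
proof (cases "\<exists>e. X e \<and> l e \<noteq> 0")
  case True
  then obtain e where e: "X e" "l e \<noteq> 0" by blast
  have "l (\<lambda>x. g x - 1 / l e * l g * e x) = 0" if "X g" for g
    unfolding lin[OF that e(1)] using e(2) by simp
  then show ?thesis using e(1) by blast
next
  case False
  then have "l (\<lambda>x. g x - 0 * l g * 0) = 0" if "X g" for g using that by simp
  then show ?thesis using zero by blast
qed

section \<open>Exhaustion of the interval and limits of truncated integrals\<close>

context lf_space
begin

text \<open>The sequences are the minima and maxima of the first terms of an enumeration of the
  rationals in (a, b). This treats finite and infinite endpoints in the same way.\<close>

lemma exhaustion:
  assumes "I \<noteq> {}"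
  obtains \<alpha> \<beta> :: "nat \<Rightarrow> real" where "\<And>n. \<alpha> n \<in> I" "\<And>n. \<beta> n \<in> I"
    "\<And>x. x \<in> I \<Longrightarrow> eventually (\<lambda>n. \<alpha> n < x \<and> x < \<beta> n) sequentially"
proof -
  define Q where "Q = \<rat> \<inter> I"
  have Q: "countable Q" unfolding Q_def by (rule countable_subset[OF Int_lower1 countable_rat])
  have Qne: "Q \<noteq> {}" using assms Iab_rat_bounds[of _ a b] unfolding Q_def by blast
  define e where "e = from_nat_into Q"
  have e: "e n \<in> Q" for n unfolding e_def by (rule from_nat_into[OF Qne])
  define \<alpha> where "\<alpha> n = Min (e ` {..n})" for n
  define \<beta> where "\<beta> n = Max (e ` {..n})" for n
  show ?thesis
  proof (rule that)
    show "\<alpha> n \<in> I" for n using Min_in[of "e ` {..n}"] e unfolding \<alpha>_def Q_def by fastforce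
    show "\<beta> n \<in> I" for n using Max_in[of "e ` {..n}"] e unfolding \<beta>_def Q_def by fastforce
    fix x assume "x \<in> I"
    then obtain p q where pq: "p \<in> Q" "q \<in> Q" "p < x" "x < q"
      using Iab_rat_bounds[of x a b] unfolding Q_def by blast
    obtain m where m: "e m = p" using from_nat_into_surj[OF Q pq(1)] unfolding e_def by blast
    obtain k where k: "e k = q" using from_nat_into_surj[OF Q pq(2)] unfolding e_def by blast
    show "eventually (\<lambda>n. \<alpha> n < x \<and> x < \<beta> n) sequentially"
    proof (rule eventually_sequentiallyI)
      fix n assume n: "max m k \<le> n"
      have "\<alpha> n \<le> e m" unfolding \<alpha>_def using n by (intro Min_le) auto
      moreover have "e k \<le> \<beta> n" unfolding \<beta>_def using n by (intro Max_ge) auto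
      ultimately show "\<alpha> n < x \<and> x < \<beta> n" using m k pq by simp
    qed
  qed
qed

lemma prim_ext_measurable:
  assumes f: "prim f p"
  shows "(\<lambda>x. indicator I x *\<^sub>R f x) \<in> borel_measurable borel"
proof (cases "I = {}")
  case False
  obtain \<alpha> \<beta> where ab: "\<And>n. \<alpha> n \<in> I" "\<And>n. \<beta> n \<in> I"
    "\<And>x. x \<in> I \<Longrightarrow> eventually (\<lambda>n. \<alpha> n < x \<and> x < \<beta> n) sequentially"
    using exhaustion[OF False] by blast
  show ?thesis
  proof (rule borel_measurable_LIMSEQ_metric)
    show "(\<lambda>x. indicator {\<alpha> n..\<beta> n} x *\<^sub>R f x) \<in> borel_measurable borel" for n
      by (rule prim_measurable[OF f ab(1,2)])
    fix x
    have "eventually (\<lambda>n. indicator {\<alpha> n..\<beta> n} x *\<^sub>R f x = indicator I x *\<^sub>R f x) sequentially"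
    proof (cases "x \<in> I")
      case True
      show ?thesis using ab(3)[OF True] by eventually_elim (simp add: True)
    next
      case False
      then have "x \<notin> {\<alpha> n..\<beta> n}" for n using atLeastAtMost_subset_Iab[OF ab(1,2)] by blast
      then show ?thesis using False by simp
    qed
    then show "(\<lambda>n. indicator {\<alpha> n..\<beta> n} x *\<^sub>R f x) \<longlonglongrightarrow> indicator I x *\<^sub>R f x"
      by (rule tendsto_eventually)
  qed
qed simp

lemma tendsto_integral_cut:
  fixes h :: "real \<Rightarrow> complex" and w :: "nat \<Rightarrow> real \<Rightarrow> real"
  assumes h: "integrable nu h" and w: "\<And>n. w n \<in> borel_measurable borel" "\<And>n t. \<bar>w n t\<bar> \<le> 1"
    and lim: "\<And>t. t \<in> I \<Longrightarrow> (\<lambda>n. w n t) \<longlonglongrightarrow> l"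
  shows "(\<lambda>n. \<integral>t. w n t *\<^sub>R h t \<partial>nu) \<longlonglongrightarrow> l *\<^sub>R (\<integral>t. h t \<partial>nu)"
proof -
  have "(\<lambda>n. \<integral>t. w n t *\<^sub>R h t \<partial>nu) \<longlonglongrightarrow> (\<integral>t. l *\<^sub>R h t \<partial>nu)"
  proof (rule integral_dominated_convergence)
    show "integrable nu (\<lambda>t. norm (h t))" using h by simp
    show "(\<lambda>t. w n t *\<^sub>R h t) \<in> borel_measurable nu" for n
      using w(1) borel_measurable_integrable[OF h] by (intro borel_measurable_scaleR) auto
    show "(\<lambda>t. l *\<^sub>R h t) \<in> borel_measurable nu"
      using borel_measurable_integrable[OF h] by (intro borel_measurable_scaleR) auto
    show "AE t in nu. (\<lambda>n. w n t *\<^sub>R h t) \<longlonglongrightarrow> l *\<^sub>R h t"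
      using AE_I by eventually_elim (intro tendsto_intros lim)
    show "AE t in nu. norm (w n t *\<^sub>R h t) \<le> norm (h t)" for n
      using w(2)[of n] by (intro AE_I2) (simp add: mult_left_le_one_le)
  qed
  then show ?thesis by simp
qed

lemma L2_Lloc:
  assumes g: "L2 nu g" shows "Lloc g"
  unfolding loc_int_def set_integrable_def
proof (intro allI impI)
  fix \<alpha> \<beta> assume ab: "\<alpha> \<in> I \<and> \<beta> \<in> I"
  have "L2 nu (\<lambda>x. indicator {\<alpha>..\<beta>} x)"
  proof (rule L2_bound)
    show "integrable nu (\<lambda>x. indicator {\<alpha>..\<beta>} x :: real)"
      using finite_compact[of \<alpha> \<beta>] ab by (intro integrable_real_indicator) simp_all
    show "(cmod (indicator {\<alpha>..\<beta>} x))\<^sup>2 \<le> indicator {\<alpha>..\<beta>} x" for x by (simp add: indicator_def)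
  qed simp
  from L2_mult_integrable[OF this g] show "integrable nu (\<lambda>x. indicator {\<alpha>..\<beta>} x *\<^sub>R g x)"
    by (simp add: scaleR_conv_of_real of_real_indicator)
qed

end

section \<open>The inhomogeneous equation\<close>

sublocale sl_densities \<subseteq> R: lf_space a b rho
  using lf_rho by unfold_locales

context sl_densities
begin

lemma integrable_loc_int: "integrable rho h \<Longrightarrow> loc_int a b rho h"
  unfolding loc_int_def set_integrable_def by (auto intro: integrable_mult_indicator)

lemma prim_rhoD:
  assumes W: "prim W (\<lambda>t. cr t * h t)" and h: "loc_int a b rho h" and xy: "x \<in> I" "y \<in> I"
  shows "W y = W x + (\<integral>t. J x y t *\<^sub>R h t \<partial>rho)"
  using primD[OF W xy] pint_density[OF dr h xy] by (simp add: pint_eq_J)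

lemma prim_rho_cong:
  assumes W: "prim W (\<lambda>t. cr t * h t)" and h: "loc_int a b rho h'"
    and eq: "AE t in rho. t \<in> I \<longrightarrow> h t = h' t"
  shows "prim W (\<lambda>t. cr t * h' t)"
proof (rule prim_cong_AE[OF W loc_int_densityD[OF dr h]])
  have "AE t in nu. 0 < r t \<longrightarrow> t \<in> I \<longrightarrow> h t = h' t"
    using eq meas(3) unfolding rho by (subst (asm) AE_density) auto
  then show "AE t in nu. t \<in> I \<longrightarrow> cr t * h t = cr t * h' t"
  proof eventually_elim
    case (elim t)
    then show ?case using bound(3)[of t] by (cases "r t = 0") auto
  qed
qed

text \<open>The forcing matters only rho-a.e., since it occurs with the factor \<open>r\<close>.
  Subtracting \<open>f1\<close> from the chi-integral of \<open>f\<close> isolates the forcing as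
  the density of a primitive, where it can be exchanged.\<close>

lemma Sys_rho_cong:
  assumes f: "Sys f f1 g" and h: "loc_int a b rho h" and eq: "AE t in rho. t \<in> I \<longrightarrow> g t = h t"
  shows "Sys f f1 h"
proof -
  have p: "prim f (\<lambda>t. cs t * f1 t)" "prim f1 (\<lambda>t. ck t * f t - cr t * g t)" using f by (simp_all add: Sys_def)
  obtain c where c: "c \<in> I" using nonempty by blast
  have "prim (\<lambda>x. sint cp cn c x f - f1 x) (\<lambda>t. cr t * g t)"
    by (rule prim_cong[OF prim_diff[OF prim_chi[OF Lloc_prim[OF p(1)] c] p(2)]]) simp_all
  from prim_rho_cong[OF this h eq] have q: "prim (\<lambda>x. sint cp cn c x f - f1 x) (\<lambda>t. cr t * h t)" .
  have "prim f1 (\<lambda>t. ck t * f t - cr t * h t)"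
    by (rule prim_cong[OF prim_diff[OF prim_chi[OF Lloc_prim[OF p(1)] c] q]]) simp_all
  then show ?thesis using p(1) by (simp add: Sys_def)
qed

text \<open>For integrable \<open>h\<close> this is the primitive normalised at the left endpoint of
  (a, b); the half-line below x may stand for (a, x) because rho has no mass outside the
  interval.\<close>

definition rcut :: "(real \<Rightarrow> complex) \<Rightarrow> real \<Rightarrow> complex" where
  "rcut h x = (\<integral>t. indicator {..<x} t *\<^sub>R h t \<partial>rho)"

lemma rcut_integrable:
  "integrable rho h \<Longrightarrow> integrable rho (\<lambda>t. indicator {..<x} t *\<^sub>R (h t :: complex))"
  by (intro integrable_mult_indicator) auto

lemma rcut_measurable:
  assumes "integrable rho h" shows "rcut h \<in> borel_measurable borel"
proof -
  have [measurable]: "h \<in> borel_measurable borel" using borel_measurable_integrable[OF assms] by simp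
  have "(\<lambda>(x, t). (if t < x then 1 else 0) *\<^sub>R h t) \<in> borel_measurable (borel \<Otimes>\<^sub>M rho)" by measurable
  from R.borel_measurable_lebesgue_integral[OF this]
  have "(\<lambda>x. \<integral>t. (if t < x then 1 else 0) *\<^sub>R h t \<partial>rho) \<in> borel_measurable borel" by simp
  then show ?thesis unfolding rcut_def indicator_def lessThan_iff by (simp add: of_bool_def)
qed

lemma rcut_bounded:
  assumes h: "integrable rho h" shows "cmod (rcut h x) \<le> (\<integral>t. cmod (h t) \<partial>rho)"
proof -
  have "cmod (rcut h x) \<le> (\<integral>t. cmod (indicator {..<x} t *\<^sub>R h t) \<partial>rho)"
    unfolding rcut_def by (rule integral_norm_bound)
  also have "\<dots> \<le> (\<integral>t. cmod (h t) \<partial>rho)"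
    by (rule integral_mono[OF integrable_norm[OF rcut_integrable[OF h]] integrable_norm[OF h]])
       (simp add: indicator_def)
  finally show ?thesis .
qed

lemma prim_rcut:
  assumes h: "integrable rho h" shows "prim (rcut h) (\<lambda>t. cr t * h t)"
proof -
  have "rcut h y - rcut h x = (\<integral>t. J x y t *\<^sub>R (cr t * h t) \<partial>nu)" if "x \<in> I" "y \<in> I" for x y
  proof -
    have "rcut h y - rcut h x = (\<integral>t. indicator {..<y} t *\<^sub>R h t - indicator {..<x} t *\<^sub>R h t \<partial>rho)"
      unfolding rcut_def using rcut_integrable[OF h] by (intro Bochner_Integration.integral_diff[symmetric])
    also have "(\<lambda>t. indicator {..<y} t *\<^sub>R h t - indicator {..<x} t *\<^sub>R h t) = (\<lambda>t. J x y t *\<^sub>R h t)"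
      by (auto simp: J_def indicator_def)
    also have "(\<integral>t. J x y t *\<^sub>R h t \<partial>rho) = (\<integral>t. J x y t *\<^sub>R (cr t * h t) \<partial>nu)"
      using pint_density[OF dr integrable_loc_int[OF h] that] by (simp add: pint_eq_J)
    finally show ?thesis .
  qed
  then show ?thesis using loc_int_densityD[OF dr integrable_loc_int[OF h]] by (simp add: prim_def)
qed

text \<open>The density is integrable over the whole interval, not just locally, so the bound is
  uniform up to both endpoints. It is applied to boundary forms.\<close>

lemma prim_rho_bounded:
  assumes W: "prim W (\<lambda>t. cr t * h t)" and h: "integrable rho h"
  shows "\<exists>B. \<forall>x\<in>I. cmod (W x) \<le> B"
proof -
  obtain c where c: "c \<in> I" using nonempty by blast
  have "cmod (W x) \<le> cmod (W c) + (\<integral>t. cmod (h t) \<partial>rho)" if x: "x \<in> I" for x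
  proof -
    have "cmod (\<integral>t. J c x t *\<^sub>R h t \<partial>rho) \<le> (\<integral>t. cmod (J c x t *\<^sub>R h t) \<partial>rho)"
      by (rule integral_norm_bound)
    also have "\<dots> \<le> (\<integral>t. cmod (h t) \<partial>rho)"
    proof (rule integral_mono[OF integrable_norm integrable_norm[OF h]])
      show "integrable rho (\<lambda>t. J c x t *\<^sub>R h t)"
        by (rule R.integrable_J[OF integrable_loc_int[OF h] c x])
      show "cmod (J c x t *\<^sub>R h t) \<le> cmod (h t)" for t by (auto simp: J_def indicator_def)
    qed
    finally show ?thesis
      unfolding prim_rhoD[OF W integrable_loc_int[OF h] c x] by (intro norm_triangle_le add_left_mono)
  qed
  then show ?thesis by blast
qed

text \<open>The boundary form is evaluated at functions satisfying the system pointwise, while its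
  density is written with the L2 representatives (primed), which may differ on a rho-null set and
  off the interval.\<close>

lemma Lagrange_identity_L2:
  assumes f: "Sys f f1 g" and v: "Sys v v1 h" and L: "L2 rho f'" "L2 rho g'" "L2 rho v'" "L2 rho h'"
    and eq: "AE t in rho. t \<in> I \<longrightarrow> f t = f' t \<and> g t = g' t \<and> v t = v' t \<and> h t = h' t"
  shows "prim (\<lambda>x. f x * v1 x - f1 x * v x) (\<lambda>t. cr t * (g' t * v' t - f' t * h' t))"
    and "integrable rho (\<lambda>t. g' t * v' t - f' t * h' t)"
proof -
  show i: "integrable rho (\<lambda>t. g' t * v' t - f' t * h' t)"
    by (intro Bochner_Integration.integrable_diff L2_mult_integrable L)
  show "prim (\<lambda>x. f x * v1 x - f1 x * v x) (\<lambda>t. cr t * (g' t * v' t - f' t * h' t))"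
    by (rule prim_rho_cong[OF Lagrange_identity[OF f v] integrable_loc_int[OF i]])
       (use eq in \<open>eventually_elim, simp\<close>)
qed

text \<open>The limit-circle condition controls \<open>u\<close> near each endpoint, and local
  boundedness controls it in between. The indicator is present because \<open>u\<close> is arbitrary
  outside the interval, where even measurability may fail.\<close>

lemma L2_solution:
  assumes u: "Sys u u1 (\<lambda>x. z * u x)"
    and lc: "lc_left a b rho sp sn cp cn" "lc_right a b rho sp sn cp cn"
  shows "L2 rho (\<lambda>x. indicator I x *\<^sub>R u x)"
proof -
  have sol: "is_sol a b rho sp sn cp cn z u" using u is_sol_iff by blast
  obtain c where c: "c \<in> I" and l: "integrable rho (\<lambda>x. indicator {x. a < ereal x \<and> x < c} x * (cmod (u x))\<^sup>2)"
    using lc(1) sol unfolding lc_left_def by blast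
  obtain d where d: "d \<in> I" and r: "integrable rho (\<lambda>x. indicator {x. d < x \<and> ereal x < b} x * (cmod (u x))\<^sup>2)"
    using lc(2) sol unfolding lc_right_def by blast
  have p: "prim u (\<lambda>t. cs t * u1 t)" using u by (simp add: Sys_def)
  obtain B where B: "B \<ge> 0" "\<And>x. x \<in> {c..d} \<Longrightarrow> cmod (u x) \<le> B" using prim_bounded[OF p c d] by blast
  have m: "(\<lambda>x. indicator I x *\<^sub>R u x) \<in> borel_measurable rho"
    using prim_ext_measurable[OF p] by simp
  show ?thesis
  proof (rule L2_bound[OF m])
    show "integrable rho (\<lambda>x. indicator {x. a < ereal x \<and> x < c} x * (cmod (u x))\<^sup>2 +
        indicator {x. d < x \<and> ereal x < b} x * (cmod (u x))\<^sup>2 + indicator {c..d} x *\<^sub>R B\<^sup>2)"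
      using R.finite_compact[OF c d]
      by (intro Bochner_Integration.integrable_add l r integrable_scaleR_left integrable_real_indicator) simp_all
    fix x
    show "(cmod (indicator I x *\<^sub>R u x))\<^sup>2 \<le> indicator {x. a < ereal x \<and> x < c} x * (cmod (u x))\<^sup>2 +
        indicator {x. d < x \<and> ereal x < b} x * (cmod (u x))\<^sup>2 + indicator {c..d} x *\<^sub>R B\<^sup>2"
    proof (cases "x \<in> I")
      case True
      then have x: "a < ereal x" "ereal x < b" by (auto simp: Iab_def)
      \<comment> \<open>The points \<open>c\<close> and \<open>d\<close> come in no particular
        order. If d < c, the middle interval is empty and the two outer ones overlap, so the sum
        still dominates.\<close>
      consider "x < c" | "d < x" | "x \<in> {c..d}" by fastforce
      then show ?thesis
      proof cases
        case 3
        then have "(cmod (u x))\<^sup>2 \<le> B\<^sup>2" using B(2) by (intro power_mono) auto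
        then show ?thesis using 3 True by simp
      qed (use x True in \<open>simp_all add: indicator_def\<close>)
    qed simp
  qed
qed

end

section \<open>The particular solution and its boundary behaviour\<close>

locale lc_problem = sl_densities +
  fixes z :: complex and u1 u1' u2 u2' :: "real \<Rightarrow> complex"
  assumes fund: "fundamental z u1 u1' u2 u2'" and L2u: "L2 rho u1" "L2 rho u2"
begin

definition A :: "(real \<Rightarrow> complex) \<Rightarrow> real \<Rightarrow> complex" where "A g = rcut (\<lambda>t. u2 t * g t)"
definition B :: "(real \<Rightarrow> complex) \<Rightarrow> real \<Rightarrow> complex" where "B g = rcut (\<lambda>t. - (u1 t * g t))"

definition l1 :: "(real \<Rightarrow> complex) \<Rightarrow> complex" where "l1 g = (\<integral>t. u1 t * g t \<partial>rho)"
definition l2 :: "(real \<Rightarrow> complex) \<Rightarrow> complex" where "l2 g = (\<integral>t. u2 t * g t \<partial>rho)"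

text \<open>The solution of \<open>(\<tau> - z) f = g\<close> that vanishes at the left endpoint.\<close>
definition psol :: "(real \<Rightarrow> complex) \<Rightarrow> real \<Rightarrow> complex" where "psol g x = A g x * u1 x + B g x * u2 x"
definition psol' :: "(real \<Rightarrow> complex) \<Rightarrow> real \<Rightarrow> complex" where "psol' g x = A g x * u1' x + B g x * u2' x"

lemma int_AB:
  assumes "L2 rho g"
  shows "integrable rho (\<lambda>t. u1 t * g t)" "integrable rho (\<lambda>t. u2 t * g t)"
    "integrable rho (\<lambda>t. - (u1 t * g t))"
  using L2_mult_integrable[OF L2u(1) assms] L2_mult_integrable[OF L2u(2) assms] by auto

lemma psol_Sys:
  assumes g: "L2 rho g" shows "Sys (psol g) (psol' g) (\<lambda>x. z * psol g x + g x)"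
proof -
  have "prim (B g) (\<lambda>t. - (cr t * (u1 t * g t)))"
    using prim_rcut[OF int_AB(3)[OF g]] by (simp add: B_def)
  from variation_of_constants[OF fund prim_rcut[OF int_AB(2)[OF g]] this]
  show ?thesis by (simp add: psol_def[abs_def] psol'_def[abs_def] A_def)
qed

text \<open>Since \<open>u1\<close>, \<open>u2\<close> and \<open>g\<close> are square integrable up
  to both endpoints, the coefficients \<open>A g\<close> and \<open>B g\<close> are bounded, and
  \<open>psol g\<close> inherits square integrability from \<open>u1\<close> and
  \<open>u2\<close>.\<close>

lemma psol_L2:
  assumes g: "L2 rho g" shows "L2 rho (psol g)"
proof -
  have "L2 rho (\<lambda>x. A g x * u1 x)"
    using rcut_measurable[OF int_AB(2)[OF g]]
    by (intro L2_mult_bounded[OF _ _ L2u(1)]) (auto simp: A_def intro: rcut_bounded[OF int_AB(2)[OF g]])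
  moreover have "L2 rho (\<lambda>x. B g x * u2 x)"
    using rcut_measurable[OF int_AB(3)[OF g]] rcut_bounded[OF int_AB(3)[OF g]] unfolding B_def
    by (intro L2_mult_bounded[OF _ _ L2u(2)]) simp_all
  ultimately show ?thesis unfolding psol_def[abs_def] by (rule L2_add)
qed

lemma rcut_diff_cmult:
  assumes f: "integrable rho f" and h: "integrable rho h"
  shows "rcut (\<lambda>t. f t - c * h t) x = rcut f x - c * rcut h x"
proof -
  have "(\<lambda>t. indicator {..<x} t *\<^sub>R (f t - c * h t)) =
      (\<lambda>t. indicator {..<x} t *\<^sub>R f t - c * (indicator {..<x} t *\<^sub>R h t))"
    by (simp add: algebra_simps)
  then show ?thesis unfolding rcut_def
    by (simp only: Bochner_Integration.integral_diff[OF rcut_integrable[OF f] integrable_mult_right[OF rcut_integrable[OF h]]]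
        integral_mult_right_zero)
qed

lemma psol_diff_cmult:
  assumes "L2 rho g" "L2 rho e"
  shows "psol (\<lambda>t. g t - c * e t) x = psol g x - c * psol e x"
proof -
  have 1: "(\<lambda>t. u2 t * (g t - c * e t)) = (\<lambda>t. u2 t * g t - c * (u2 t * e t))"
    and 2: "(\<lambda>t. - (u1 t * (g t - c * e t))) = (\<lambda>t. - (u1 t * g t) - c * - (u1 t * e t))"
    by (simp_all add: algebra_simps)
  show ?thesis
    unfolding psol_def A_def B_def 1 2 rcut_diff_cmult[OF int_AB(2)[OF assms(1)] int_AB(2)[OF assms(2)]]
      rcut_diff_cmult[OF int_AB(3)[OF assms(1)] int_AB(3)[OF assms(2)]]
    by (simp add: algebra_simps)
qed

lemma l_diff_cmult:
  assumes "L2 rho g" "L2 rho e"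
  shows "l1 (\<lambda>t. g t - c * e t) = l1 g - c * l1 e" "l2 (\<lambda>t. g t - c * e t) = l2 g - c * l2 e"
proof -
  have 1: "(\<lambda>t. u t * (g t - c * e t)) = (\<lambda>t. u t * g t - c * (u t * e t))" for u
    by (simp add: algebra_simps)
  show "l1 (\<lambda>t. g t - c * e t) = l1 g - c * l1 e" "l2 (\<lambda>t. g t - c * e t) = l2 g - c * l2 e"
    unfolding l1_def l2_def 1
    by (simp_all only: Bochner_Integration.integral_diff int_AB assms integrable_mult_right integral_mult_right_zero)
qed

text \<open>If \<open>g\<close> is orthogonal to both solutions, \<open>psol g\<close> vanishes at both endpoints, so no boundary
  term survives in the Lagrange identity with any element of the maximal relation.\<close>
lemma psol_adjoint:
  assumes g: "L2 rho g" and 0: "l1 g = 0" "l2 g = 0"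
    and pq: "(p, q) \<in> Tmax a b rho sp sn cp cn"
  shows "(\<integral>x. (z * psol g x + g x) * cnj (p x) \<partial>rho) = (\<integral>x. psol g x * cnj (q x) \<partial>rho)"
proof -
  obtain p' where L: "L2 rho p" "L2 rho q" and "tau_rel a b rho sp sn cp cn p' q" and eq: "AE x in rho. p x = p' x"
    using pq unfolding Tmax_def by blast
  then obtain p1 where "Sys p' p1 q" using tau_rel_Sys by blast
  \<comment> \<open>The coefficients of the system are real, so conjugation preserves it; the
    sesquilinear identity becomes an instance of the bilinear Lagrange identity.\<close>
  then have v: "Sys (\<lambda>x. cnj (p' x)) (\<lambda>x. cnj (p1 x)) (\<lambda>x. cnj (q x))" by (rule Sys_cnj)
  define W where "W f f1 x = f x * cnj (p1 x) - f1 x * cnj (p' x)" for f f1 x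
  define H where "H f g x = g x * cnj (p x) - f x * cnj (q x)" for f g x
  have u: "Sys u1 u1' (\<lambda>x. z * u1 x)" "Sys u2 u2' (\<lambda>x. z * u2 x)" using fund by (auto simp: fundamental_def)
  have Lag: "prim (W f f1) (\<lambda>t. cr t * H f h t)" "integrable rho (H f h)"
    if "Sys f f1 h" "L2 rho f" "L2 rho h" for f f1 h
    unfolding W_def[abs_def] H_def[abs_def]
    by (rule Lagrange_identity_L2[OF that(1) v that(2,3) L2_cnj[OF L(1)] L2_cnj[OF L(2)]],
        use eq in \<open>eventually_elim, simp\<close>)+
  obtain B1 where B1: "\<And>x. x \<in> I \<Longrightarrow> cmod (W u1 u1' x) \<le> B1"
    using prim_rho_bounded[OF Lag[OF u(1) L2u(1) L2_cmult[OF L2u(1)]]] by blast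
  obtain B2 where B2: "\<And>x. x \<in> I \<Longrightarrow> cmod (W u2 u2' x) \<le> B2"
    using prim_rho_bounded[OF Lag[OF u(2) L2u(2) L2_cmult[OF L2u(2)]]] by blast
  \<comment> \<open>The boundary form is linear in the pair, so for \<open>psol g\<close> it is a
    combination of the two bounded boundary forms of \<open>u1\<close> and \<open>u2\<close>. It
    tends to 0 wherever the coefficients \<open>A g\<close> and \<open>B g\<close> do.\<close>
  have W: "W (psol g) (psol' g) x = A g x * W u1 u1' x + B g x * W u2 u2' x" for x
    by (simp add: W_def psol_def psol'_def algebra_simps)
  obtain \<alpha> \<beta> where ab: "\<And>n. \<alpha> n \<in> I" "\<And>n. \<beta> n \<in> I"
    "\<And>x. x \<in> I \<Longrightarrow> eventually (\<lambda>n. \<alpha> n < x \<and> x < \<beta> n) sequentially"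
    using exhaustion[OF nonempty] by blast
  have rcut_\<alpha>: "(\<lambda>n. rcut h (\<alpha> n)) \<longlonglongrightarrow> 0" and rcut_\<beta>: "(\<lambda>n. rcut h (\<beta> n)) \<longlonglongrightarrow> (\<integral>t. h t \<partial>rho)"
    if h: "integrable rho h" for h
  proof -
    have "(\<lambda>n. \<integral>t. indicator {..<\<alpha> n} t *\<^sub>R h t \<partial>rho) \<longlonglongrightarrow> 0 *\<^sub>R (\<integral>t. h t \<partial>rho)"
    proof (rule R.tendsto_integral_cut[OF h])
      fix t assume "t \<in> I"
      from ab(3)[OF this] have "eventually (\<lambda>n. indicator {..<\<alpha> n} t = (0::real)) sequentially"
        by eventually_elim simp
      then show "(\<lambda>n. indicator {..<\<alpha> n} t) \<longlonglongrightarrow> (0::real)" by (rule tendsto_eventually)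
    qed (simp_all add: indicator_def)
    then show "(\<lambda>n. rcut h (\<alpha> n)) \<longlonglongrightarrow> 0" by (simp add: rcut_def)
    have "(\<lambda>n. \<integral>t. indicator {..<\<beta> n} t *\<^sub>R h t \<partial>rho) \<longlonglongrightarrow> 1 *\<^sub>R (\<integral>t. h t \<partial>rho)"
    proof (rule R.tendsto_integral_cut[OF h])
      fix t assume "t \<in> I"
      from ab(3)[OF this] have "eventually (\<lambda>n. indicator {..<\<beta> n} t = (1::real)) sequentially"
        by eventually_elim simp
      then show "(\<lambda>n. indicator {..<\<beta> n} t) \<longlonglongrightarrow> (1::real)" by (rule tendsto_eventually)
    qed (simp_all add: indicator_def)
    then show "(\<lambda>n. rcut h (\<beta> n)) \<longlonglongrightarrow> (\<integral>t. h t \<partial>rho)" by (simp add: rcut_def)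
  qed
  have null: "(\<lambda>n. w n * v n) \<longlonglongrightarrow> 0" if "w \<longlonglongrightarrow> 0" "\<And>n. cmod (v n) \<le> K" for w v :: "nat \<Rightarrow> complex" and K
    using that by (intro lim_null_mult_right_bounded[where B = K]) auto
  have AB\<alpha>: "(\<lambda>n. A g (\<alpha> n)) \<longlonglongrightarrow> 0" "(\<lambda>n. B g (\<alpha> n)) \<longlonglongrightarrow> 0"
    unfolding A_def B_def by (intro rcut_\<alpha> int_AB[OF g])+
  \<comment> \<open>At the right endpoint the coefficients tend to \<open>l2 g\<close> and
    \<open>- l1 g\<close>; this is where the two orthogonality conditions enter.\<close>
  have AB\<beta>: "(\<lambda>n. A g (\<beta> n)) \<longlonglongrightarrow> 0" "(\<lambda>n. B g (\<beta> n)) \<longlonglongrightarrow> 0"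
    using rcut_\<beta>[OF int_AB(2)[OF g]] rcut_\<beta>[OF int_AB(3)[OF g]] 0 by (simp_all add: A_def B_def l1_def l2_def)
  have W\<alpha>: "(\<lambda>n. W (psol g) (psol' g) (\<alpha> n)) \<longlonglongrightarrow> 0"
    unfolding W using tendsto_add[OF null[OF AB\<alpha>(1) B1[OF ab(1)]] null[OF AB\<alpha>(2) B2[OF ab(1)]]] by simp
  have W\<beta>: "(\<lambda>n. W (psol g) (psol' g) (\<beta> n)) \<longlonglongrightarrow> 0"
    unfolding W using tendsto_add[OF null[OF AB\<beta>(1) B1[OF ab(2)]] null[OF AB\<beta>(2) B2[OF ab(2)]]] by simp
  let ?H = "H (psol g) (\<lambda>x. z * psol g x + g x)"
  note P = psol_Sys[OF g] psol_L2[OF g] L2_add[OF L2_cmult[OF psol_L2[OF g], of z] g]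
  have int: "integrable rho ?H" and prim: "prim (W (psol g) (psol' g)) (\<lambda>t. cr t * ?H t)"
    using Lag[OF P] by blast+
  \<comment> \<open>The boundary form and \<open>rcut ?H\<close> are primitives of the same density,
    so their increments agree; in the limit the integral of \<open>?H\<close> equals a difference of
    vanishing boundary terms.\<close>
  have "W (psol g) (psol' g) (\<beta> n) - W (psol g) (psol' g) (\<alpha> n) = rcut ?H (\<beta> n) - rcut ?H (\<alpha> n)" for n
    using primD[OF prim ab(1)[of n] ab(2)[of n]] primD[OF prim_rcut[OF int] ab(1)[of n] ab(2)[of n]] by simp
  then have "(\<lambda>n. rcut ?H (\<beta> n) - rcut ?H (\<alpha> n)) \<longlonglongrightarrow> 0 - 0"
    using tendsto_diff[OF W\<beta> W\<alpha>] by simp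
  moreover have "(\<lambda>n. rcut ?H (\<beta> n) - rcut ?H (\<alpha> n)) \<longlonglongrightarrow> (\<integral>t. ?H t \<partial>rho) - 0"
    by (intro tendsto_diff rcut_\<alpha> rcut_\<beta> int)
  ultimately have "(\<integral>t. ?H t \<partial>rho) = 0" using LIMSEQ_unique by fastforce
  then show ?thesis unfolding H_def
    using L2_mult_integrable[OF P(3) L2_cnj[OF L(1)]] L2_mult_integrable[OF P(2) L2_cnj[OF L(2)]] by simp
qed

end

section \<open>The resolvent\<close>

lemma resolvent_set_solvable:
  assumes "z \<in> resolvent_set M S" "L2 M g"
  obtains f h where "(f, h) \<in> S" "AE x in M. h x - z * f x = g x"
proof -
  have "\<exists>p\<in>S. AE x in M. snd p x - z * fst p x = g x"
    using assms by (simp add: resolvent_set_def case_prod_beta')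
  then show thesis using that by (metis prod.collapse)
qed

lemma resolvent_set_unique:
  assumes "z \<in> resolvent_set M S" "(f, h) \<in> S" "(f', h') \<in> S"
    and "AE x in M. h x - z * f x = h' x - z * f' x"
  shows "AE x in M. f x = f' x"
proof -
  have "\<forall>p\<in>S. \<forall>q\<in>S. (AE x in M. snd p x - z * fst p x = snd q x - z * fst q x) \<longrightarrow> (AE x in M. fst p x = fst q x)"
    using assms(1) by (simp add: resolvent_set_def case_prod_beta')
  from this[rule_format, OF assms(2,3)] assms(4) show ?thesis by simp
qed

context lc_problem
begin

text \<open>By self-adjointness the resolvent maps \<open>g\<close> to \<open>psol g\<close> as soon as \<open>g\<close> annihilates the two
  functionals \<open>l1, l2\<close>. So \<open>R\<^sub>z g - psol g\<close>, which always lies in the span of \<open>u1, u2\<close>, depends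
  linearly on \<open>(l1 g, l2 g)\<close> only.\<close>
lemma resolvent_representation:
  assumes S: "S \<subseteq> Tmax a b rho sp sn cp cn" "S = adj rho S" and z: "z \<in> resolvent_set rho S"
  obtains m11 m12 m21 m22 where
    "\<And>f h g. \<lbrakk>(f, h) \<in> S; L2 rho g; AE x in rho. h x - z * f x = g x\<rbrakk> \<Longrightarrow>
      AE x in rho. f x = psol g x + (m11 * l1 g + m12 * l2 g) * u1 x + (m21 * l1 g + m22 * l2 g) * u2 x"
proof -
  have L2S: "L2 rho f \<and> L2 rho h" if "(f, h) \<in> S" for f h using that S(1) by (auto simp: Tmax_def)
  have ker: "AE x in rho. f x = psol g x"
    if S': "(f, h) \<in> S" and g: "L2 rho g" "l1 g = 0" "l2 g = 0" and eq: "AE x in rho. h x - z * f x = g x" for f h g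
  proof -
    have "(psol g, \<lambda>x. z * psol g x + g x) \<in> adj rho S"
      unfolding adj_def
    proof (clarsimp, intro conjI ballI)
      show "L2 rho (psol g)" by (rule psol_L2[OF g(1)])
      then show "L2 rho (\<lambda>x. z * psol g x + g x)" by (intro L2_add L2_cmult g(1))
      fix p assume "p \<in> S"
      then have "p \<in> Tmax a b rho sp sn cp cn" using S(1) by blast
      then show "case p of (u, v) \<Rightarrow> (\<integral>x. (z * psol g x + g x) * cnj (u x) \<partial>rho) = (\<integral>x. psol g x * cnj (v x) \<partial>rho)"
        using psol_adjoint[OF g] by (cases p) simp
    qed
    then have "(psol g, \<lambda>x. z * psol g x + g x) \<in> S" using S(2) by simp
    moreover have "AE x in rho. h x - z * f x = (z * psol g x + g x) - z * psol g x"
      using eq by eventually_elim simp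
    ultimately show ?thesis by (rule resolvent_set_unique[OF z S'])
  qed
  have span: "\<exists>c d. AE x in rho. f x = psol g x + c * u1 x + d * u2 x"
    if S': "(f, h) \<in> S" and g: "L2 rho g" and eq: "AE x in rho. h x - z * f x = g x" for f h g
  proof -
    obtain f' where f': "tau_rel a b rho sp sn cp cn f' h" "AE x in rho. f x = f' x"
      using S' S(1) unfolding Tmax_def by blast
    then obtain f1 where f1: "Sys f' f1 h" using tau_rel_Sys by blast
    have "Lloc f'" using f1 by (auto simp: Sys_def intro: Lloc_prim)
    then have f'_loc: "loc_int a b rho f'" by (rule loc_int_densityI[OF dr])
    have g_loc: "loc_int a b rho g" by (rule R.L2_Lloc[OF g])
    \<comment> \<open>The relation between \<open>h\<close> and \<open>z * f' + g\<close> holds only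
      rho-a.e. Once the forcing has been exchanged accordingly, \<open>f' - psol g\<close> solves
      the homogeneous system on the whole interval.\<close>
    have "loc_int a b rho (\<lambda>x. z * f' x + g x)"
      by (intro R.Lloc_add R.Lloc_cmult f'_loc g_loc)
    moreover have "AE x in rho. x \<in> I \<longrightarrow> h x = z * f' x + g x"
      using eq f'(2) by eventually_elim (simp add: algebra_simps)
    ultimately have "Sys f' f1 (\<lambda>x. z * f' x + g x)" by (rule Sys_rho_cong[OF f1])
    from Sys_diff[OF this psol_Sys[OF g]]
    have "Sys (\<lambda>x. f' x - psol g x) (\<lambda>x. f1 x - psol' g x) (\<lambda>x. z * (f' x - psol g x))"
      by (rule Sys_cong) (simp add: algebra_simps)
    from solution_in_span[OF fund this] obtain c d where
      cd: "\<And>x. x \<in> I \<Longrightarrow> f' x - psol g x = c * u1 x + d * u2 x" by blast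
    have "AE x in rho. f x = psol g x + c * u1 x + d * u2 x"
      using f'(2) R.AE_I by eventually_elim (use cd in \<open>simp add: algebra_simps\<close>)
    then show ?thesis by blast
  qed
  obtain e1 k1 where e1: "L2 rho e1" and k1: "\<And>g. L2 rho g \<Longrightarrow> l1 (\<lambda>x. g x - k1 * l1 g * e1 x) = 0"
    using functional_complement[of "L2 rho" l1] L2_zero l_diff_cmult(1) by blast
  \<comment> \<open>The second correction function is sought inside the kernel of \<open>l1\<close>,
    so that removing the \<open>l2\<close> part does not spoil the condition already achieved for
    \<open>l1\<close>.\<close>
  obtain e2 k2 where e2: "L2 rho e2" "l1 e2 = 0"
    and k2: "\<And>g. L2 rho g \<Longrightarrow> l1 g = 0 \<Longrightarrow> l2 (\<lambda>x. g x - k2 * l2 g * e2 x) = 0"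
  proof -
    have "\<exists>e k. (L2 rho e \<and> l1 e = 0) \<and> (\<forall>g. L2 rho g \<and> l1 g = 0 \<longrightarrow> l2 (\<lambda>x. g x - k * l2 g * e x) = 0)"
      by (rule functional_complement) (simp_all add: l1_def L2_zero l_diff_cmult(2))
    then show ?thesis using that by blast
  qed
  obtain f1 h1 where s1: "(f1, h1) \<in> S" "AE x in rho. h1 x - z * f1 x = e1 x"
    using resolvent_set_solvable[OF z e1] by blast
  obtain f2 h2 where s2: "(f2, h2) \<in> S" "AE x in rho. h2 x - z * f2 x = e2 x"
    using resolvent_set_solvable[OF z e2(1)] by blast
  obtain a1 b1 where ab1: "AE x in rho. f1 x = psol e1 x + a1 * u1 x + b1 * u2 x"
    using span[OF s1(1) e1 s1(2)] by blast
  obtain a2 b2 where ab2: "AE x in rho. f2 x = psol e2 x + a2 * u1 x + b2 * u2 x"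
    using span[OF s2(1) e2(1) s2(2)] by blast
  have Sd: "(\<lambda>x. f x - c * f' x, \<lambda>x. h x - c * h' x) \<in> S" if "(f, h) \<in> S" "(f', h') \<in> S" for f h f' h' c
    using adj_diff_cmult[of S rho f h f' h' c] that S(2) L2S by blast
  have main: "AE x in rho. f x = psol g x
      + (k1 * a1 * l1 g + k2 * (l2 g - k1 * l1 g * l2 e1) * a2) * u1 x
      + (k1 * b1 * l1 g + k2 * (l2 g - k1 * l1 g * l2 e1) * b2) * u2 x"
    if S': "(f, h) \<in> S" and g: "L2 rho g" and eq: "AE x in rho. h x - z * f x = g x" for f h g
  proof -
    \<comment> \<open>Multiples of \<open>e1\<close> and \<open>e2\<close> are subtracted from
      \<open>g\<close> to reach the common kernel of \<open>l1, l2\<close>. There \<open>ker\<close>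
      gives the resolvent as \<open>psol\<close>, and adding back the known resolvents of
      \<open>e1\<close> and \<open>e2\<close> yields the coefficients of \<open>u1\<close> and
      \<open>u2\<close>.\<close>
    define c1 where "c1 = k1 * l1 g"
    define g' where "g' = (\<lambda>x. g x - c1 * e1 x)"
    have g': "L2 rho g'" "l1 g' = 0" unfolding g'_def c1_def using L2_diff_cmult[OF g e1] k1[OF g] by auto
    have l2g': "l2 g' = l2 g - c1 * l2 e1" unfolding g'_def by (rule l_diff_cmult(2)[OF g e1])
    define c2 where "c2 = k2 * l2 g'"
    define g'' where "g'' = (\<lambda>x. g' x - c2 * e2 x)"
    have g'': "L2 rho g''" "l1 g'' = 0" "l2 g'' = 0"
      unfolding g''_def c2_def using L2_diff_cmult[OF g'(1) e2(1)] k2[OF g'] l_diff_cmult(1)[OF g'(1) e2(1)] g'(2) e2(2)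
      by auto
    have "AE x in rho. (h x - c1 * h1 x - c2 * h2 x) - z * (f x - c1 * f1 x - c2 * f2 x) = g'' x"
      using eq s1(2) s2(2)
    proof eventually_elim
      case (elim x)
      have "(h x - c1 * h1 x - c2 * h2 x) - z * (f x - c1 * f1 x - c2 * f2 x) =
        (h x - z * f x) - c1 * (h1 x - z * f1 x) - c2 * (h2 x - z * f2 x)" by (simp add: algebra_simps)
      then show ?case unfolding elim by (simp add: g''_def g'_def)
    qed
    then have k: "AE x in rho. f x - c1 * f1 x - c2 * f2 x = psol g'' x"
      by (rule ker[OF Sd[OF Sd[OF S' s1(1)] s2(1)] g''])
    have ps: "psol g'' x = psol g x - c1 * psol e1 x - c2 * psol e2 x" for x
      unfolding g''_def psol_diff_cmult[OF g'(1) e2(1)] unfolding g'_def psol_diff_cmult[OF g e1] ..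
    have "AE x in rho. f x = psol g x + (c1 * a1 + c2 * a2) * u1 x + (c1 * b1 + c2 * b2) * u2 x"
      using k ab1 ab2
    proof eventually_elim
      case (elim x)
      have "f x = (f x - c1 * f1 x - c2 * f2 x) + c1 * f1 x + c2 * f2 x" by simp
      also have "\<dots> = psol g x + (c1 * a1 + c2 * a2) * u1 x + (c1 * b1 + c2 * b2) * u2 x"
        unfolding elim(1) unfolding elim(2,3) ps by (simp add: algebra_simps)
      finally show ?case .
    qed
    then show ?thesis by (simp add: c1_def c2_def l2g' mult_ac)
  qed
  show thesis
  proof (rule that)
    fix f h g assume "(f, h) \<in> S" "L2 rho g" "AE x in rho. h x - z * f x = g x"
    from main[OF this]
    show "AE x in rho. f x = psol g x
      + ((k1 * a1 - k2 * k1 * l2 e1 * a2) * l1 g + k2 * a2 * l2 g) * u1 x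
      + ((k1 * b1 - k2 * k1 * l2 e1 * b2) * l1 g + k2 * b2 * l2 g) * u2 x"
      by eventually_elim (simp add: algebra_simps)
  qed
qed

section \<open>The Green kernel\<close>

definition green :: "complex \<Rightarrow> complex \<Rightarrow> complex \<Rightarrow> complex \<Rightarrow> real \<Rightarrow> real \<Rightarrow> complex" where
  "green m11 m12 m21 m22 x y = (if y < x then u1 x * u2 y - u2 x * u1 y else 0) +
     (m11 * u1 x * u1 y + m12 * u1 x * u2 y + m21 * u2 x * u1 y + m22 * u2 x * u2 y)"

text \<open>The triangular part of \<open>green\<close> comes from variation of constants and
  integrates to \<open>psol g\<close>. The remaining part is degenerate and realises the linear map
  from \<open>(l1 g, l2 g)\<close> to the coefficients of \<open>u1\<close> and \<open>u2\<close>.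
  Both identities hold at every x.\<close>

lemma green_integral:
  assumes g: "L2 rho g"
  shows "integrable rho (\<lambda>y. green m11 m12 m21 m22 x y * g y)" (is ?int)
    and "(\<integral>y. green m11 m12 m21 m22 x y * g y \<partial>rho) =
      psol g x + (m11 * l1 g + m12 * l2 g) * u1 x + (m21 * l1 g + m22 * l2 g) * u2 x" (is ?eq)
proof -
  let ?F = "\<lambda>y. u1 x * (indicator {..<x} y *\<^sub>R (u2 y * g y)) + u2 x * (indicator {..<x} y *\<^sub>R - (u1 y * g y)) +
      (m11 * u1 x + m21 * u2 x) * (u1 y * g y) + (m12 * u1 x + m22 * u2 x) * (u2 y * g y)"
  have e: "(\<lambda>y. green m11 m12 m21 m22 x y * g y) = ?F"
    by (auto simp: green_def fun_eq_iff indicator_def algebra_simps)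
  note i = integrable_mult_right[OF rcut_integrable[OF int_AB(2)[OF g], of x], of "u1 x"]
    integrable_mult_right[OF rcut_integrable[OF int_AB(3)[OF g], of x], of "u2 x"]
    integrable_mult_right[OF int_AB(1)[OF g], of "m11 * u1 x + m21 * u2 x"]
    integrable_mult_right[OF int_AB(2)[OF g], of "m12 * u1 x + m22 * u2 x"]
  note j = Bochner_Integration.integrable_add[OF i(1,2)]
  note j' = Bochner_Integration.integrable_add[OF j i(3)]
  show ?int unfolding e by (rule Bochner_Integration.integrable_add[OF j' i(4)])
  have "(\<integral>y. green m11 m12 m21 m22 x y * g y \<partial>rho) = u1 x * A g x + u2 x * B g x +
      (m11 * u1 x + m21 * u2 x) * l1 g + (m12 * u1 x + m22 * u2 x) * l2 g"
    unfolding e Bochner_Integration.integral_add[OF j' i(4)] Bochner_Integration.integral_add[OF j i(3)]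
      Bochner_Integration.integral_add[OF i(1,2)] integral_mult_right_zero
    unfolding A_def B_def rcut_def l1_def l2_def ..
  then show ?eq by (simp add: psol_def algebra_simps)
qed

lemma green_measurable: "(\<lambda>(x, y). green m11 m12 m21 m22 x y) \<in> borel_measurable (rho \<Otimes>\<^sub>M rho)"
proof -
  have [measurable]: "u1 \<in> borel_measurable borel" "u2 \<in> borel_measurable borel"
    using L2_measurable[OF L2u(1)] L2_measurable[OF L2u(2)] by simp_all
  have sets2: "sets (rho \<Otimes>\<^sub>M rho) = sets (borel \<Otimes>\<^sub>M borel)" by (intro sets_pair_measure_cong R.sets_nu)
  have "(\<lambda>(x, y). green m11 m12 m21 m22 x y) \<in> borel_measurable (borel \<Otimes>\<^sub>M borel)"
    unfolding green_def by measurable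
  then show ?thesis by (simp only: measurable_cong_sets[OF sets2 refl])
qed

text \<open>The kernel is dominated by a product of a function of x and a function of y, each a
  multiple of the sum of the moduli of \<open>u1\<close> and \<open>u2\<close>. Squares of such sums
  are at most twice the sums of squares, whence the factor 4.\<close>

lemma green_square_integrable:
  "integrable (rho \<Otimes>\<^sub>M rho) (\<lambda>(x, y). (cmod (green m11 m12 m21 m22 x y))\<^sup>2)"
proof (rule Bochner_Integration.integrable_bound)
  let ?q = "\<lambda>x. (cmod (u1 x))\<^sup>2 + (cmod (u2 x))\<^sup>2"
  \<comment> \<open>The summand 1 accounts for the triangular part, the others for the four
    degenerate terms.\<close>
  define K where "K = 1 + cmod m11 + cmod m12 + cmod m21 + cmod m22"
  have "integrable rho ?q" using L2u by (auto simp: L2_def)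
  then show "integrable (rho \<Otimes>\<^sub>M rho) (\<lambda>p. 4 * K\<^sup>2 * (case p of (x, y) \<Rightarrow> ?q x * ?q y))"
    by (intro integrable_mult_right R.integrable_product)
  show "(\<lambda>(x, y). (cmod (green m11 m12 m21 m22 x y))\<^sup>2) \<in> borel_measurable (rho \<Otimes>\<^sub>M rho)"
    using green_measurable[of m11 m12 m21 m22] by (simp add: case_prod_beta')
  have "(cmod (green m11 m12 m21 m22 x y))\<^sup>2 \<le> 4 * K\<^sup>2 * (?q x * ?q y)" for x y
  proof -
    define p where "p = cmod (u1 x) + cmod (u2 x)"
    define q where "q = cmod (u1 y) + cmod (u2 y)"
    have pq: "p \<ge> 0" "q \<ge> 0" by (simp_all add: p_def q_def)
    have t: "cmod (m * v * w) \<le> cmod m * (p * q)" if "cmod v \<le> p" "cmod w \<le> q" for m v w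
      unfolding norm_mult mult.assoc using that pq by (intro mult_left_mono mult_mono) auto
    have v: "cmod (u1 x) \<le> p" "cmod (u2 x) \<le> p" "cmod (u1 y) \<le> q" "cmod (u2 y) \<le> q"
      by (simp_all add: p_def q_def)
    have 1: "cmod (if y < x then u1 x * u2 y - u2 x * u1 y else 0) \<le> p * q"
    proof -
      have "cmod (u1 x * u2 y - u2 x * u1 y) \<le> cmod (u1 x) * cmod (u2 y) + cmod (u2 x) * cmod (u1 y)"
        using norm_triangle_ineq4[of "u1 x * u2 y" "u2 x * u1 y"] by (simp add: norm_mult)
      also have "\<dots> \<le> p * q" by (simp add: p_def q_def algebra_simps)
      finally show ?thesis using pq by simp
    qed
    have "cmod (green m11 m12 m21 m22 x y) \<le>
      p * q + (cmod m11 * (p * q) + cmod m12 * (p * q) + cmod m21 * (p * q) + cmod m22 * (p * q))"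
      unfolding green_def by (intro norm_triangle_le add_mono 1 t v)
    also have "\<dots> = K * p * q" by (simp add: K_def algebra_simps)
    finally have "(cmod (green m11 m12 m21 m22 x y))\<^sup>2 \<le> (K * p * q)\<^sup>2" by (intro power_mono) auto
    also have "\<dots> = K\<^sup>2 * (p\<^sup>2 * q\<^sup>2)" by (simp add: power_mult_distrib)
    also have "\<dots> \<le> K\<^sup>2 * ((2 * ?q x) * (2 * ?q y))"
      using sum_squares_bound[of "cmod (u1 x)" "cmod (u2 x)"] sum_squares_bound[of "cmod (u1 y)" "cmod (u2 y)"]
      by (intro mult_left_mono mult_mono) (auto simp: p_def q_def power2_sum)
    also have "\<dots> = 4 * K\<^sup>2 * (?q x * ?q y)" by (simp only: mult_ac)
    finally show ?thesis .
  qed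
  then show "AE p in rho \<Otimes>\<^sub>M rho. norm (case p of (x, y) \<Rightarrow> (cmod (green m11 m12 m21 m22 x y))\<^sup>2) \<le>
      norm (4 * K\<^sup>2 * (case p of (x, y) \<Rightarrow> ?q x * ?q y))"
    by (intro AE_I2) (auto simp: abs_mult)
qed

text \<open>The coefficient matrix of \<open>w1, w2\<close> relative to \<open>u1, u2\<close> is
  inverted by Cramer's rule. If its determinant \<open>D\<close> were 0, the adjugate would give
  vanishing combinations of \<open>w1, w2\<close>; independence would force all its entries to be 0,
  and then \<open>w1\<close> would vanish.\<close>

lemma change_of_basis:
  assumes w1: "is_sol a b rho sp sn cp cn z w1" and w2: "is_sol a b rho sp sn cp cn z w2"
    and ind: "\<And>c1 c2. (\<And>x. x \<in> I \<Longrightarrow> c1 * w1 x + c2 * w2 x = 0) \<Longrightarrow> c1 = 0 \<and> c2 = 0"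
  obtains p11 p12 p21 p22 where "\<And>x. x \<in> I \<Longrightarrow> u1 x = p11 * w1 x + p12 * w2 x"
    "\<And>x. x \<in> I \<Longrightarrow> u2 x = p21 * w1 x + p22 * w2 x"
proof -
  obtain a11 a12 where 1: "\<And>x. x \<in> I \<Longrightarrow> w1 x = a11 * u1 x + a12 * u2 x"
    using w1 is_sol_iff solution_in_span[OF fund] by meson
  obtain a21 a22 where 2: "\<And>x. x \<in> I \<Longrightarrow> w2 x = a21 * u1 x + a22 * u2 x"
    using w2 is_sol_iff solution_in_span[OF fund] by meson
  define D where "D = a11 * a22 - a12 * a21"
  have e1: "a22 * w1 x + (- a12) * w2 x = D * u1 x" and e2: "(- a21) * w1 x + a11 * w2 x = D * u2 x" if "x \<in> I" for x
    unfolding 1[OF that] 2[OF that] D_def by (simp_all add: algebra_simps)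
  have "D \<noteq> 0"
  proof
    assume D: "D = 0"
    have "a22 = 0 \<and> - a12 = 0" by (rule ind) (simp only: e1 D mult_zero_left)
    moreover have "- a21 = 0 \<and> a11 = 0" by (rule ind) (simp only: e2 D mult_zero_left)
    ultimately have "w1 x = 0" if "x \<in> I" for x using 1[OF that] by simp
    then have "(1::complex) = 0 \<and> (0::complex) = 0" by (intro ind) simp
    then show False by simp
  qed
  then have "u1 x = a22 / D * w1 x + (- a12 / D) * w2 x" "u2 x = - a21 / D * w1 x + a11 / D * w2 x" if "x \<in> I" for x
    using e1[OF that] e2[OF that] by (simp_all add: field_simps)
  then show ?thesis by (rule that)
qed

end

text \<open>The coefficients are the entries of the transpose of P times M times P, where the rows
  of P are the coordinates of the old basis in the new one.\<close>

lemma bilinear_coefficients: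
  fixes M11 M12 M21 M22 p11 p12 p21 p22 :: complex
  obtains n :: "nat \<Rightarrow> nat \<Rightarrow> complex" where
    "\<And>v1 v2 w1 w2. M11 * (p11 * v1 + p12 * v2) * (p11 * w1 + p12 * w2) + M12 * (p11 * v1 + p12 * v2) * (p21 * w1 + p22 * w2)
      + M21 * (p21 * v1 + p22 * v2) * (p11 * w1 + p12 * w2) + M22 * (p21 * v1 + p22 * v2) * (p21 * w1 + p22 * w2)
     = n 1 1 * v1 * w1 + n 1 2 * v1 * w2 + n 2 1 * v2 * w1 + n 2 2 * v2 * w2"
proof -
  define n :: "nat \<Rightarrow> nat \<Rightarrow> complex" where "n = (\<lambda>i j.
      if i = 1 then if j = 1 then M11 * p11 * p11 + M12 * p11 * p21 + M21 * p21 * p11 + M22 * p21 * p21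
        else M11 * p11 * p12 + M12 * p11 * p22 + M21 * p21 * p12 + M22 * p21 * p22
      else if j = 1 then M11 * p12 * p11 + M12 * p12 * p21 + M21 * p22 * p11 + M22 * p22 * p21
        else M11 * p12 * p12 + M12 * p12 * p22 + M21 * p22 * p12 + M22 * p22 * p22)"
  have n: "n 1 1 = M11 * p11 * p11 + M12 * p11 * p21 + M21 * p21 * p11 + M22 * p21 * p21"
    "n 1 2 = M11 * p11 * p12 + M12 * p11 * p22 + M21 * p21 * p12 + M22 * p21 * p22"
    "n 2 1 = M11 * p12 * p11 + M12 * p12 * p21 + M21 * p22 * p11 + M22 * p22 * p21"
    "n 2 2 = M11 * p12 * p12 + M12 * p12 * p22 + M21 * p22 * p12 + M22 * p22 * p22"
    by (simp_all add: n_def)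
  show thesis by (rule that[of n], unfold n) (simp only: algebra_simps)
qed

section \<open>From the standing hypotheses to densities, and the final assembly\<close>

lemma measure_density_point:
  fixes d :: "real \<Rightarrow> real"
  assumes "sets M = sets borel" "d \<in> borel_measurable borel" "\<And>x. 0 \<le> d x"
  shows "measure (density M d) {x} = d x * measure M {x}"
proof -
  have "emeasure (density M d) {x} = (\<integral>\<^sup>+t. ennreal (d t) * indicator {x} t \<partial>M)"
    using assms by (subst emeasure_density) (auto cong: measurable_cong_sets)
  also have "\<dots> = (\<integral>\<^sup>+t. ennreal (d x) * indicator {x} t \<partial>M)"
    by (intro nn_integral_cong) (auto simp: indicator_def)
  also have "\<dots> = ennreal (d x) * emeasure M {x}"
    using assms(1) by (simp add: nn_integral_cmult)
  finally show ?thesis using assms(3)[of x] by (simp add: measure_def enn2real_mult)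
qed

lemma standing_hyps_sl_densities:
  assumes H: "standing_hyps a b rho sp sn cp cn"
  shows "\<exists>nu s k r dsp dsn dcp dcn. sl_densities a b nu s k r sp sn cp cn rho dsp dsn dcp dcn"
proof -
  have lfN: "lf_measure a b N" if "N \<in> {rho, sp, sn, cp, cn}" for N
    using H that by (auto simp: standing_hyps_def real_lf_measure_def)
  \<comment> \<open>The five measures form a set, so coinciding ones are summed once; only
    domination of each of them matters.\<close>
  obtain nu where nu: "lf_measure a b nu"
    and dom: "\<And>N A. N \<in> {rho, sp, sn, cp, cn} \<Longrightarrow> A \<in> sets borel \<Longrightarrow> emeasure N A \<le> emeasure nu A"
    using lf_measure_sum[of "{rho, sp, sn, cp, cn}" a b "\<lambda>N. N"] lfN by blast
  interpret lf_space a b nu using nu by unfold_locales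
  have RN: "\<exists>d :: real \<Rightarrow> real. d \<in> borel_measurable borel \<and> (\<forall>x. 0 \<le> d x \<and> d x \<le> 1) \<and> N = density nu (\<lambda>x. ennreal (d x))"
    if "N \<in> {rho, sp, sn, cp, cn}" for N
  proof -
    have "sets N = sets nu" using lfN[OF that] by (simp add: lf_measure_def)
    from bounded_Radon_Nikodym[OF sigma_finite_measure_axioms this] dom[OF that]
    show ?thesis by (simp add: measurable_cong_sets[OF sets_nu refl])
  qed
  obtain r :: "real \<Rightarrow> real" where r: "r \<in> borel_measurable borel" "\<And>x. 0 \<le> r x" "\<And>x. r x \<le> 1" "rho = density nu r"
    using RN[of rho] by blast
  obtain dsp :: "real \<Rightarrow> real" where dsp: "dsp \<in> borel_measurable borel" "\<And>x. 0 \<le> dsp x" "\<And>x. dsp x \<le> 1" "sp = density nu dsp"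
    using RN[of sp] by blast
  obtain dsn :: "real \<Rightarrow> real" where dsn: "dsn \<in> borel_measurable borel" "\<And>x. 0 \<le> dsn x" "\<And>x. dsn x \<le> 1" "sn = density nu dsn"
    using RN[of sn] by blast
  obtain dcp :: "real \<Rightarrow> real" where dcp: "dcp \<in> borel_measurable borel" "\<And>x. 0 \<le> dcp x" "\<And>x. dcp x \<le> 1" "cp = density nu dcp"
    using RN[of cp] by blast
  obtain dcn :: "real \<Rightarrow> real" where dcn: "dcn \<in> borel_measurable borel" "\<And>x. 0 \<le> dcn x" "\<And>x. dcn x \<le> 1" "cn = density nu dcn"
    using RN[of cn] by blast
  define s where "s x = dsp x - dsn x" for x
  define k where "k x = dcp x - dcn x" for x
  have pt: "rpoint sp sn x = s x * measure nu {x}" "rpoint cp cn x = k x * measure nu {x}"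
    "measure rho {x} = r x * measure nu {x}" for x
    unfolding rpoint_def s_def k_def dsp(4) dsn(4) dcp(4) dcn(4) r(4)
    using measure_density_point[OF sets_nu dsp(1,2)] measure_density_point[OF sets_nu dsn(1,2)]
      measure_density_point[OF sets_nu dcp(1,2)] measure_density_point[OF sets_nu dcn(1,2)]
      measure_density_point[OF sets_nu r(1,2)]
    by (simp_all add: left_diff_distrib)
  have at: "s t * k t * measure nu {t} = 0" "s t * r t * measure nu {t} = 0" if "t \<in> Iab a b" for t
  proof -
    have "rpoint sp sn t * rpoint cp cn t = 0 \<and> rpoint sp sn t * measure rho {t} = 0"
      using H that unfolding standing_hyps_def by blast
    \<comment> \<open>A product of two point masses contains the square of the mass of
      \<open>nu\<close> at t; it vanishes exactly when the version with a single factor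
      does.\<close>
    then show "s t * k t * measure nu {t} = 0" "s t * r t * measure nu {t} = 0"
      unfolding pt by auto
  qed
  have ne: "Iab a b \<noteq> {}" using H unfolding standing_hyps_def msupp_def by blast
  have "sl_densities a b nu s k r sp sn cp cn rho dsp dsn dcp dcn"
  proof unfold_locales
    show "s \<in> borel_measurable borel" "k \<in> borel_measurable borel"
      unfolding s_def[abs_def] k_def[abs_def] using dsp(1) dsn(1) dcp(1) dcn(1) by measurable
    show "\<bar>s t\<bar> \<le> 1" "\<bar>k t\<bar> \<le> 1" for t
      using dsp(2,3)[of t] dsn(2,3)[of t] dcp(2,3)[of t] dcn(2,3)[of t] by (auto simp: s_def k_def)
  qed (fact r dsp dsn dcp dcn at ne lfN[of rho, simplified] s_def k_def)+
  then show ?thesis by blast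
qed

theorem theorem8p1:
  fixes a b :: ereal and rho sp sn cp cn :: "real measure"
    and S :: "((real \<Rightarrow> complex) \<times> (real \<Rightarrow> complex)) set" and z :: complex
  assumes "standing_hyps a b rho sp sn cp cn"
    and "lc_left a b rho sp sn cp cn" and "lc_right a b rho sp sn cp cn"
    and "S \<subseteq> Tmax a b rho sp sn cp cn" and "S = adj rho S"
    and "z \<in> resolvent_set rho S"
  shows "\<exists>G :: real \<Rightarrow> real \<Rightarrow> complex.
     (\<lambda>(x, y). G x y) \<in> borel_measurable (rho \<Otimes>\<^sub>M rho) \<and>
     integrable (rho \<Otimes>\<^sub>M rho) (\<lambda>(x, y). (cmod (G x y))\<^sup>2) \<and>
     (\<forall>g. L2 rho g \<longrightarrow> (\<forall>(f, h) \<in> S. (AE x in rho. h x - z * f x = g x) \<longrightarrow>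
        (AE x in rho. integrable rho (\<lambda>y. G x y * g y) \<and> f x = (\<integral>y. G x y * g y \<partial>rho)))) \<and>
     (\<forall>u1 u2. is_sol a b rho sp sn cp cn z u1 \<and> is_sol a b rho sp sn cp cn z u2 \<and>
        (\<forall>c1 c2. (\<forall>x\<in>Iab a b. c1 * u1 x + c2 * u2 x = 0) \<longrightarrow> c1 = 0 \<and> c2 = 0) \<longrightarrow>
        (\<exists>(mplus :: nat \<Rightarrow> nat \<Rightarrow> complex) (mminus :: nat \<Rightarrow> nat \<Rightarrow> complex). \<forall>x\<in>Iab a b. \<forall>y\<in>Iab a b.
           G x y = (if y < x then
              mplus 1 1 * u1 x * u1 y + mplus 1 2 * u1 x * u2 y + mplus 2 1 * u2 x * u1 y + mplus 2 2 * u2 x * u2 y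
            else
              mminus 1 1 * u1 x * u1 y + mminus 1 2 * u1 x * u2 y + mminus 2 1 * u2 x * u1 y + mminus 2 2 * u2 x * u2 y)))"
proof -
  obtain nu s k r dsp dsn dcp dcn where "sl_densities a b nu s k r sp sn cp cn rho dsp dsn dcp dcn"
    using standing_hyps_sl_densities[OF assms(1)] by blast
  then interpret sl_densities a b nu s k r sp sn cp cn rho dsp dsn dcp dcn .
  obtain v1 v1' v2 v2' where v: "fundamental z v1 v1' v2 v2'" using fundamental_exists by blast
  \<comment> \<open>Solutions are unconstrained outside (a, b). Setting them to 0 there makes them
    Borel functions on the line and hence the kernel measurable, without affecting the system or the
    Wronskian inside.\<close>
  define u1 where "u1 = (\<lambda>x. indicator (Iab a b) x *\<^sub>R v1 x)"
  define u2 where "u2 = (\<lambda>x. indicator (Iab a b) x *\<^sub>R v2 x)"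
  have Sys_ext: "Sys (\<lambda>x. indicator (Iab a b) x *\<^sub>R u x) u' (\<lambda>x. z * (indicator (Iab a b) x *\<^sub>R u x))"
    if "Sys u u' (\<lambda>x. z * u x)" for u u'
    using that unfolding Sys_def by (auto intro: prim_cong)
  have "fundamental z u1 v1' u2 v2'"
    using v Sys_ext unfolding fundamental_def u1_def u2_def by simp
  moreover have "L2 rho u1" "L2 rho u2"
    using v L2_solution[OF _ assms(2,3)] unfolding fundamental_def u1_def u2_def by blast+
  ultimately interpret lc_problem a b nu s k r sp sn cp cn rho dsp dsn dcp dcn z u1 v1' u2 v2'
    by unfold_locales
  obtain m11 m12 m21 m22 where m: "\<And>f h g. \<lbrakk>(f, h) \<in> S; L2 rho g; AE x in rho. h x - z * f x = g x\<rbrakk> \<Longrightarrow>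
      AE x in rho. f x = psol g x + (m11 * l1 g + m12 * l2 g) * u1 x + (m21 * l1 g + m22 * l2 g) * u2 x"
    using resolvent_representation[OF assms(4-6)] by blast
  let ?G = "green m11 m12 m21 m22"
  show ?thesis
  proof (intro exI[of _ ?G] conjI allI impI ballI)
    show "(\<lambda>(x, y). ?G x y) \<in> borel_measurable (rho \<Otimes>\<^sub>M rho)" by (rule green_measurable)
    show "integrable (rho \<Otimes>\<^sub>M rho) (\<lambda>(x, y). (cmod (?G x y))\<^sup>2)" by (rule green_square_integrable)
    show "case p of (f, h) \<Rightarrow> (AE x in rho. h x - z * f x = g x) \<longrightarrow>
        (AE x in rho. integrable rho (\<lambda>y. ?G x y * g y) \<and> f x = (\<integral>y. ?G x y * g y \<partial>rho))"
      if g: "L2 rho g" and p: "p \<in> S" for g p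
    proof (cases p)
      case (Pair f h)
      then show ?thesis using m[of f h g] p g green_integral[OF g] by simp
    qed
    fix w1 w2
    assume w: "is_sol a b rho sp sn cp cn z w1 \<and> is_sol a b rho sp sn cp cn z w2 \<and>
        (\<forall>c1 c2. (\<forall>x\<in>Iab a b. c1 * w1 x + c2 * w2 x = 0) \<longrightarrow> c1 = 0 \<and> c2 = 0)"
    obtain p11 p12 p21 p22 where p: "\<And>x. x \<in> Iab a b \<Longrightarrow> u1 x = p11 * w1 x + p12 * w2 x"
      "\<And>x. x \<in> Iab a b \<Longrightarrow> u2 x = p21 * w1 x + p22 * w2 x"
      using change_of_basis[of w1 w2] w by blast
    \<comment> \<open>For y < x the triangular part \<open>u1 x * u2 y - u2 x * u1 y\<close> is
      absorbed into the matrix, which shifts \<open>m12\<close> by 1 and \<open>m21\<close> by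
      -1.\<close>
    obtain mplus :: "nat \<Rightarrow> nat \<Rightarrow> complex" where mplus: "\<And>v1 v2 w1 w2. m11 * (p11 * v1 + p12 * v2) * (p11 * w1 + p12 * w2)
      + (m12 + 1) * (p11 * v1 + p12 * v2) * (p21 * w1 + p22 * w2)
      + (m21 - 1) * (p21 * v1 + p22 * v2) * (p11 * w1 + p12 * w2) + m22 * (p21 * v1 + p22 * v2) * (p21 * w1 + p22 * w2)
      = mplus 1 1 * v1 * w1 + mplus 1 2 * v1 * w2 + mplus 2 1 * v2 * w1 + mplus 2 2 * v2 * w2"
      by (rule bilinear_coefficients[of m11 p11 p12 "m12 + 1" p21 p22 "m21 - 1" m22]) (rule that)
    obtain mminus :: "nat \<Rightarrow> nat \<Rightarrow> complex" where mminus: "\<And>v1 v2 w1 w2. m11 * (p11 * v1 + p12 * v2) * (p11 * w1 + p12 * w2)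
      + m12 * (p11 * v1 + p12 * v2) * (p21 * w1 + p22 * w2)
      + m21 * (p21 * v1 + p22 * v2) * (p11 * w1 + p12 * w2) + m22 * (p21 * v1 + p22 * v2) * (p21 * w1 + p22 * w2)
      = mminus 1 1 * v1 * w1 + mminus 1 2 * v1 * w2 + mminus 2 1 * v2 * w1 + mminus 2 2 * v2 * w2"
      by (rule bilinear_coefficients[of m11 p11 p12 m12 p21 p22 m21 m22]) (rule that)
    have "?G x y = (if y < x then
              mplus 1 1 * w1 x * w1 y + mplus 1 2 * w1 x * w2 y + mplus 2 1 * w2 x * w1 y + mplus 2 2 * w2 x * w2 y
            else
              mminus 1 1 * w1 x * w1 y + mminus 1 2 * w1 x * w2 y + mminus 2 1 * w2 x * w1 y + mminus 2 2 * w2 x * w2 y)"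
      if x: "x \<in> Iab a b" and y: "y \<in> Iab a b" for x y
    proof -
      have "?G x y = (if y < x then
          m11 * u1 x * u1 y + (m12 + 1) * u1 x * u2 y + (m21 - 1) * u2 x * u1 y + m22 * u2 x * u2 y
        else m11 * u1 x * u1 y + m12 * u1 x * u2 y + m21 * u2 x * u1 y + m22 * u2 x * u2 y)"
        by (simp add: green_def algebra_simps)
      then show ?thesis unfolding p[OF x] p[OF y] mplus mminus .
    qed
    then show "\<exists>(mplus :: nat \<Rightarrow> nat \<Rightarrow> complex) (mminus :: nat \<Rightarrow> nat \<Rightarrow> complex). \<forall>x\<in>Iab a b. \<forall>y\<in>Iab a b.
           ?G x y = (if y < x then
              mplus 1 1 * w1 x * w1 y + mplus 1 2 * w1 x * w2 y + mplus 2 1 * w2 x * w1 y + mplus 2 2 * w2 x * w2 y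
            else
              mminus 1 1 * w1 x * w1 y + mminus 1 2 * w1 x * w2 y + mminus 2 1 * w2 x * w1 y + mminus 2 2 * w2 x * w2 y)"
      by blast
  qed
qed

end
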